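(* Let $X$ be an infinite-dimensional complex Banach space and $T\in L(X)$. Then for each $\mathbf R$ among $\mathcal B_+$, $\mathcal B_-$, $\mathcal B$, $\Phi_+$, $\Phi_-$, $\Phi$, $\mathcal W_+$, $\mathcal W_-$, $\mathcal W$, $$\partial\sigma_{\mathbf R}(T)\cap\operatorname{acc}\sigma_{\mathbf R}(T)\subset\sigma_{gKR}(T),$$ and moreover $$\partial\sigma_{ap}(T)\cap\operatorname{acc}\sigma_{\mathcal B_+}(T)\subset\sigma_{gKR}(T),\quad \partial\sigma_{su}(T)\cap\operatorname{acc}\sigma_{\mathcal B_-}(T)\subset\sigma_{gKR}(T),\quad \partial\sigma(T)\cap\operatorname{acc}\sigma_{\mathcal B}(T)\subset\sigma_{gKR}(T).$$
   Context: $S$ is Kato if $R(S)$ is closed and $N(S)\subset R(S^n)$ for all $n$; $S$ is Riesz if $S-\lambda$ is Fredholm for all $\lambda\ne0$. $\sigma_{gKR}(T)$ is the set of $\lambda\in\mathbb C$ for which there are no closed $(T-\lambda)$-invariant $M,N$ with $X=M\oplus N$, $(T-\lambda)_M$ Kato and $(T-\lambda)_N$ Riesz. $\Phi_+$: finite-dimensional kernel and closed range; $\Phi_-$: finite-codimensional range; $\Phi=\Phi_+\cap\Phi_-$; $\mathcal W_+$, $\mathcal W_-$, $\mathcal W$: operators in $\Phi_+$, $\Phi_-$, $\Phi$ with index $\le0$, $\ge0$, $=0$; $\mathcal B_+$: $\Phi_+$ with finite ascent; $\mathcal B_-$: $\Phi_-$ with finite descent; $\mathcal B$: Fredholm with finite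 ascent and descent. $\sigma_{\mathbf R}(T)=\{\lambda:T-\lambda\notin\mathbf R\}$; $\sigma_{ap}(T)$ ($\sigma_{su}(T)$): $T-\lambda$ not bounded below (not surjective). $\partial$, $\operatorname{acc}$: boundary, accumulation points. *)

theory Defs
  imports "HOL-Analysis.Analysis"
begin

class complex_banach = banach +
  fixes scaleC :: "complex \<Rightarrow> 'a \<Rightarrow> 'a"
  assumes scaleC_add_right: "scaleC a (x + y) = scaleC a x + scaleC a y"
    and scaleC_add_left: "scaleC (a + b) x = scaleC a x + scaleC b x"
    and scaleC_scaleC: "scaleC a (scaleC b x) = scaleC (a * b) x"
    and scaleC_one: "scaleC 1 x = x"
    and scaleC_of_real: "scaleC (complex_of_real r) x = scaleR r x"
    and norm_scaleC: "norm (scaleC a x) = cmod a * norm x"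

instantiation complex :: complex_banach
begin
definition scaleC_complex :: "complex \<Rightarrow> complex \<Rightarrow> complex" where
  "scaleC_complex a x = a * x"
instance
  by standard (auto simp: scaleC_complex_def algebra_simps scaleR_conv_of_real norm_mult)
end

definition bounded_clinear :: "('a::complex_banach \<Rightarrow> 'a) \<Rightarrow> bool" where
  "bounded_clinear T \<longleftrightarrow> (\<forall>x y. T (x + y) = T x + T y) \<and> (\<forall>c x. T (scaleC c x) = scaleC c (T x))
     \<and> (\<exists>K. \<forall>x. norm (T x) \<le> norm x * K)"

definition csubspace :: "'a::complex_banach set \<Rightarrow> bool" where
  "csubspace V \<longleftrightarrow> 0 \<in> V \<and> (\<forall>x\<in>V. \<forall>y\<in>V. x + y \<in> V) \<and> (\<forall>c. \<forall>x\<in>V. scaleC c x \<in> V)"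

definition cspan :: "'a::complex_banach set \<Rightarrow> 'a set" where
  "cspan B = {\<Sum>b\<in>F. scaleC (c b) b | F c. finite F \<and> F \<subseteq> B}"

definition cfinite_dim :: "'a::complex_banach set \<Rightarrow> bool" where
  "cfinite_dim V \<longleftrightarrow> (\<exists>B. finite B \<and> cspan B = V)"

definition cdim :: "'a::complex_banach set \<Rightarrow> nat" where
  "cdim V = (LEAST n. \<exists>B. finite B \<and> card B = n \<and> cspan B = V)"

definition fin_codim :: "'a::complex_banach set \<Rightarrow> 'a set \<Rightarrow> bool" where
  "fin_codim V R \<longleftrightarrow> (\<exists>B. finite B \<and> B \<subseteq> V \<and> V = {r + y | r y. r \<in> R \<and> y \<in> cspan B})"

definition codim :: "'a::complex_banach set \<Rightarrow> 'a set \<Rightarrow> nat" where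
  "codim V R = (LEAST n. \<exists>B. finite B \<and> card B = n \<and> B \<subseteq> V \<and> V = {r + y | r y. r \<in> R \<and> y \<in> cspan B})"

section \<open>Operators restricted to an (invariant, closed) subspace V\<close>

definition kern :: "'a::complex_banach set \<Rightarrow> ('a \<Rightarrow> 'a) \<Rightarrow> 'a set" where
  "kern V S = {x \<in> V. S x = 0}"

definition rng :: "'a::complex_banach set \<Rightarrow> ('a \<Rightarrow> 'a) \<Rightarrow> 'a set" where
  "rng V S = S ` V"

definition Phi_plus :: "'a::complex_banach set \<Rightarrow> ('a \<Rightarrow> 'a) \<Rightarrow> bool" where
  "Phi_plus V S \<longleftrightarrow> cfinite_dim (kern V S) \<and> closed (rng V S)"

definition Phi_minus :: "'a::complex_banach set \<Rightarrow> ('a \<Rightarrow> 'a) \<Rightarrow> bool" where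
  "Phi_minus V S \<longleftrightarrow> fin_codim V (rng V S)"

definition Phi :: "'a::complex_banach set \<Rightarrow> ('a \<Rightarrow> 'a) \<Rightarrow> bool" where
  "Phi V S \<longleftrightarrow> Phi_plus V S \<and> Phi_minus V S"

text \<open>index \<le> 0 (index is -\<infinity> if the codimension is infinite)\<close>
definition W_plus :: "'a::complex_banach set \<Rightarrow> ('a \<Rightarrow> 'a) \<Rightarrow> bool" where
  "W_plus V S \<longleftrightarrow> Phi_plus V S \<and>
     (\<not> fin_codim V (rng V S) \<or> cdim (kern V S) \<le> codim V (rng V S))"

text \<open>index \<ge> 0 (index is +\<infinity> if the kernel is infinite-dimensional)\<close>
definition W_minus :: "'a::complex_banach set \<Rightarrow> ('a \<Rightarrow> 'a) \<Rightarrow> bool" where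
  "W_minus V S \<longleftrightarrow> Phi_minus V S \<and>
     (\<not> cfinite_dim (kern V S) \<or> cdim (kern V S) \<ge> codim V (rng V S))"

definition W :: "'a::complex_banach set \<Rightarrow> ('a \<Rightarrow> 'a) \<Rightarrow> bool" where
  "W V S \<longleftrightarrow> Phi V S \<and> cdim (kern V S) = codim V (rng V S)"

definition finite_ascent :: "'a::complex_banach set \<Rightarrow> ('a \<Rightarrow> 'a) \<Rightarrow> bool" where
  "finite_ascent V S \<longleftrightarrow> (\<exists>p. kern V (S ^^ p) = kern V (S ^^ Suc p))"

definition finite_descent :: "'a::complex_banach set \<Rightarrow> ('a \<Rightarrow> 'a) \<Rightarrow> bool" where
  "finite_descent V S \<longleftrightarrow> (\<exists>q. rng V (S ^^ q) = rng V (S ^^ Suc q))"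

definition B_plus :: "'a::complex_banach set \<Rightarrow> ('a \<Rightarrow> 'a) \<Rightarrow> bool" where
  "B_plus V S \<longleftrightarrow> Phi_plus V S \<and> finite_ascent V S"

definition B_minus :: "'a::complex_banach set \<Rightarrow> ('a \<Rightarrow> 'a) \<Rightarrow> bool" where
  "B_minus V S \<longleftrightarrow> Phi_minus V S \<and> finite_descent V S"

definition Browder :: "'a::complex_banach set \<Rightarrow> ('a \<Rightarrow> 'a) \<Rightarrow> bool" where
  "Browder V S \<longleftrightarrow> Phi V S \<and> finite_ascent V S \<and> finite_descent V S"

definition Kato :: "'a::complex_banach set \<Rightarrow> ('a \<Rightarrow> 'a) \<Rightarrow> bool" where
  "Kato V S \<longleftrightarrow> closed (rng V S) \<and> (\<forall>n. kern V S \<subseteq> rng V (S ^^ n))"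

definition Riesz :: "'a::complex_banach set \<Rightarrow> ('a \<Rightarrow> 'a) \<Rightarrow> bool" where
  "Riesz V S \<longleftrightarrow> (\<forall>\<mu>. \<mu> \<noteq> 0 \<longrightarrow> Phi V (\<lambda>x. S x - scaleC \<mu> x))"

definition shiftop :: "('a::complex_banach \<Rightarrow> 'a) \<Rightarrow> complex \<Rightarrow> 'a \<Rightarrow> 'a" where
  "shiftop T l = (\<lambda>x. T x - scaleC l x)"

definition sigma_R :: "('a::complex_banach set \<Rightarrow> ('a \<Rightarrow> 'a) \<Rightarrow> bool) \<Rightarrow> ('a \<Rightarrow> 'a) \<Rightarrow> complex set" where
  "sigma_R R T = {l. \<not> R UNIV (shiftop T l)}"

definition sigma_ap :: "('a::complex_banach \<Rightarrow> 'a) \<Rightarrow> complex set" where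
  "sigma_ap T = {l. \<not> (\<exists>c>0. \<forall>x. c * norm x \<le> norm (shiftop T l x))}"

definition sigma_su :: "('a::complex_banach \<Rightarrow> 'a) \<Rightarrow> complex set" where
  "sigma_su T = {l. \<not> surj (shiftop T l)}"

definition spectrum :: "('a::complex_banach \<Rightarrow> 'a) \<Rightarrow> complex set" where
  "spectrum T = {l. \<not> (\<exists>S. bounded_clinear S \<and> S \<circ> shiftop T l = id \<and> shiftop T l \<circ> S = id)}"

definition sigma_gKR :: "('a::complex_banach \<Rightarrow> 'a) \<Rightarrow> complex set" where
  "sigma_gKR T = {l. \<not> (\<exists>M N. closed M \<and> closed N \<and> csubspace M \<and> csubspace N
       \<and> shiftop T l ` M \<subseteq> M \<and> shiftop T l ` N \<subseteq> N
       \<and> M \<inter> N = {0} \<and> (\<forall>x. \<exists>m\<in>M. \<exists>n\<in>N. x = m + n)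
       \<and> Kato M (shiftop T l) \<and> Riesz N (shiftop T l))}"

definition acc :: "complex set \<Rightarrow> complex set" where
  "acc S = {z. z islimpt S}"

end

theory Submission
  imports Defs
begin

text \<open>
  Let \<open>A = T - z\<close> with \<open>z\<close> outside the generalized Kato-Riesz spectrum, and let \<open>A\<close> be Kato on \<open>M\<close> and Riesz on \<open>N\<close>
  with \<open>X = M \<oplus> N\<close>. For small \<open>l\<close> the operator \<open>A - l\<close> stays Kato on \<open>M\<close>, and the dimension of its kernel and
  the codimension of its range on \<open>M\<close> do not depend on \<open>l\<close>. A Kato operator with finite ascent is injective, and one
  with finite descent is surjective, so on \<open>M\<close> membership in each of the classes is decided by these two numbers. On \<open>N\<close>
  the operator \<open>A - l\<close> is Browder of index zero for every \<open>l \<noteq> 0\<close>, and also for \<open>l = 0\<close> as soon as it is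
  semi-Fredholm. Hence one \<open>l\<close> in a small disc for which \<open>A - l\<close> belongs to the class forces this for all nonzero \<open>l\<close>
  in the disc, which is impossible if \<open>z\<close> is both a boundary point and an accumulation point of the spectrum.

  For a semi-Fredholm operator, some power has a range on which the operator is Kato. Together with the constancy
  of dimensions this replaces the classical punctured neighbourhood and index theorems.
\<close>

section \<open>Open mapping onto closed subspaces\<close>

text \<open>Two obstacles shape the proof. The point of a small disc at which the operator belongs
  to the class may be the centre \<open>z\<close> itself, so the dimensions on \<open>M\<close> must
  be constant on the full disc, and the part on \<open>N\<close> must also be treated at
  \<open>l = 0\<close>, about which the Riesz condition says nothing. Moreover these dimensions may
  be infinite: an operator in \<open>Phi_minus\<close> may have an infinite-dimensional kernel. The
  index is therefore never formed as a difference. Dimensions are compared in \<open>enat\<close>,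
  and what is carried through the disc is the statement \<open>enat n \<le> q l\<close> for each
  finite \<open>n\<close>; connectedness then replaces continuity, provided that all constants are
  uniform in the base point. The subspaces \<open>M\<close>, \<open>N\<close> and the ranges of
  powers are sets inside one Banach space, so the open mapping theorem is needed between closed
  subspaces. It is used in its quantitative form, as a lift with a norm bound; such a lift is both a
  consequence of closed range and the means of proving it.\<close>

lemma approximate_lift_imp_lift:
  fixes S :: "'b::banach \<Rightarrow> 'a::real_normed_vector" and W :: "'a set"
  assumes S: "bounded_linear S" and V: "closed V" "subspace V" and C: "C \<ge> 0"
    and ap: "\<And>y. y \<in> W \<Longrightarrow> \<exists>x\<in>V. norm x \<le> C * norm y \<and> y - S x \<in> W \<and> norm (y - S x) \<le> norm y / 2"
    and y: "y \<in> W"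
  shows "\<exists>x\<in>V. S x = y \<and> norm x \<le> 2 * C * norm y"
proof -
  interpret bounded_linear S by fact
  obtain f where f: "\<And>y. y \<in> W \<Longrightarrow> f y \<in> V \<and> norm (f y) \<le> C * norm y \<and> y - S (f y) \<in> W \<and> norm (y - S (f y)) \<le> norm y / 2"
    using ap by metis
  \<comment> \<open>\<open>r\<close> is the sequence of residuals of successive approximation. They
    halve at each step, so the corrections form a geometric series; its sum is the factor 2 in the
    bound. \<open>W\<close> only has to be stable under taking residuals, so it can be an image, a
    closure of an image, or an invariant subspace.\<close>
  define r where "r = rec_nat y (\<lambda>_ z. z - S (f z))"
  have r0: "r 0 = y" and rS: "\<And>n. r (Suc n) = r n - S (f (r n))"
    by (simp_all add: r_def)
  have rW: "r n \<in> W" for n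
    by (induction n) (use y f in \<open>auto simp: r0 rS\<close>)
  have rn: "norm (r n) \<le> norm y * (1/2) ^ n" for n
  proof (induction n)
    case (Suc n)
    have "norm (r (Suc n)) \<le> norm (r n) / 2"
      using f[OF rW[of n]] by (simp add: rS)
    then show ?case using Suc by simp
  qed (simp add: r0)
  have fb: "norm (f (r n)) \<le> C * norm y * (1/2) ^ n" for n
    using f[OF rW[of n]] mult_left_mono[OF rn[of n] C] by (simp add: mult.assoc)
  have gs: "(\<lambda>n. C * norm y * (1/2) ^ n) sums (C * norm y * 2)"
    using sums_mult[OF geometric_sums[of "1/2::real"], of "C * norm y"] by simp
  have sn: "summable (\<lambda>n. norm (f (r n)))"
    using fb by (intro summable_comparison_test'[OF sums_summable[OF gs]]) auto
  then have sf: "summable (\<lambda>n. f (r n))" by (rule summable_norm_cancel)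
  define x where "x = (\<Sum>n. f (r n))"
  have lx: "(\<lambda>n. \<Sum>i<n. f (r i)) \<longlonglongrightarrow> x"
    using summable_LIMSEQ[OF sf] by (simp add: x_def)
  have "x \<in> V"
    by (rule closed_sequentially[OF V(1) _ lx]) (auto intro!: subspace_sum[OF V(2)] simp: f rW)
  have part: "S (\<Sum>i<n. f (r i)) = y - r n" for n
    by (induction n) (simp_all add: r0 rS add zero)
  have "r \<longlonglongrightarrow> 0"
  proof (rule Lim_null_comparison)
    show "\<forall>\<^sub>F n in sequentially. norm (r n) \<le> norm y * (1/2) ^ n"
      using rn by (intro always_eventually allI)
    show "(\<lambda>n. norm y * (1/2) ^ n) \<longlonglongrightarrow> 0"
      by (intro tendsto_mult_right_zero LIMSEQ_realpow_zero) auto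
  qed
  then have "(\<lambda>n. S (\<Sum>i<n. f (r i))) \<longlonglongrightarrow> y"
    unfolding part using tendsto_diff[OF tendsto_const, of r 0 sequentially y] by simp
  moreover have "(\<lambda>n. S (\<Sum>i<n. f (r i))) \<longlonglongrightarrow> S x"
    by (rule tendsto[OF lx])
  ultimately have "S x = y" by (rule LIMSEQ_unique[symmetric])
  moreover have "norm x \<le> 2 * C * norm y"
  proof -
    have "norm x \<le> (\<Sum>n. norm (f (r n)))"
      unfolding x_def by (rule summable_norm[OF sn])
    also have "\<dots> \<le> (\<Sum>n. C * norm y * (1/2) ^ n)"
      by (rule suminf_le[OF fb sn sums_summable[OF gs]])
    also have "\<dots> = 2 * C * norm y" using sums_unique[OF gs] by simp
    finally show ?thesis .
  qed
  ultimately show ?thesis using \<open>x \<in> V\<close> by blast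
qed

lemma open_mapping_closed_subspace:
  fixes S :: "'b::banach \<Rightarrow> 'a::banach"
  assumes S: "bounded_linear S" and V: "closed V" "subspace V" and cl: "closed (S ` V)"
  shows "\<exists>C>0. \<forall>y\<in>S ` V. \<exists>x\<in>V. S x = y \<and> norm x \<le> C * norm y"
proof -
  interpret bounded_linear S by fact
  define W where "W = S ` V"
  have W: "subspace W" unfolding W_def by (rule linear_subspace_image[OF linear V(2)])
  have W0: "0 \<in> W" using W by (rule subspace_0)
  define T where "T = (\<lambda>n::nat. closure (S ` (V \<inter> cball 0 (real n))))"
  have TW: "T n \<subseteq> W" for n
    unfolding T_def W_def by (rule closure_minimal[OF _ cl]) auto
  have UT: "\<Union>(range T) = W"
  proof
    show "W \<subseteq> \<Union>(range T)"
    proof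
      fix w assume "w \<in> W"
      then obtain v where v: "v \<in> V" "w = S v" by (auto simp: W_def)
      obtain n where "norm v \<le> real n" using real_arch_simple by blast
      then have "w \<in> S ` (V \<inter> cball 0 (real n))" using v by auto
      then have "w \<in> T n" unfolding T_def by (rule closure_subset[THEN subsetD])
      then show "w \<in> \<Union>(range T)" by blast
    qed
  qed (use TW in auto)
  have "\<exists>n. (top_of_set W) interior_of (T n) \<noteq> {}"
  proof (rule ccontr)
    assume "\<not> ?thesis"
    moreover have "completely_metrizable_space (top_of_set W)"
      by (rule completely_metrizable_space_closedin[OF completely_metrizable_space_euclidean])
        (use cl in \<open>simp add: W_def\<close>)
    moreover have "closedin (top_of_set W) (T n)" for n
      by (rule closed_subset[OF TW]) (simp add: T_def)
    ultimately have "(top_of_set W) interior_of \<Union>(range T) = {}"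
      by (intro Baire_category_alt) auto
    moreover have "(top_of_set W) interior_of W = W"
      by (simp add: interior_of_openin)
    ultimately show False using W0 UT by auto
  qed
  then obtain n w0 where "w0 \<in> (top_of_set W) interior_of (T n)" by blast
  then obtain U where U: "openin (top_of_set W) U" "w0 \<in> U" "U \<subseteq> T n"
    by (auto simp: interior_of_def)
  then obtain e where e: "e > 0" "ball w0 e \<inter> W \<subseteq> U"
    unfolding openin_contains_ball by blast
  have w0W: "w0 \<in> W" using U by (auto dest: openin_imp_subset)
  \<comment> \<open>\<open>y\<close> is the difference of \<open>w0 + y\<close> and
    \<open>w0\<close>, both approximable from the ball of radius \<open>n\<close>; hence the radius
    \<open>2 * real n\<close>.\<close>
  have small: "\<exists>x\<in>V. norm x \<le> 2 * real n \<and> norm (y - S x) \<le> d"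
    if y: "y \<in> W" "norm y < e" and d: "d > 0" for y d
  proof -
    have "w0 + y \<in> ball w0 e \<inter> W"
      using y w0W by (auto simp: dist_norm subspace_add[OF W])
    then have "w0 + y \<in> T n" "w0 \<in> T n"
      using e U by blast+
    then obtain a b where a: "a \<in> V" "norm a \<le> real n" "dist (S a) (w0 + y) < d/2"
       and b: "b \<in> V" "norm b \<le> real n" "dist (S b) w0 < d/2"
      unfolding T_def closure_approachable using d by (force dest!: spec[of _ "d/2"])
    have "norm (y - S (a - b)) \<le> dist (S a) (w0 + y) + dist (S b) w0"
      using norm_triangle_ineq[of "w0 + y - S a" "S b - w0"] by (simp add: diff dist_norm norm_minus_commute algebra_simps)
    moreover have "norm (a - b) \<le> 2 * real n" using norm_triangle_ineq4[of a b] a b by simp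
    moreover have "a - b \<in> V" using a b by (auto intro: subspace_diff[OF V(2)])
    ultimately show ?thesis using a b d by (intro bexI[of _ "a - b"]) auto
  qed
  \<comment> \<open>The preimage bound \<open>2 * real n\<close> is divided by the scaling factor
    \<open>k\<close> below, which gives \<open>4 * real n / e\<close>. The summand 1 keeps
    \<open>C\<close> positive when \<open>n = 0\<close>.\<close>
  define C where "C = 4 * real n / e + 1"
  have C: "C \<ge> 0" "C > 0" using e by (auto simp: C_def intro: add_nonneg_pos)
  have ap: "\<exists>x\<in>V. norm x \<le> C * norm y \<and> y - S x \<in> W \<and> norm (y - S x) \<le> norm y / 2" if y: "y \<in> W" for y
  proof (cases "y = 0")
    case True
    then show ?thesis using V(2) W0 by (intro bexI[of _ 0]) (auto simp: zero subspace_0)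
  next
    case False
    \<comment> \<open>\<open>k\<close> brings \<open>y\<close> to norm \<open>e / 2\<close>, inside
      the ball of radius \<open>e\<close>; the error \<open>e / 4\<close> is then half of the norm,
      as the iteration demands.\<close>
    define k where "k = e / (2 * norm y)"
    have k: "k > 0" using False e by (simp add: k_def)
    have "norm (k *\<^sub>R y) < e" using False e by (simp add: k_def)
    moreover have "k *\<^sub>R y \<in> W" by (rule subspace_scale[OF W y])
    ultimately obtain x where x: "x \<in> V" "norm x \<le> 2 * real n" "norm (k *\<^sub>R y - S x) \<le> e / 4"
      using small[of "k *\<^sub>R y" "e/4"] e by auto
    define x' where "x' = (1/k) *\<^sub>R x"
    have x'V: "x' \<in> V" unfolding x'_def by (rule subspace_scale[OF V(2) x(1)])
    have "norm x' \<le> C * norm y"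
    proof -
      have "norm x' = norm x / k" using k by (simp add: x'_def)
      also have "\<dots> \<le> 2 * real n / k" using x k by (simp add: divide_right_mono)
      also have "\<dots> = 4 * real n / e * norm y" using e False by (simp add: k_def field_simps)
      also have "\<dots> \<le> C * norm y" by (simp add: C_def algebra_simps)
      finally show ?thesis .
    qed
    moreover have "y - S x' \<in> W" using x'V y by (intro subspace_diff[OF W]) (auto simp: W_def)
    moreover have "norm (y - S x') \<le> norm y / 2"
    proof -
      have "y - S x' = (1/k) *\<^sub>R (k *\<^sub>R y - S x)" using k by (simp add: x'_def scaleR scaleR_right_diff_distrib)
      then have "norm (y - S x') = norm (k *\<^sub>R y - S x) / k" using k by simp
      also have "\<dots> \<le> (e/4) / k" by (rule divide_right_mono[OF x(3)]) (use k in simp)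
      also have "\<dots> = norm y / 2" using e False by (simp add: k_def field_simps)
      finally show ?thesis .
    qed
    ultimately show ?thesis using x'V by blast
  qed
  show ?thesis
  proof (intro exI[of _ "2 * C"] conjI ballI)
    fix y assume "y \<in> S ` V"
    then show "\<exists>x\<in>V. S x = y \<and> norm x \<le> 2 * C * norm y"
      using approximate_lift_imp_lift[OF S V C(1) ap, of y] by (simp add: W_def)
  qed (use C in simp)
qed

lemma subspace_closure:
  fixes V :: "'a::real_normed_vector set"
  assumes "subspace V"
  shows "subspace (closure V)"
proof (rule subspaceI)
  show "0 \<in> closure V" using subspace_0[OF assms] closure_subset by blast
next
  fix x y assume "x \<in> closure V" "y \<in> closure V"
  then obtain f g where f: "\<And>n. f n \<in> V" "f \<longlonglongrightarrow> x" and g: "\<And>n. g n \<in> V" "g \<longlonglongrightarrow> y"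
    unfolding closure_sequential by blast
  have "(\<lambda>n. f n + g n) \<longlonglongrightarrow> x + y" using f g by (intro tendsto_add)
  moreover have "f n + g n \<in> V" for n using f g assms by (simp add: subspace_add)
  ultimately show "x + y \<in> closure V" unfolding closure_sequential by (intro exI[of _ "\<lambda>n. f n + g n"]) simp
next
  fix c x assume "x \<in> closure V"
  then obtain f where f: "\<And>n. f n \<in> V" "f \<longlonglongrightarrow> x"
    unfolding closure_sequential by blast
  have "(\<lambda>n. c *\<^sub>R f n) \<longlonglongrightarrow> c *\<^sub>R x" using f by (intro tendsto_scaleR tendsto_const)
  moreover have "c *\<^sub>R f n \<in> V" for n using f assms by (simp add: subspace_scale)
  ultimately show "c *\<^sub>R x \<in> closure V" unfolding closure_sequential by (intro exI[of _ "\<lambda>n. c *\<^sub>R f n"]) simp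
qed

text \<open>Converse of the open mapping bound: a point \<open>y\<close> of the closure is within
  half its norm of an image point \<open>z\<close>, and lifting \<open>z\<close> costs at most
  \<open>2 * C * norm y\<close>. The iteration with \<open>W\<close> the closure then shows that
  \<open>y\<close> is itself an image.\<close>

lemma lift_imp_closed_image:
  fixes S :: "'b::banach \<Rightarrow> 'a::real_normed_vector"
  assumes S: "bounded_linear S" and V: "closed V" "subspace V" and C: "C \<ge> 0"
    and lift: "\<And>y. y \<in> S ` V \<Longrightarrow> \<exists>x\<in>V. S x = y \<and> norm x \<le> C * norm y"
  shows "closed (S ` V)"
proof -
  interpret bounded_linear S by fact
  have W: "subspace (closure (S ` V))"
    by (rule subspace_closure[OF linear_subspace_image[OF linear V(2)]])
  have ap: "\<exists>x\<in>V. norm x \<le> 2 * C * norm y \<and> y - S x \<in> closure (S ` V) \<and> norm (y - S x) \<le> norm y / 2"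
    if y: "y \<in> closure (S ` V)" for y
  proof (cases "y = 0")
    case True
    then show ?thesis using V(2) W by (intro bexI[of _ 0]) (auto simp: zero subspace_0)
  next
    case False
    then obtain z where z: "z \<in> S ` V" "dist z y < norm y / 2"
      using y unfolding closure_approachable by (metis half_gt_zero zero_less_norm_iff)
    obtain x where x: "x \<in> V" "S x = z" "norm x \<le> C * norm z" using lift[OF z(1)] by blast
    have "norm z \<le> 2 * norm y"
      using z(2)[unfolded dist_norm] norm_triangle_ineq[of "z - y" y] norm_ge_zero[of y]
      unfolding diff_add_cancel by linarith
    then have "norm x \<le> C * (2 * norm y)" using x(3) C by (meson mult_left_mono order_trans)
    moreover have "y - S x \<in> closure (S ` V)"
      using subspace_diff[OF W y] x(1) closure_subset by blast
    ultimately show ?thesis using x z(2) by (intro bexI[of _ x]) (auto simp: dist_norm norm_minus_commute)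
  qed
  have "closure (S ` V) \<subseteq> S ` V"
    using approximate_lift_imp_lift[OF S V _ ap] C by fastforce
  then show ?thesis by (simp add: closure_subset_eq)
qed

section \<open>Complex linear algebra and relative dimension\<close>

interpretation cvs: vector_space "scaleC :: complex \<Rightarrow> 'a::complex_banach \<Rightarrow> 'a"
  by standard (simp_all add: scaleC_add_right scaleC_add_left scaleC_scaleC scaleC_one)

interpretation cvs_pair: vector_space_pair "scaleC :: complex \<Rightarrow> 'a::complex_banach \<Rightarrow> 'a"
    "scaleC :: complex \<Rightarrow> 'a \<Rightarrow> 'a" ..

abbreviation clinear :: "('a::complex_banach \<Rightarrow> 'a) \<Rightarrow> bool" where
  "clinear \<equiv> Vector_Spaces.linear scaleC scaleC"

lemma csubspace_iff: "csubspace V \<longleftrightarrow> cvs.subspace V"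
  by (auto simp: csubspace_def cvs.subspace_def)

lemma cspan_eq_span: "cspan B = cvs.span B"
  unfolding cspan_def cvs.span_explicit by blast

lemma csubspace_0: "csubspace V \<Longrightarrow> 0 \<in> V"
  and csubspace_add: "csubspace V \<Longrightarrow> x \<in> V \<Longrightarrow> y \<in> V \<Longrightarrow> x + y \<in> V"
  and csubspace_diff: "csubspace V \<Longrightarrow> x \<in> V \<Longrightarrow> y \<in> V \<Longrightarrow> x - y \<in> V"
  and csubspace_neg: "csubspace V \<Longrightarrow> x \<in> V \<Longrightarrow> - x \<in> V"
  and csubspace_scale: "csubspace V \<Longrightarrow> x \<in> V \<Longrightarrow> scaleC c x \<in> V"
  and csubspace_sum: "csubspace V \<Longrightarrow> (\<And>i. i \<in> A \<Longrightarrow> g i \<in> V) \<Longrightarrow> sum g A \<in> V"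
  by (auto simp: csubspace_iff cvs.subspace_0 cvs.subspace_add cvs.subspace_diff cvs.subspace_neg
      cvs.subspace_scale intro: cvs.subspace_sum)

lemma csubspace_scale_iff: "csubspace V \<Longrightarrow> c \<noteq> 0 \<Longrightarrow> scaleC c x \<in> V \<longleftrightarrow> x \<in> V"
  using csubspace_scale[of V "scaleC c x" "inverse c"] csubspace_scale[of V x c]
  by auto

lemma csubspace_add_right_iff: "csubspace V \<Longrightarrow> y \<in> V \<Longrightarrow> x + y \<in> V \<longleftrightarrow> x \<in> V"
  using csubspace_add csubspace_diff by fastforce

lemma csubspace_imp_subspace: "csubspace V \<Longrightarrow> subspace V"
  unfolding subspace_def csubspace_def scaleC_of_real[symmetric] by blast

lemma csubspace_single_0 [simp]: "csubspace {0}" and csubspace_UNIV [simp]: "csubspace UNIV"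
  by (simp_all add: csubspace_iff cvs.subspace_single_0)

lemma csubspace_cspan: "csubspace (cspan B)"
  by (simp add: csubspace_iff cspan_eq_span)

lemma csubspace_sums: "csubspace U \<Longrightarrow> csubspace V \<Longrightarrow> csubspace {u + v | u v. u \<in> U \<and> v \<in> V}"
  by (simp add: csubspace_iff cvs.subspace_sums)

lemma csubspace_inter: "csubspace U \<Longrightarrow> csubspace V \<Longrightarrow> csubspace (U \<inter> V)"
  by (simp add: csubspace_iff cvs.subspace_inter)

lemma clinearI:
  "(\<And>x y. f (x + y) = f x + f y) \<Longrightarrow> (\<And>c x. f (scaleC c x) = scaleC c (f x)) \<Longrightarrow> clinear f"
  by unfold_locales (simp_all add: scaleC_add_right scaleC_add_left scaleC_scaleC scaleC_one)

lemma clinear_add: "clinear f \<Longrightarrow> f (x + y) = f x + f y"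
  and clinear_diff: "clinear f \<Longrightarrow> f (x - y) = f x - f y"
  and clinear_scale: "clinear f \<Longrightarrow> f (scaleC c x) = scaleC c (f x)"
  and clinear_0: "clinear f \<Longrightarrow> f 0 = 0"
  and clinear_sum: "clinear f \<Longrightarrow> f (sum g A) = (\<Sum>i\<in>A. f (g i))"
  by (simp_all add: cvs_pair.linear_add cvs_pair.linear_diff cvs_pair.linear_scale cvs_pair.linear_0 cvs_pair.linear_sum)

lemma csubspace_kern:
  assumes S: "clinear S" and "csubspace V"
  shows "csubspace (kern V S)"
  using assms(2) unfolding kern_def csubspace_def
  by (auto simp: clinear_add[OF S] clinear_scale[OF S] clinear_0[OF S])

lemma csubspace_rng: "clinear S \<Longrightarrow> csubspace V \<Longrightarrow> csubspace (rng V S)"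
  unfolding rng_def csubspace_iff by (rule cvs_pair.linear_subspace_image)

lemma clinear_id: "clinear (\<lambda>x. x)"
  by (rule clinearI) auto

lemma clinear_funpow:
  assumes S: "clinear S"
  shows "clinear (S ^^ n)"
proof (induction n)
  case (Suc n)
  show ?case
    by (rule clinearI) (simp_all add: clinear_add[OF Suc] clinear_scale[OF Suc] clinear_add[OF S] clinear_scale[OF S])
qed (simp add: clinear_id id_def)

text \<open>An algebraic projection along a complement spanned by part of a Hamel basis. It stands
  in for the quotient map by \<open>R\<close> and carries no continuity.\<close>

lemma exists_clinear_with_kernel:
  fixes R :: "'a::complex_banach set"
  assumes "csubspace R"
  obtains P where "clinear P" "\<And>x. P x = 0 \<longleftrightarrow> x \<in> R"
proof -
  obtain B where B: "B \<subseteq> R" "cvs.independent B" "R \<subseteq> cvs.span B"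
    by (rule cvs.maximal_independent_subset[of R])
  have RB: "R = cvs.span B"
    using B assms cvs.span_minimal[of B R] by (auto simp: csubspace_iff)
  obtain C where C: "B \<subseteq> C" "cvs.independent C" "UNIV \<subseteq> cvs.span C"
    by (rule cvs.maximal_independent_subset_extend[OF subset_UNIV B(2)])
  obtain P where P: "clinear P" "\<And>x. x \<in> C \<Longrightarrow> P x = (if x \<in> B then 0 else x)"
    using cvs_pair.linear_independent_extend[OF C(2), of "\<lambda>x. if x \<in> B then 0 else x"] by auto
  have "P x = 0 \<longleftrightarrow> x \<in> R" for x
  proof
    assume "P x = 0"
    obtain t u where t: "finite t" "t \<subseteq> C" "x = (\<Sum>a\<in>t. scaleC (u a) a)"
      using C(3) unfolding cvs.span_explicit by blast
    have "P x = (\<Sum>a\<in>t. scaleC (u a) (P a))"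
      unfolding t(3) by (simp add: clinear_sum[OF P(1)] clinear_scale[OF P(1)])
    also have "\<dots> = (\<Sum>a\<in>t - B. scaleC (u a) a)"
      using t P(2) by (intro sum.mono_neutral_cong_right) auto
    finally have "(\<Sum>a\<in>t - B. scaleC (u a) a) = 0" using \<open>P x = 0\<close> by simp
    then have u0: "\<And>a. a \<in> t - B \<Longrightarrow> u a = 0"
      using C(2) t unfolding cvs.independent_explicit_finite_subsets by (metis Diff_subset finite_Diff subset_trans)
    have xe: "x = (\<Sum>a\<in>t \<inter> B. scaleC (u a) a)"
      unfolding t(3) using t(1) by (intro sum.mono_neutral_right) (auto simp: u0)
    show "x \<in> R"
      unfolding RB xe by (intro cvs.span_sum cvs.span_scale cvs.span_base) auto
  next
    assume "x \<in> R"
    then have "x \<in> cvs.span B" by (simp add: RB)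
    then show "P x = 0"
    proof (induction rule: cvs.span_induct_alt)
      case (step c a y)
      then have "P a = 0" using P(2) C(1) by auto
      then show ?case using step by (simp add: clinear_add[OF P(1)] clinear_scale[OF P(1)])
    qed (simp add: clinear_0[OF P(1)])
  qed
  with P(1) that show thesis by blast
qed

section \<open>Dimension of a subspace relative to a smaller one\<close>

text \<open>Families instead of sets: repeated vectors count as dependent, and families can be
  concatenated or perturbed entry by entry.\<close>

definition indep_mod :: "'a::complex_banach set \<Rightarrow> nat \<Rightarrow> (nat \<Rightarrow> 'a) \<Rightarrow> bool" where
  "indep_mod R n v \<longleftrightarrow> (\<forall>c. (\<Sum>i<n. scaleC (c i) (v i)) \<in> R \<longrightarrow> (\<forall>i<n. c i = 0))"

text \<open>The dimension of \<open>V / R\<close>; quotient spaces are avoided. Kernel dimensions are \<open>qdim (kern V S) {0}\<close>,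
  codimensions of ranges are \<open>qdim V (rng V S)\<close>, so both obey the same additivity law.\<close>

definition qdim :: "'a::complex_banach set \<Rightarrow> 'a set \<Rightarrow> enat" where
  "qdim V R = (if fin_codim V R then enat (codim V R) else \<infinity>)"

lemma qdim_le_card:
  assumes "finite B" "B \<subseteq> V" "V = {r + y | r y. r \<in> R \<and> y \<in> cspan B}"
  shows "qdim V R \<le> enat (card B)"
proof -
  have "fin_codim V R" using assms unfolding fin_codim_def by blast
  moreover have "codim V R \<le> card B"
    unfolding codim_def by (rule Least_le) (use assms in blast)
  ultimately show ?thesis by (simp add: qdim_def)
qed

lemma qdim_finite_spanning:
  assumes "qdim V R = enat n"
  obtains B where "finite B" "card B = n" "B \<subseteq> V" "V = {r + y | r y. r \<in> R \<and> y \<in> cspan B}"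
proof -
  have f: "fin_codim V R" "codim V R = n" using assms by (auto simp: qdim_def split: if_splits)
  then have "\<exists>n B. finite B \<and> card B = n \<and> B \<subseteq> V \<and> V = {r + y | r y. r \<in> R \<and> y \<in> cspan B}"
    unfolding fin_codim_def by blast
  from LeastI_ex[OF this] have "\<exists>B. finite B \<and> card B = n \<and> B \<subseteq> V \<and> V = {r + y | r y. r \<in> R \<and> y \<in> cspan B}"
    using f(2) unfolding codim_def by simp
  then show thesis using that by blast
qed

lemma indep_mod_le_card:
  assumes R: "csubspace R" and B: "finite B" "V \<subseteq> {r + y | r y. r \<in> R \<and> y \<in> cspan B}"
    and v: "\<And>i. i < n \<Longrightarrow> v i \<in> V" "indep_mod R n v"
  shows "n \<le> card B"
proof -
  obtain P where P: "clinear P" "\<And>x. P x = 0 \<longleftrightarrow> x \<in> R"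
    using exists_clinear_with_kernel[OF R] by blast
  have zero: "c i = 0" if "(\<Sum>i<n. scaleC (c i) (P (v i))) = 0" "i < n" for c i
  proof -
    have "P (\<Sum>i<n. scaleC (c i) (v i)) = 0"
      using that(1) by (simp add: clinear_sum[OF P(1)] clinear_scale[OF P(1)])
    then show ?thesis using v(2) that(2) P(2) unfolding indep_mod_def by blast
  qed
  have inj: "inj_on (\<lambda>i. P (v i)) {..<n}"
  proof (rule inj_onI, rule ccontr)
    fix i j assume ij: "i \<in> {..<n}" "j \<in> {..<n}" "P (v i) = P (v j)" "i \<noteq> j"
    define c where "c = (\<lambda>k. if k = i then 1 else if k = j then -1 else 0 :: complex)"
    have "(\<Sum>k<n. scaleC (c k) (P (v k))) = (\<Sum>k\<in>{i,j}. scaleC (c k) (P (v k)))"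
      using ij by (intro sum.mono_neutral_right) (auto simp: c_def)
    also have "\<dots> = 0" using ij by (simp add: c_def)
    finally have "c i = 0" using zero ij by blast
    then show False by (simp add: c_def)
  qed
  have "cvs.independent ((\<lambda>i. P (v i)) ` {..<n})"
  proof (rule cvs.independent_if_scalars_zero)
    fix f x assume f: "(\<Sum>x\<in>(\<lambda>i. P (v i)) ` {..<n}. scaleC (f x) x) = 0" and x: "x \<in> (\<lambda>i. P (v i)) ` {..<n}"
    from f have "(\<Sum>i<n. scaleC (f (P (v i))) (P (v i))) = 0"
      by (simp add: sum.reindex[OF inj])
    then show "f x = 0" using zero[of "\<lambda>i. f (P (v i))"] x by auto
  qed simp
  moreover have "(\<lambda>i. P (v i)) ` {..<n} \<subseteq> cvs.span (P ` B)"
  proof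
    fix z assume "z \<in> (\<lambda>i. P (v i)) ` {..<n}"
    then obtain i where i: "i < n" "z = P (v i)" by auto
    then obtain r y where "v i = r + y" "r \<in> R" "y \<in> cspan B" using v(1)[OF i(1)] B(2) by blast
    then have "z = P y" "y \<in> cvs.span B" using P i by (auto simp: clinear_add[OF P(1)] cspan_eq_span)
    then show "z \<in> cvs.span (P ` B)" using cvs_pair.linear_span_image[OF P(1)] by auto
  qed
  ultimately have "card ((\<lambda>i. P (v i)) ` {..<n}) \<le> card (P ` B)"
    using cvs.independent_span_bound[of "P ` B"] B(1) by blast
  then show ?thesis using card_image[OF inj] card_image_le[OF B(1), of P] by simp
qed

lemma maximal_indep_mod_spans:
  assumes V: "csubspace V" and R: "csubspace R" "R \<subseteq> V"
    and v: "\<And>i. i < n \<Longrightarrow> v i \<in> V" "indep_mod R n v"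
    and max: "\<And>w. (\<And>i. i < Suc n \<Longrightarrow> w i \<in> V) \<Longrightarrow> \<not> indep_mod R (Suc n) w"
  shows "V = {r + y | r y. r \<in> R \<and> y \<in> cspan (v ` {..<n})}"
proof -
  have sub: "v ` {..<n} \<subseteq> V" using v(1) by auto
  show ?thesis
  proof
    have "cspan (v ` {..<n}) \<subseteq> V"
      using cvs.span_minimal[OF sub] V by (simp add: cspan_eq_span csubspace_iff)
    then show "{r + y | r y. r \<in> R \<and> y \<in> cspan (v ` {..<n})} \<subseteq> V"
      using R(2) csubspace_add[OF V] by blast
    show "V \<subseteq> {r + y | r y. r \<in> R \<and> y \<in> cspan (v ` {..<n})}"
    proof
      fix x assume x: "x \<in> V"
      have "\<not> indep_mod R (Suc n) (v(n := x))"
        by (rule max) (use v(1) x in auto)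
      then obtain c where c: "(\<Sum>i<Suc n. scaleC (c i) ((v(n := x)) i)) \<in> R" "\<exists>i<Suc n. c i \<noteq> 0"
        unfolding indep_mod_def by blast
      define s where "s = (\<Sum>i<n. scaleC (c i) (v i))"
      have s: "s + scaleC (c n) x \<in> R" using c(1) by (simp add: s_def)
      have "c n \<noteq> 0"
      proof
        assume "c n = 0"
        then have "s \<in> R" using s by simp
        then have "\<forall>i<n. c i = 0" using v(2) by (auto simp: indep_mod_def s_def)
        then show False using c(2) \<open>c n = 0\<close> less_Suc_eq by auto
      qed
      then have "x = scaleC (inverse (c n)) (s + scaleC (c n) x) + scaleC (- inverse (c n)) s"
        by (simp add: scaleC_add_right)
      moreover have "s \<in> cspan (v ` {..<n})"
        unfolding s_def cspan_eq_span by (intro cvs.span_sum cvs.span_scale cvs.span_base) auto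
      ultimately show "x \<in> {r + y | r y. r \<in> R \<and> y \<in> cspan (v ` {..<n})}"
        using csubspace_scale[OF R(1) s] csubspace_scale[OF csubspace_cspan] by blast
    qed
  qed
qed

text \<open>The bridge from spanning sets, by which \<open>qdim\<close> is defined, to independent
  families, which survive perturbation. Lower bounds always have finite witnesses, also when the
  dimension is infinite.\<close>

lemma qdim_ge_iff:
  assumes V: "csubspace V" and R: "csubspace R" "R \<subseteq> V"
  shows "enat n \<le> qdim V R \<longleftrightarrow> (\<exists>v. (\<forall>i<n. v i \<in> V) \<and> indep_mod R n v)"
proof
  assume "\<exists>v. (\<forall>i<n. v i \<in> V) \<and> indep_mod R n v"
  then obtain v where v: "\<And>i. i < n \<Longrightarrow> v i \<in> V" "indep_mod R n v" by blast
  show "enat n \<le> qdim V R"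
  proof (cases "qdim V R")
    case (enat m)
    then obtain B where "finite B" "card B = m" "B \<subseteq> V" "V = {r + y | r y. r \<in> R \<and> y \<in> cspan B}"
      by (rule qdim_finite_spanning)
    then show ?thesis using indep_mod_le_card[OF R(1) _ _ v] enat by auto
  qed simp
next
  assume n: "enat n \<le> qdim V R"
  show "\<exists>v. (\<forall>i<n. v i \<in> V) \<and> indep_mod R n v"
    using n
  proof (induction n)
    case 0
    then show ?case by (simp add: indep_mod_def)
  next
    case (Suc n)
    have "enat n \<le> qdim V R" using Suc.prems by (metis Suc_ile_eq order_less_imp_le)
    then obtain v where v: "\<And>i. i < n \<Longrightarrow> v i \<in> V" "indep_mod R n v" using Suc.IH by blast
    show ?case
    proof (rule ccontr)
      assume "\<not> ?thesis"
      then have "V = {r + y | r y. r \<in> R \<and> y \<in> cspan (v ` {..<n})}"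
        by (intro maximal_indep_mod_spans[OF V R v]) auto
      then have "qdim V R \<le> enat (card (v ` {..<n}))"
        using v(1) by (intro qdim_le_card) auto
      also have "\<dots> \<le> enat n" using card_image_le[of "{..<n}" v] by simp
      finally have "qdim V R \<le> enat n" .
      then show False using Suc.prems by (meson Suc_ile_eq leD)
    qed
  qed
qed

lemma enat_eqI:
  fixes a b :: enat
  assumes n: "\<And>n. enat n \<le> a \<longleftrightarrow> enat n \<le> b"
  shows "a = b"
proof (cases a)
  case (enat k)
  show ?thesis
  proof (cases b)
    case (enat l)
    then show ?thesis using n[of k] n[of l] \<open>a = enat k\<close> by simp
  qed (use n[of "Suc k"] enat in simp)
next
  case infinity
  show ?thesis
  proof (cases b)
    case (enat l)
    then show ?thesis using n[of "Suc l"] infinity by simp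
  qed (use infinity in simp)
qed

text \<open>The hypotheses say that \<open>f\<close> induces an isomorphism from
  \<open>V / R\<close> onto \<open>V' / R'\<close>: it is surjective modulo \<open>R'\<close>, and
  the last equivalence makes it well defined and injective.\<close>

lemma qdim_transfer:
  assumes V: "csubspace V" "csubspace R" "R \<subseteq> V" and V': "csubspace V'" "csubspace R'" "R' \<subseteq> V'"
    and f: "clinear f" "\<And>x. x \<in> V \<Longrightarrow> f x \<in> V'" "\<And>y. y \<in> V' \<Longrightarrow> \<exists>x\<in>V. y - f x \<in> R'"
      "\<And>x. x \<in> V \<Longrightarrow> f x \<in> R' \<longleftrightarrow> x \<in> R"
  shows "qdim V R = qdim V' R'"
proof (rule enat_eqI)
  fix n :: nat
  have sumV: "(\<Sum>i<n. scaleC (c i) (v i)) \<in> V" if "\<forall>i<n. v i \<in> V" for c v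
    using that by (intro csubspace_sum[OF V(1)] csubspace_scale[OF V(1)]) auto
  have fs: "f (\<Sum>i<n. scaleC (c i) (v i)) = (\<Sum>i<n. scaleC (c i) (f (v i)))" for c v
    by (simp add: clinear_sum[OF f(1)] clinear_scale[OF f(1)])
  show "enat n \<le> qdim V R \<longleftrightarrow> enat n \<le> qdim V' R'"
    unfolding qdim_ge_iff[OF V] qdim_ge_iff[OF V']
  proof
    assume "\<exists>v. (\<forall>i<n. v i \<in> V) \<and> indep_mod R n v"
    then obtain v where v: "\<forall>i<n. v i \<in> V" "indep_mod R n v" by blast
    have "indep_mod R' n (\<lambda>i. f (v i))"
      unfolding indep_mod_def
    proof (intro allI impI)
      fix c i assume c: "(\<Sum>i<n. scaleC (c i) (f (v i))) \<in> R'" and i: "i < n"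
      have "(\<Sum>i<n. scaleC (c i) (v i)) \<in> R"
        using c f(4)[OF sumV[OF v(1), of c]] by (simp add: fs)
      then show "c i = 0" using v(2) i by (auto simp: indep_mod_def)
    qed
    then show "\<exists>v. (\<forall>i<n. v i \<in> V') \<and> indep_mod R' n v"
      using v(1) f(2) by (intro exI[of _ "\<lambda>i. f (v i)"]) simp
  next
    assume "\<exists>v. (\<forall>i<n. v i \<in> V') \<and> indep_mod R' n v"
    then obtain w where w: "\<forall>i<n. w i \<in> V'" "indep_mod R' n w" by blast
    then have "\<forall>i. \<exists>x. i < n \<longrightarrow> x \<in> V \<and> w i - f x \<in> R'" using f(3) by blast
    then obtain v where v: "\<And>i. i < n \<Longrightarrow> v i \<in> V \<and> w i - f (v i) \<in> R'" by metis
    have "indep_mod R n v"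
      unfolding indep_mod_def
    proof (intro allI impI)
      fix c i assume c: "(\<Sum>i<n. scaleC (c i) (v i)) \<in> R" and i: "i < n"
      have "f (\<Sum>i<n. scaleC (c i) (v i)) \<in> R'" using c f(4) V(3) by blast
      moreover have "(\<Sum>i<n. scaleC (c i) (w i - f (v i))) \<in> R'"
        using v by (intro csubspace_sum[OF V'(2)] csubspace_scale[OF V'(2)]) auto
      ultimately have "f (\<Sum>i<n. scaleC (c i) (v i)) + (\<Sum>i<n. scaleC (c i) (w i - f (v i))) \<in> R'"
        by (rule csubspace_add[OF V'(2)])
      then have "(\<Sum>i<n. scaleC (c i) (w i)) \<in> R'"
        unfolding fs sum.distrib[symmetric] scaleC_add_right[symmetric] by simp
      then show "c i = 0" using w(2) i unfolding indep_mod_def by blast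
    qed
    then show "\<exists>v. (\<forall>i<n. v i \<in> V) \<and> indep_mod R n v" using v by blast
  qed
qed

text \<open>One inequality joins spanning sets, the other concatenates independent families:
  coefficients of the first vanish modulo \<open>R'\<close>, then those of the second modulo
  \<open>R\<close>. The second inequality also covers infinite summands, by families of arbitrary
  length.\<close>

lemma qdim_add:
  assumes V: "csubspace V" and R: "csubspace R" "R \<subseteq> R'" and R': "csubspace R'" "R' \<subseteq> V"
  shows "qdim V R = qdim V R' + qdim R' R"
proof (rule order_antisym)
  have RV: "R \<subseteq> V" using R R' by blast
  show "qdim V R \<le> qdim V R' + qdim R' R"
  proof (cases "qdim V R' = \<infinity> \<or> qdim R' R = \<infinity>")
    case False
    then obtain n m where nm: "qdim V R' = enat n" "qdim R' R = enat m" by auto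
    obtain B where B: "finite B" "card B = n" "B \<subseteq> V" "V = {r + y | r y. r \<in> R' \<and> y \<in> cspan B}"
      using qdim_finite_spanning[OF nm(1)] .
    obtain C where C: "finite C" "card C = m" "C \<subseteq> R'" "R' = {r + y | r y. r \<in> R \<and> y \<in> cspan C}"
      using qdim_finite_spanning[OF nm(2)] .
    have "V = {r + y | r y. r \<in> R \<and> y \<in> cspan (B \<union> C)}"
    proof
      have "cspan (B \<union> C) \<subseteq> V"
        using cvs.span_minimal[of "B \<union> C" V] V B(3) C(3) R' by (auto simp: cspan_eq_span csubspace_iff)
      then show "{r + y | r y. r \<in> R \<and> y \<in> cspan (B \<union> C)} \<subseteq> V"
        using RV csubspace_add[OF V] by blast
      show "V \<subseteq> {r + y | r y. r \<in> R \<and> y \<in> cspan (B \<union> C)}"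
      proof
        fix x assume "x \<in> V"
        then obtain r y where x: "x = r + y" "r \<in> R'" "y \<in> cspan B" using B(4) by blast
        then obtain r' y' where r: "r = r' + y'" "r' \<in> R" "y' \<in> cspan C" using C(4) by blast
        have "y' + y \<in> cspan (B \<union> C)"
          using x(3) r(3) unfolding cspan_eq_span
          by (meson cvs.span_add cvs.span_mono sup_ge1 sup_ge2 subsetD)
        then show "x \<in> {r + y | r y. r \<in> R \<and> y \<in> cspan (B \<union> C)}"
          using x r by (auto simp: add.assoc)
      qed
    qed
    then have "qdim V R \<le> enat (card (B \<union> C))" using B C R' by (intro qdim_le_card) auto
    also have "\<dots> \<le> enat (n + m)" using card_Un_le[of B C] B C by simp
    finally show ?thesis by (simp add: nm)
  qed auto
  have *: "enat (n + m) \<le> qdim V R" if n: "enat n \<le> qdim V R'" and m: "enat m \<le> qdim R' R" for n m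
  proof -
    obtain v where v: "\<forall>i<n. v i \<in> V" "indep_mod R' n v" using n by (auto simp: qdim_ge_iff[OF V R'])
    obtain w where w: "\<forall>i<m. w i \<in> R'" "indep_mod R m w" using m by (auto simp: qdim_ge_iff[OF R'(1) R])
    define u where "u = (\<lambda>i. if i < n then v i else w (i - n))"
    have u: "(\<Sum>i<n+m. scaleC (c i) (u i)) = (\<Sum>i<n. scaleC (c i) (v i)) + (\<Sum>i<m. scaleC (c (n + i)) (w i))" for c
      by (induction m) (simp_all add: u_def add.assoc)
    have "indep_mod R (n + m) u"
      unfolding indep_mod_def u
    proof (intro allI impI)
      fix c i
      assume c: "(\<Sum>i<n. scaleC (c i) (v i)) + (\<Sum>i<m. scaleC (c (n + i)) (w i)) \<in> R" and i: "i < n + m"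
      have "(\<Sum>i<m. scaleC (c (n + i)) (w i)) \<in> R'"
        using w by (intro csubspace_sum[OF R'(1)] csubspace_scale[OF R'(1)]) auto
      then have "(\<Sum>i<n. scaleC (c i) (v i)) \<in> R'"
        using c R(2) csubspace_add_right_iff[OF R'(1)] by blast
      then have c0: "\<forall>i<n. c i = 0" using v(2) unfolding indep_mod_def by blast
      then have "(\<Sum>i<m. scaleC (c (n + i)) (w i)) \<in> R" using c by simp
      then have "\<forall>i<m. c (n + i) = 0" using w(2) unfolding indep_mod_def by (auto dest: spec[of _ "\<lambda>i. c (n + i)"])
      then show "c i = 0" using c0 i by (metis add_less_cancel_left le_add_diff_inverse not_less)
    qed
    moreover have "\<forall>i<n+m. u i \<in> V" using v w R'(2) by (auto simp: u_def)
    ultimately show ?thesis unfolding qdim_ge_iff[OF V R(1) RV] by blast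
  qed
  show "qdim V R' + qdim R' R \<le> qdim V R"
  proof (cases "qdim V R")
    case (enat k)
    have "qdim V R' \<noteq> \<infinity>"
    proof
      assume "qdim V R' = \<infinity>"
      then show False using *[of "Suc k" 0] enat by (simp add: zero_enat_def[symmetric])
    qed
    moreover have "qdim R' R \<noteq> \<infinity>"
    proof
      assume "qdim R' R = \<infinity>"
      then show False using *[of 0 "Suc k"] enat by (simp add: zero_enat_def[symmetric])
    qed
    ultimately show ?thesis using * by auto
  qed simp
qed

lemma qdim_self: "csubspace V \<Longrightarrow> qdim V V = 0"
  using qdim_le_card[of "{}" V V] by (simp add: cspan_def zero_enat_def[symmetric])

lemma qdim_eq_0_iff:
  assumes "csubspace V" "csubspace R" "R \<subseteq> V"
  shows "qdim V R = 0 \<longleftrightarrow> V = R"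
proof
  assume "qdim V R = 0"
  then have "qdim V R = enat 0" by (simp add: zero_enat_def)
  then obtain B where B: "finite B" "card B = 0" "V = {r + y | r y. r \<in> R \<and> y \<in> cspan B}"
    by (rule qdim_finite_spanning)
  then show "V = R" by (simp add: cspan_def)
qed (use assms qdim_self in auto)

text \<open>The second isomorphism theorem, \<open>(U + R) / R = U / (U \<inter> R)\<close>, induced
  by the inclusion of \<open>U\<close>.\<close>

lemma qdim_sum:
  assumes U: "csubspace U" and R: "csubspace R"
  shows "qdim {u + r | u r. u \<in> U \<and> r \<in> R} R = qdim U (U \<inter> R)"
proof (rule qdim_transfer[symmetric, where f = "\<lambda>x. x"])
  show "R \<subseteq> {u + r | u r. u \<in> U \<and> r \<in> R}" using csubspace_0[OF U] by force
  show "x \<in> {u + r | u r. u \<in> U \<and> r \<in> R}" if "x \<in> U" for x using that csubspace_0[OF R] by force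
  show "\<exists>x\<in>U. y - x \<in> R" if "y \<in> {u + r | u r. u \<in> U \<and> r \<in> R}" for y
    using that by (force simp: add_diff_cancel_left')
qed (use assms in \<open>auto simp: csubspace_inter csubspace_sums clinear_id\<close>)

lemma qdim_mono_left:
  assumes "csubspace V" "csubspace U" "csubspace R" "R \<subseteq> U" "U \<subseteq> V"
  shows "qdim U R \<le> qdim V R"
  using qdim_add[of V R U] assms by simp

lemma qdim_antimono_right:
  assumes "csubspace V" "csubspace U" "csubspace R" "R \<subseteq> U" "U \<subseteq> V"
  shows "qdim V U \<le> qdim V R"
  using qdim_add[of V R U] assms by simp

lemma cfinite_dim_iff: "csubspace V \<Longrightarrow> cfinite_dim V \<longleftrightarrow> fin_codim V {0}"
  and cdim_eq_codim: "csubspace V \<Longrightarrow> cdim V = codim V {0}"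
proof -
  have "(B \<subseteq> V \<and> V = {r + y | r y. r \<in> {0} \<and> y \<in> cspan B}) \<longleftrightarrow> cspan B = V" for B
    using cvs.span_superset[of B] by (auto simp: cspan_eq_span)
  then show "cfinite_dim V \<longleftrightarrow> fin_codim V {0}" "cdim V = codim V {0}"
    unfolding cfinite_dim_def fin_codim_def cdim_def codim_def by simp_all
qed

lemma fin_codim_iff_qdim: "fin_codim V R \<longleftrightarrow> qdim V R \<noteq> \<infinity>"
  by (simp add: qdim_def)

lemma cfinite_dim_iff_qdim: "csubspace V \<Longrightarrow> cfinite_dim V \<longleftrightarrow> qdim V {0} \<noteq> \<infinity>"
  by (simp add: fin_codim_iff_qdim cfinite_dim_iff)

section \<open>Finite-dimensional perturbations of closed subspaces\<close>

lemma bounded_clinear_imp_clinear: "bounded_clinear S \<Longrightarrow> clinear S"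
  unfolding bounded_clinear_def by (intro clinearI) blast+

lemma bounded_clinear_imp_bounded_linear:
  assumes "bounded_clinear S"
  shows "bounded_linear S"
proof -
  obtain K where "\<And>x y. S (x + y) = S x + S y" "\<And>c x. S (scaleC c x) = scaleC c (S x)"
     "\<And>x. norm (S x) \<le> norm x * K"
    using assms unfolding bounded_clinear_def by blast
  then show ?thesis
    by (intro bounded_linear_intro[of S K]) (auto simp: scaleC_of_real[symmetric])
qed

lemma bounded_clinear_iff: "bounded_clinear S \<longleftrightarrow> clinear S \<and> bounded_linear S"
proof
  assume S: "clinear S \<and> bounded_linear S"
  then have "\<exists>K. \<forall>x. norm (S x) \<le> norm x * K" by (blast dest: bounded_linear.bounded)
  then show "bounded_clinear S"
    unfolding bounded_clinear_def using S clinear_add[of S] clinear_scale[of S] by blast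
qed (use bounded_clinear_imp_clinear bounded_clinear_imp_bounded_linear in blast)

lemma bounded_clinear_scaleC: "bounded_clinear (scaleC c)"
  unfolding bounded_clinear_def
  by (auto simp: scaleC_add_right norm_scaleC mult.commute intro: exI[of _ "cmod c"])

lemma bounded_clinear_shiftop:
  assumes "bounded_clinear S"
  shows "bounded_clinear (shiftop S l)"
proof -
  have c: "clinear S" using assms by (rule bounded_clinear_imp_clinear)
  have "clinear (shiftop S l)"
    unfolding shiftop_def
    by (rule clinearI) (simp_all add: clinear_add[OF c] clinear_scale[OF c] scaleC_add_right
        cvs.scale_right_diff_distrib mult.commute)
  moreover have "bounded_linear (shiftop S l)"
    unfolding shiftop_def
    using assms bounded_clinear_scaleC by (intro bounded_linear_sub) (auto simp: bounded_clinear_iff)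
  ultimately show ?thesis by (simp add: bounded_clinear_iff)
qed

lemma bounded_clinear_funpow:
  assumes "bounded_clinear S"
  shows "bounded_clinear (S ^^ n)"
proof (induction n)
  case 0
  show ?case by (auto simp: bounded_clinear_def intro: exI[of _ 1])
next
  case (Suc n)
  then have "bounded_linear (\<lambda>x. S ((S ^^ n) x))"
    using assms by (intro bounded_linear_compose[of S "S ^^ n"]) (auto simp: bounded_clinear_iff)
  moreover have "S ^^ Suc n = (\<lambda>x. S ((S ^^ n) x))" by auto
  moreover have "clinear (S ^^ Suc n)"
    by (rule clinear_funpow) (use assms bounded_clinear_imp_clinear in blast)
  ultimately show ?case by (simp add: bounded_clinear_iff)
qed

lemma shiftop_shiftop: "shiftop (shiftop S a) b = shiftop S (a + b)"
  by (simp add: shiftop_def fun_eq_iff scaleC_add_left)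

lemma shiftop_0 [simp]: "shiftop S 0 = S"
  by (simp add: shiftop_def)

lemma csubspace_gap:
  fixes V :: "'a::complex_banach set"
  assumes V: "closed V" "csubspace V" and x: "x \<notin> V"
  obtains d where "d > 0" "\<And>v c. v \<in> V \<Longrightarrow> d * cmod c \<le> norm (v + scaleC c x)"
proof -
  obtain d where d: "d > 0" "ball x d \<subseteq> - V"
    using V(1) x open_contains_ball[of "- V"] by auto
  have "d * cmod c \<le> norm (v + scaleC c x)" if v: "v \<in> V" for v c
  proof (cases "c = 0")
    case False
    define w where "w = scaleC (- inverse c) v"
    have "w \<in> V" unfolding w_def by (rule csubspace_scale[OF V(2) v])
    then have "d \<le> dist x w" using d(2) by (force simp: not_less[symmetric])
    moreover have "v + scaleC c x = scaleC c (x - w)"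
      using False by (simp add: w_def cvs.scale_right_diff_distrib scaleC_add_right)
    ultimately show ?thesis using mult_left_mono[of d "dist x w" "cmod c"]
      by (simp add: norm_scaleC dist_norm mult.commute)
  qed simp
  then show thesis using d(1) that by blast
qed

text \<open>Since \<open>x\<close> has positive distance from \<open>V\<close>, the coefficients of
  \<open>x\<close> are controlled by the vectors; along a convergent sequence they are Cauchy, and
  the components in \<open>V\<close> converge as well.\<close>

lemma closed_csubspace_plus_line:
  fixes V :: "'a::complex_banach set"
  assumes V: "closed V" "csubspace V"
  shows "closed {v + scaleC c x | v c. v \<in> V}"
proof (cases "x \<in> V")
  case True
  have "{v + scaleC c x | v c. v \<in> V} = V"
  proof
    show "V \<subseteq> {v + scaleC c x | v c. v \<in> V}"
    proof
      fix v assume "v \<in> V"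
      then show "v \<in> {v + scaleC c x | v c. v \<in> V}"
        by (intro CollectI exI[of _ v] exI[of _ 0]) simp
    qed
  qed (auto intro!: csubspace_add[OF V(2)] csubspace_scale[OF V(2)] True)
  then show ?thesis using V(1) by simp
next
  case False
  obtain d where d: "d > 0" "\<And>v c. v \<in> V \<Longrightarrow> d * cmod c \<le> norm (v + scaleC c x)"
    using csubspace_gap[OF V False] by blast
  show ?thesis
    unfolding closed_sequential_limits
  proof (intro allI impI, elim conjE)
    fix z l assume z: "\<forall>n. z n \<in> {v + scaleC c x | v c. v \<in> V}" and l: "z \<longlonglongrightarrow> l"
    then obtain v c where vc: "\<And>n. z n = v n + scaleC (c n) x" "\<And>n. v n \<in> V"
      by simp metis
    have diff: "d * cmod (c m - c n) \<le> norm (z m - z n)" for m n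
      using d(2)[OF csubspace_diff[OF V(2) vc(2) vc(2)], of "c m - c n" m n]
      by (simp add: vc(1) cvs.scale_left_diff_distrib algebra_simps)
    have "Cauchy c"
    proof (rule metric_CauchyI)
      fix e :: real assume "e > 0"
      then obtain M where M: "\<forall>m\<ge>M. \<forall>n\<ge>M. dist (z m) (z n) < d * e"
        using metric_CauchyD[OF LIMSEQ_imp_Cauchy[OF l], of "d * e"] d(1) by auto
      have "dist (c m) (c n) < e" if "m \<ge> M" "n \<ge> M" for m n
      proof -
        have "d * cmod (c m - c n) < d * e"
          using diff[of m n] M that by (force simp: dist_norm)
        then show ?thesis using d(1) by (simp add: dist_norm)
      qed
      then show "\<exists>M. \<forall>m\<ge>M. \<forall>n\<ge>M. dist (c m) (c n) < e" by blast
    qed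
    then obtain c0 where c0: "c \<longlonglongrightarrow> c0" using Cauchy_convergent convergent_def by blast
    have "(\<lambda>n. scaleC (c n - c0) x) \<longlonglongrightarrow> 0"
      by (rule Lim_null_comparison[where g = "\<lambda>n. cmod (c n - c0) * norm x"])
        (use c0 in \<open>auto simp: norm_scaleC intro!: tendsto_mult_left_zero tendsto_norm_zero LIM_zero\<close>)
    then have "(\<lambda>n. z n - scaleC (c n - c0) x) \<longlonglongrightarrow> l - 0" by (rule tendsto_diff[OF l])
    then have "(\<lambda>n. z n - scaleC (c n - c0) x - scaleC c0 x) \<longlonglongrightarrow> l - 0 - scaleC c0 x"
      by (rule tendsto_diff) (rule tendsto_const)
    moreover have "(\<lambda>n. z n - scaleC (c n - c0) x - scaleC c0 x) = v"
      by (simp add: vc(1) cvs.scale_left_diff_distrib)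
    ultimately have "l - scaleC c0 x \<in> V"
      using closed_sequentially[OF V(1), of v] vc(2) by simp
    then show "l \<in> {v + scaleC c x | v c. v \<in> V}"
      by (intro CollectI exI[of _ "l - scaleC c0 x"] exI[of _ c0]) simp
  qed
qed

lemma closed_csubspace_plus_cspan:
  fixes V :: "'a::complex_banach set"
  assumes V: "closed V" "csubspace V" and "finite B"
  shows "closed {v + y | v y. v \<in> V \<and> y \<in> cspan B}"
  using \<open>finite B\<close>
proof (induction B)
  case empty
  have "{v + y | v y. v \<in> V \<and> y \<in> cspan {}} = V" by (auto simp: cspan_eq_span)
  then show ?case using V by simp
next
  case (insert x B)
  let ?U = "{v + y | v y. v \<in> V \<and> y \<in> cspan B}"
  have "{v + y | v y. v \<in> V \<and> y \<in> cspan (insert x B)} = {u + scaleC c x | u c. u \<in> ?U}"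
  proof (intro set_eqI iffI)
    fix z assume "z \<in> {v + y | v y. v \<in> V \<and> y \<in> cspan (insert x B)}"
    then obtain v y where z: "z = v + y" "v \<in> V" "y \<in> cvs.span (insert x B)"
      by (auto simp: cspan_eq_span)
    then obtain k where k: "y - scaleC k x \<in> cvs.span B" using cvs.span_breakdown_eq by blast
    show "z \<in> {u + scaleC c x | u c. u \<in> ?U}"
      using z k by (intro CollectI exI[of _ "v + (y - scaleC k x)"] exI[of _ k]) (auto simp: cspan_eq_span)
  next
    fix z assume "z \<in> {u + scaleC c x | u c. u \<in> ?U}"
    then obtain v y c where z: "z = v + y + scaleC c x" "v \<in> V" "y \<in> cvs.span B"
      by (auto simp: cspan_eq_span)
    have "y + scaleC c x \<in> cvs.span (insert x B)"
      unfolding cvs.span_breakdown_eq by (intro exI[of _ c]) (simp add: z)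
    then show "z \<in> {v + y | v y. v \<in> V \<and> y \<in> cspan (insert x B)}"
      using z by (auto simp: cspan_eq_span add.assoc)
  qed
  then show ?case
    using closed_csubspace_plus_line[OF insert.IH csubspace_sums[OF V(2) csubspace_cspan]] by simp
qed

lemma closed_csubspace_plus_finite_dim:
  assumes "closed V" "csubspace V" "cfinite_dim U"
  shows "closed {v + u | v u. v \<in> V \<and> u \<in> U}"
  using assms closed_csubspace_plus_cspan unfolding cfinite_dim_def by blast

section \<open>Independent families with explicit constants\<close>

text \<open>Normalise \<open>x - r0\<close> for an \<open>r0\<close> that is within twice the
  distance from \<open>x\<close> to \<open>R\<close>; this is the factor 2. The bound is stated for
  all coefficients so that it can be iterated.\<close>

lemma riesz_lemma:
  fixes V :: "'a::complex_banach set"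
  assumes V: "csubspace V" and R: "closed R" "csubspace R" "R \<subseteq> V" "R \<noteq> V"
  obtains v where "v \<in> V" "norm v = 1" "\<And>c r. r \<in> R \<Longrightarrow> cmod c \<le> 2 * norm (r + scaleC c v)"
proof -
  obtain x where x: "x \<in> V" "x \<notin> R" using R by blast
  define d where "d = infdist x R"
  have ne: "R \<noteq> {}" using csubspace_0[OF R(2)] by blast
  have d: "d > 0"
    using x(2) in_closed_iff_infdist_zero[OF R(1) ne, of x] infdist_nonneg[of x R] by (simp add: d_def)
  have "\<exists>r\<in>R. dist x r < 2 * d"
  proof (rule ccontr)
    assume "\<not> ?thesis"
    then have "2 * d \<le> infdist x R" using ne by (auto simp: infdist_def not_less intro!: cINF_greatest)
    then show False using d by (simp add: d_def)
  qed
  then obtain r0 where r0: "r0 \<in> R" "dist x r0 < 2 * d" by blast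
  define t where "t = norm (x - r0)"
  have t: "t > 0" "t < 2 * d" using r0 x by (auto simp: t_def dist_norm)
  define v where "v = scaleC (complex_of_real (1/t)) (x - r0)"
  show thesis
  proof
    show "v \<in> V" unfolding v_def using x r0 R by (intro csubspace_scale csubspace_diff V) auto
    show "norm v = 1" using t by (simp add: v_def norm_scaleC t_def norm_divide)
    fix c r assume r: "r \<in> R"
    show "cmod c \<le> 2 * norm (r + scaleC c v)"
    proof (cases "c = 0")
      case False
      define w where "w = r0 - scaleC (of_real t / c) r"
      have w: "w \<in> R" unfolding w_def by (intro csubspace_diff csubspace_scale R r0 r)
      have "d \<le> norm (x - w)" using infdist_le[OF w, of x] by (simp add: d_def dist_norm)
      moreover have "r + scaleC c v = scaleC (c / of_real t) (x - w)"
        using False t by (simp add: w_def v_def cvs.scale_right_diff_distrib scaleC_add_right)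
      then have "norm (r + scaleC c v) = cmod c / t * norm (x - w)"
        using t by (simp add: norm_scaleC norm_divide)
      ultimately have "cmod c / t * d \<le> norm (r + scaleC c v)"
        using t mult_left_mono[of d "norm (x - w)" "cmod c / t"] by simp
      moreover have "cmod c \<le> 2 * (cmod c / t * d)"
        using t mult_left_mono[of t "2 * d" "cmod c"] by (simp add: field_simps)
      ultimately show ?thesis by linarith
    qed simp
  qed
qed

text \<open>The constant depends on \<open>n\<close> only, not on \<open>V\<close> and \<open>R\<close>. Therefore kernel and cokernel dimensions \<open>\<ge> n\<close>
  propagate over distances that are uniform in the base point, and dimensions are constant on a whole disc,
  also when they are infinite.\<close>

lemma quantitative_independence:
  fixes V :: "'a::complex_banach set"
  assumes V: "csubspace V" and R: "closed R" "csubspace R" "R \<subseteq> V" and n: "enat n \<le> qdim V R"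
  shows "\<exists>v. (\<forall>i<n. v i \<in> V \<and> norm (v i) = 1) \<and>
    (\<forall>c. \<forall>r\<in>R. \<forall>i<n. cmod (c i) \<le> 3 ^ n * norm ((\<Sum>j<n. scaleC (c j) (v j)) + r))"
  using n
proof (induction n)
  case (Suc n)
  then have "enat n \<le> qdim V R" by (metis Suc_ile_eq order_less_imp_le)
  with Suc.IH obtain v where v: "\<And>i. i < n \<Longrightarrow> v i \<in> V" "\<And>i. i < n \<Longrightarrow> norm (v i) = 1"
    "\<And>c r i. r \<in> R \<Longrightarrow> i < n \<Longrightarrow> cmod (c i) \<le> 3 ^ n * norm ((\<Sum>j<n. scaleC (c j) (v j)) + r)"
    by blast
  \<comment> \<open>The next vector is chosen far from \<open>R\<close> together with all the
    previous ones; \<open>Q\<close> is closed because only finitely many vectors are added.\<close>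
  define Q where "Q = {r + y | r y. r \<in> R \<and> y \<in> cspan (v ` {..<n})}"
  have Q: "closed Q" "csubspace Q"
    unfolding Q_def by (auto intro: closed_csubspace_plus_cspan csubspace_sums csubspace_cspan R)
  have "v ` {..<n} \<subseteq> V" using v(1) by auto
  then have "cspan (v ` {..<n}) \<subseteq> V"
    using cvs.span_minimal V by (simp add: cspan_eq_span csubspace_iff)
  then have QV: "Q \<subseteq> V" using R(3) csubspace_add[OF V] by (auto simp: Q_def)
  have "Q \<noteq> V"
  proof
    assume "Q = V"
    then have "qdim V R \<le> enat (card (v ` {..<n}))"
      using v(1) by (intro qdim_le_card) (auto simp: Q_def)
    also have "\<dots> \<le> enat n" using card_image_le[of "{..<n}" v] by simp
    finally show False using Suc.prems by (meson Suc_ile_eq leD)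
  qed
  then obtain u where u: "u \<in> V" "norm u = 1" "\<And>c r. r \<in> Q \<Longrightarrow> cmod c \<le> 2 * norm (r + scaleC c u)"
    using riesz_lemma[OF V Q QV] by blast
  define w where "w = v(n := u)"
  have bd: "cmod (c i) \<le> 3 ^ Suc n * norm ((\<Sum>j<Suc n. scaleC (c j) (w j)) + r)"
    if r: "r \<in> R" and i: "i < Suc n" for c r i
  proof -
    define s where "s = (\<Sum>j<n. scaleC (c j) (v j))"
    define t where "t = norm (s + r + scaleC (c n) u)"
    have eq: "(\<Sum>j<Suc n. scaleC (c j) (w j)) + r = s + r + scaleC (c n) u"
      by (simp add: w_def s_def)
    have "s \<in> cspan (v ` {..<n})"
      unfolding s_def cspan_eq_span by (intro cvs.span_sum cvs.span_scale cvs.span_base) auto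
    then have "s + r \<in> Q" using r by (auto simp: Q_def add.commute)
    then have cn: "cmod (c n) \<le> 2 * t" unfolding t_def by (rule u(3))
    have tn: "t \<ge> 0" by (simp add: t_def)
    have p: "(1::real) \<le> 3 ^ n" by simp
    have "norm (s + r) \<le> t + cmod (c n)"
      using norm_triangle_ineq4[of "s + r + scaleC (c n) u" "scaleC (c n) u"] u(2)
      by (simp add: t_def norm_scaleC)
    \<comment> \<open>Origin of the base 3: the last coefficient costs \<open>2 * t\<close>, so what
      remains after removing it has norm at most \<open>t + 2 * t\<close>.\<close>
    then have sr: "norm (s + r) \<le> 3 * t" using cn by simp
    show ?thesis
    proof (cases "i = n")
      case True
      have "2 * t \<le> 3 ^ Suc n * t"
        unfolding power_Suc using p by (intro mult_right_mono tn) linarith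
      then show ?thesis using cn True unfolding eq t_def by simp
    next
      case False
      then have "cmod (c i) \<le> 3 ^ n * norm (s + r)" using v(3)[OF r, of i c] i by (simp add: s_def)
      also have "\<dots> \<le> 3 ^ n * (3 * t)" using sr by (intro mult_left_mono) auto
      finally show ?thesis unfolding eq t_def by simp
    qed
  qed
  show ?case
  proof (intro exI[of _ w] conjI allI impI ballI)
    fix i assume "i < Suc n"
    then show "w i \<in> V" "norm (w i) = 1" using u v by (cases "i = n"; simp add: w_def)+
  qed (rule bd)
qed simp

text \<open>The span of a maximal family independent modulo \<open>R\<close>: maximality gives the
  decomposition, independence gives \<open>F \<inter> R = {0}\<close>, and finite dimension gives
  closedness.\<close>

lemma finite_codim_complement:
  fixes V :: "'a::complex_banach set"
  assumes V: "csubspace V" and R: "csubspace R" "R \<subseteq> V" and fin: "fin_codim V R"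
  obtains F where "csubspace F" "closed F" "F \<subseteq> V" "F \<inter> R = {0}" "V = {r + y | r y. r \<in> R \<and> y \<in> F}"
proof -
  obtain n where n: "qdim V R = enat n" using fin by (auto simp: fin_codim_iff_qdim)
  then obtain v where v: "\<And>i. i < n \<Longrightarrow> v i \<in> V" "indep_mod R n v"
    using qdim_ge_iff[OF V R, of n] by auto
  have max: "\<not> indep_mod R (Suc n) w" if "\<And>i. i < Suc n \<Longrightarrow> w i \<in> V" for w
    using qdim_ge_iff[OF V R, of "Suc n"] n that by auto
  let ?F = "cspan (v ` {..<n})"
  have span: "V = {r + y | r y. r \<in> R \<and> y \<in> ?F}"
    by (rule maximal_indep_mod_spans[OF V R v max])
  have "closed {z + y | z y. z \<in> {0} \<and> y \<in> ?F}"
    by (rule closed_csubspace_plus_cspan) auto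
  moreover have "{z + y | z y. z \<in> {0} \<and> y \<in> ?F} = ?F" by auto
  ultimately have "closed ?F" by simp
  moreover have "v ` {..<n} \<subseteq> V" using v(1) by auto
  then have "?F \<subseteq> V" using cvs.span_minimal V by (simp add: cspan_eq_span csubspace_iff)
  moreover have "x = 0" if x: "x \<in> ?F" "x \<in> R" for x
  proof -
    have "x \<in> {\<Sum>i<n. scaleC (c i) (v i) | c. True}"
      using x(1) unfolding cspan_eq_span
    proof (induction rule: cvs.span_induct_alt)
      case base
      show ?case by (intro CollectI exI[of _ "\<lambda>_. 0"]) simp
    next
      case (step c y z)
      then obtain i d where i: "i < n" "y = v i" and z: "z = (\<Sum>i<n. scaleC (d i) (v i))" by auto
      have "scaleC c y = (\<Sum>j<n. scaleC (if j = i then c else 0) (v j))"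
        using i by (simp add: if_distrib[of "\<lambda>k. scaleC k _"] sum.delta cong: if_cong)
      then have "scaleC c y + z = (\<Sum>j<n. scaleC ((if j = i then c else 0) + d j) (v j))"
        by (simp add: z scaleC_add_left sum.distrib)
      then show ?case by (intro CollectI exI[of _ "\<lambda>j. (if j = i then c else 0) + d j"]) simp
    qed
    then obtain c where c: "x = (\<Sum>i<n. scaleC (c i) (v i))" by blast
    then have "\<forall>i<n. c i = 0" using v(2) x(2) unfolding indep_mod_def by blast
    then show "x = 0" using c by simp
  qed
  then have "?F \<inter> R = {0}" using csubspace_0[OF R(1)] csubspace_0[OF csubspace_cspan] by blast
  ultimately show thesis using that[of ?F] span csubspace_cspan by blast
qed

text \<open>The open mapping bound for addition on \<open>M \<times> N\<close>. Uniqueness of the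
  decomposition identifies the pair it supplies with the given one, so both projections are
  bounded.\<close>

lemma direct_sum_bound:
  fixes M N :: "'a::banach set"
  assumes M: "closed M" "subspace M" and N: "closed N" "subspace N" and MN: "M \<inter> N = {0}"
    and cl: "closed {m + n | m n. m \<in> M \<and> n \<in> N}"
  shows "\<exists>C>0. \<forall>m\<in>M. \<forall>n\<in>N. norm m \<le> C * norm (m + n) \<and> norm n \<le> C * norm (m + n)"
proof -
  let ?S = "\<lambda>p::'a \<times> 'a. fst p + snd p"
  have "?S ` (M \<times> N) = {m + n | m n. m \<in> M \<and> n \<in> N}" by force
  then have "closed (?S ` (M \<times> N))" using cl by simp
  moreover have "bounded_linear ?S" by (intro bounded_linear_add bounded_linear_fst bounded_linear_snd)
  moreover have "closed (M \<times> N)" "subspace (M \<times> N)" using M N by (auto intro: closed_Times subspace_Times)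
  ultimately obtain C where C: "C > 0" "\<forall>y\<in>?S ` (M \<times> N). \<exists>x\<in>M \<times> N. ?S x = y \<and> norm x \<le> C * norm y"
    using open_mapping_closed_subspace[of ?S "M \<times> N"] by blast
  have bd: "norm (m, n) \<le> C * norm (m + n)" if m: "m \<in> M" and n: "n \<in> N" for m n
  proof -
    have "m + n \<in> ?S ` (M \<times> N)" using m n by force
    from bspec[OF C(2) this] obtain m' n' where p: "m' \<in> M" "n' \<in> N" "m' + n' = m + n" "norm (m', n') \<le> C * norm (m + n)"
      by auto
    have "m' - m \<in> M" using p m M(2) by (simp add: subspace_diff)
    moreover have "m' = m + n - n'" unfolding p(3)[symmetric] by simp
    then have eq: "m' - m = n - n'" by simp
    have "m' - m \<in> N" unfolding eq using p(2) n by (intro subspace_diff N(2))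
    ultimately have "m' - m \<in> M \<inter> N" by (rule IntI)
    then have "m' = m" unfolding MN by simp
    moreover have "n' = n" using \<open>m' = m\<close> eq by simp
    ultimately show ?thesis using p(4) by simp
  qed
  show ?thesis
    using C(1) order_trans[OF norm_fst_le bd] order_trans[OF norm_snd_le bd] by (intro exI[of _ C]) simp
qed

section \<open>Operators on closed invariant subspaces\<close>

text \<open>The operator stays defined on the whole space and only the subspace varies, so
  restrictions to summands and to ranges of powers are instances for the same
  \<open>S\<close>.\<close>

locale invariant_op =
  fixes V :: "'a::complex_banach set" and S :: "'a \<Rightarrow> 'a"
  assumes closedV: "closed V" and csubV: "csubspace V" and bclS: "bounded_clinear S"
    and invS: "x \<in> V \<Longrightarrow> S x \<in> V"
begin

lemma clinS: "clinear S"
  using bclS by (rule bounded_clinear_imp_clinear)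

lemma blinS: "bounded_linear S"
  using bclS by (rule bounded_clinear_imp_bounded_linear)

lemma subV: "subspace V"
  using csubV by (rule csubspace_imp_subspace)

lemma inv_funpow: "x \<in> V \<Longrightarrow> (S ^^ n) x \<in> V"
  by (induction n) (auto intro: invS)

lemma rng_subset: "rng V (S ^^ n) \<subseteq> V"
  using inv_funpow by (auto simp: rng_def)

lemma csub_rng: "csubspace (rng V (S ^^ n))"
  by (rule csubspace_rng[OF clinear_funpow[OF clinS] csubV])

lemma csub_kern: "csubspace (kern V (S ^^ n))"
  by (rule csubspace_kern[OF clinear_funpow[OF clinS] csubV])

lemma invariant_op_shiftop: "invariant_op V (shiftop S l)"
  by unfold_locales
    (auto simp: closedV csubV shiftop_def
      intro!: bounded_clinear_shiftop[OF bclS, unfolded shiftop_def] invS csubspace_diff csubspace_scale)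

lemma invariant_op_funpow: "invariant_op V (S ^^ n)"
  by unfold_locales (auto simp: closedV csubV bounded_clinear_funpow[OF bclS] intro: inv_funpow)

lemma invariant_op_rng: "closed (rng V (S ^^ n)) \<Longrightarrow> invariant_op (rng V (S ^^ n)) S"
proof unfold_locales
  show "S x \<in> rng V (S ^^ n)" if x: "x \<in> rng V (S ^^ n)" for x
  proof -
    obtain v where "v \<in> V" "x = (S ^^ n) v" using x unfolding rng_def by blast
    then have "S v \<in> V" "S x = (S ^^ n) (S v)" by (simp_all add: invS funpow_swap1[symmetric])
    then show ?thesis unfolding rng_def by blast
  qed
qed (auto simp: csub_rng bclS)

lemma bounded_lift:
  assumes "closed (rng V S)"
  shows "\<exists>C>0. \<forall>y\<in>rng V S. \<exists>x\<in>V. S x = y \<and> norm x \<le> C * norm y"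
  using open_mapping_closed_subspace[OF blinS closedV subV assms[unfolded rng_def]] by (simp add: rng_def)

text \<open>\<open>(x, f) \<mapsto> S x + f\<close> maps \<open>V \<times> F\<close> onto
  \<open>V\<close> for a finite-dimensional complement \<open>F\<close>, so the component in
  \<open>F\<close> depends boundedly on the vector. For \<open>w\<close> in the closure this
  component is unchanged when a nearby range element is subtracted, hence it is arbitrarily
  small.\<close>

lemma closed_rng_if_fin_codim:
  assumes fin: "fin_codim V (rng V S)"
  shows "closed (rng V S)"
proof -
  have R: "csubspace (rng V S)" "rng V S \<subseteq> V" using csub_rng[of 1] rng_subset[of 1] by simp_all
  obtain F where F: "csubspace F" "closed F" "F \<subseteq> V" "F \<inter> rng V S = {0}"
      "V = {r + y | r y. r \<in> rng V S \<and> y \<in> F}"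
    using finite_codim_complement[OF csubV R fin] .
  let ?S = "\<lambda>p::'a \<times> 'a. S (fst p) + snd p"
  have bl: "bounded_linear ?S"
    by (intro bounded_linear_add bounded_linear_compose[OF blinS] bounded_linear_fst bounded_linear_snd)
  have im: "?S ` (V \<times> F) = V" by (subst (2) F(5)) (force simp: rng_def)
  have "closed (?S ` (V \<times> F))" by (simp only: im closedV)
  moreover have "closed (V \<times> F)" "subspace (V \<times> F)"
    using F closedV subV by (auto intro: closed_Times subspace_Times csubspace_imp_subspace)
  ultimately obtain C where C: "C > 0" "\<forall>y\<in>?S ` (V \<times> F). \<exists>x\<in>V \<times> F. ?S x = y \<and> norm x \<le> C * norm y"
    using open_mapping_closed_subspace[OF bl, of "V \<times> F"] by blast
  have "w \<in> rng V S" if w: "w \<in> closure (rng V S)" for w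
  proof -
    have "w \<in> V" using w closure_minimal[OF R(2) closedV] by blast
    then obtain r f where rf: "w = r + f" "r \<in> rng V S" "f \<in> F" using F(5) by blast
    have "norm f \<le> C * e" if "e > 0" for e
    proof -
      obtain z where z: "z \<in> rng V S" "dist z w < e"
        using w \<open>e > 0\<close> unfolding closure_approachable by blast
      have "w - z \<in> ?S ` (V \<times> F)" unfolding im using \<open>w \<in> V\<close> z R(2) csubspace_diff[OF csubV] by blast
      from bspec[OF C(2) this] obtain x g where xg: "x \<in> V" "g \<in> F" "S x + g = w - z" "norm (x, g) \<le> C * norm (w - z)"
        by auto
      have "f - g \<in> F" using rf xg F(1) by (simp add: csubspace_diff)
      moreover have "f - g = S x - (r - z)" using xg(3) rf(1) by (simp add: algebra_simps)
      then have "f - g \<in> rng V S"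
        using xg(1) rf(2) z(1) by (auto simp: rng_def intro!: csubspace_diff[OF R(1)[unfolded rng_def]])
      ultimately have "f - g \<in> F \<inter> rng V S" by (rule IntI)
      then have fg: "f = g" unfolding F(4) by simp
      have "norm f \<le> C * norm (w - z)" unfolding fg using norm_snd_le[of g x] xg(4) by (rule order_trans)
      also have "\<dots> \<le> C * e" using z(2) C(1) by (simp add: dist_norm norm_minus_commute)
      finally show ?thesis .
    qed
    \<comment> \<open>For this \<open>e\<close> the bound reads
      \<open>norm f \<le> norm f / 2\<close>.\<close>
    from this[of "norm f / (2 * C)"] have "f = 0" using C(1) by (cases "f = 0") simp_all
    then show ?thesis using rf by simp
  qed
  then have "closure (rng V S) \<subseteq> rng V S" by blast
  then show ?thesis by (simp only: closure_subset_eq)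
qed

text \<open>A bounded lift of \<open>S l\<close> differs from \<open>l\<close> by a kernel vector
  and therefore stays in \<open>L\<close>.\<close>

lemma closed_image_if_kern_subset:
  assumes R: "closed (rng V S)" and L: "closed L" "csubspace L" "L \<subseteq> V" "kern V S \<subseteq> L"
  shows "closed (rng L S)"
proof -
  obtain C where C: "C > 0" "\<forall>y\<in>rng V S. \<exists>x\<in>V. S x = y \<and> norm x \<le> C * norm y"
    using bounded_lift[OF R] by blast
  have "\<exists>x\<in>L. S x = y \<and> norm x \<le> C * norm y" if y: "y \<in> S ` L" for y
  proof -
    obtain l where l: "l \<in> L" "y = S l" using y by blast
    then have "y \<in> rng V S" using L(3) by (auto simp: rng_def)
    then obtain x where x: "x \<in> V" "S x = y" "norm x \<le> C * norm y" using C(2) by blast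
    have "x - l \<in> kern V S"
      using x l L(3) by (auto simp: kern_def clinear_diff[OF clinS] intro!: csubspace_diff[OF csubV])
    then have "x \<in> L" using L(4) l(1) csubspace_add[OF L(2), of "x - l" l] by auto
    then show ?thesis using x by blast
  qed
  then show ?thesis
    unfolding rng_def using lift_imp_closed_image[OF blinS L(1) csubspace_imp_subspace[OF L(2)], of C] C(1) by simp
qed

end

section \<open>Perturbation of Kato operators\<close>

lemma infdist_approx:
  assumes "Y \<noteq> {}" "d > 0"
  shows "\<exists>y\<in>Y. dist x y < infdist x Y + d"
proof (rule ccontr)
  assume "\<not> ?thesis"
  then have "infdist x Y + d \<le> infdist x Y"
    using assms by (subst (2) infdist_def) (auto simp: not_less intro!: cINF_greatest)
  then show False using assms by simp
qed

text \<open>For fixed \<open>n\<close> the distance \<open>d\<close> serves all pairs of points, so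
  \<open>{x. enat n \<le> q x}\<close> is both open and closed in \<open>D\<close>. Values of
  \<open>q\<close> may be infinite.\<close>

lemma enat_constant_on_connected:
  fixes q :: "'b::metric_space \<Rightarrow> enat"
  assumes D: "connected D" "a \<in> D" "b \<in> D"
    and loc: "\<And>n. \<exists>d>0. \<forall>x\<in>D. \<forall>y\<in>D. dist x y < d \<longrightarrow> enat n \<le> q x \<longrightarrow> enat n \<le> q y"
  shows "q a = q b"
proof -
  have *: "enat n \<le> q v" if uv: "u \<in> D" "v \<in> D" "enat n \<le> q u" for u v n
  proof -
    obtain d where d: "d > 0" "\<forall>x\<in>D. \<forall>y\<in>D. dist x y < d \<longrightarrow> enat n \<le> q x \<longrightarrow> enat n \<le> q y"
      using loc[of n] by blast
    show ?thesis
    proof (rule connected_induction_simple[where P = "\<lambda>x. enat n \<le> q x", OF D(1) uv])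
      fix z assume z: "z \<in> D"
      have "dist x y < d" if "x \<in> ball z (d/2)" "y \<in> ball z (d/2)" for x y
        using that dist_triangle_half_l[of x z d y] by (simp add: dist_commute)
      then have "\<forall>x\<in>D \<inter> ball z (d/2). \<forall>y\<in>D \<inter> ball z (d/2). enat n \<le> q x \<longrightarrow> enat n \<le> q y"
        using d(2) by blast
      moreover have "openin (top_of_set D) (D \<inter> ball z (d/2))" by (simp add: openin_open_Int)
      moreover have "z \<in> D \<inter> ball z (d/2)" using z d(1) by simp
      ultimately show "\<exists>T. openin (top_of_set D) T \<and> z \<in> T \<and> (\<forall>x\<in>T. \<forall>y\<in>T. enat n \<le> q x \<longrightarrow> enat n \<le> q y)"
        by blast
    qed
  qed
  show ?thesis by (rule enat_eqI) (use * D in blast)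
qed

text \<open>With \<open>s\<close> the sum of the \<open>cmod (c j)\<close>, the coefficient bounds
  add up to \<open>s \<le> real n * 3 ^ n * k * s\<close>, so \<open>s = 0\<close>. Kernels use it
  with a perturbed family \<open>w\<close> and \<open>R = Q = {0}\<close>, ranges with
  \<open>w = v\<close> and two different ranges.\<close>

lemma indep_modI_contraction:
  fixes v w :: "nat \<Rightarrow> 'a::complex_banach"
  assumes k: "k \<ge> 0" "real n * 3 ^ n * k < 1"
    and v: "\<And>c r i. r \<in> R \<Longrightarrow> i < n \<Longrightarrow> cmod (c i) \<le> 3 ^ n * norm ((\<Sum>j<n. scaleC (c j) (v j)) + r)"
    and w: "\<And>c. (\<Sum>j<n. scaleC (c j) (w j)) \<in> Q \<Longrightarrow>
      \<exists>r\<in>R. norm ((\<Sum>j<n. scaleC (c j) (v j)) + r) \<le> k * (\<Sum>j<n. cmod (c j))"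
  shows "indep_mod Q n w"
  unfolding indep_mod_def
proof (intro allI impI)
  fix c i assume c: "(\<Sum>j<n. scaleC (c j) (w j)) \<in> Q" and i: "i < n"
  define s where "s = (\<Sum>j<n. cmod (c j))"
  obtain r where r: "r \<in> R" "norm ((\<Sum>j<n. scaleC (c j) (v j)) + r) \<le> k * s"
    using w[OF c] s_def by blast
  have "cmod (c j) \<le> 3 ^ n * (k * s)" if "j < n" for j
    by (rule order_trans[OF v[OF r(1) that] mult_left_mono[OF r(2)]]) simp
  then have "s \<le> (\<Sum>j<n. 3 ^ n * (k * s))" unfolding s_def by (intro sum_mono) auto
  then have "s \<le> (real n * 3 ^ n * k) * s" by (simp add: mult_ac)
  then have "(1 - real n * 3 ^ n * k) * s \<le> 0" by (simp add: left_diff_distrib)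
  then have "s \<le> 0" using k(2) by (simp add: mult_le_0_iff)
  moreover have "cmod (c i) \<le> s" unfolding s_def using i by (intro member_le_sum) auto
  ultimately have "cmod (c i) \<le> 0" by (rule order_trans[rotated])
  then show "c i = 0" by simp
qed

lemma norm_sum_scaleC_le:
  fixes g :: "nat \<Rightarrow> 'a::complex_banach"
  assumes "\<And>j. j < n \<Longrightarrow> norm (g j) \<le> k"
  shows "norm (\<Sum>j<n. scaleC (c j) (g j)) \<le> k * (\<Sum>j<n. cmod (c j))"
proof -
  have "norm (\<Sum>j<n. scaleC (c j) (g j)) \<le> (\<Sum>j<n. norm (scaleC (c j) (g j)))" by (rule norm_sum)
  also have "\<dots> \<le> (\<Sum>j<n. cmod (c j) * k)"
    using assms by (intro sum_mono) (auto simp: norm_scaleC mult_left_mono)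
  finally show ?thesis by (simp add: sum_distrib_left mult.commute)
qed

lemma rng_rng: "rng (rng V (S ^^ n)) S = rng V (S ^^ Suc n)"
  by (simp add: rng_def image_comp)

lemma rng_rng_funpow: "rng (rng V (S ^^ m)) (S ^^ n) = rng V (S ^^ (n + m))"
  by (simp add: rng_def image_comp funpow_add)

text \<open>For a Kato operator this holds with \<open>Y\<close> the intersection of the ranges \<open>rng V (S ^^ n)\<close>: \<open>S\<close> maps \<open>Y\<close> onto itself
  and is bounded below modulo \<open>Y\<close>. Both conditions survive a small shift, and together they imply that \<open>S\<close> is Kato.\<close>

definition surj_bounded_below :: "'a::complex_banach set \<Rightarrow> 'a set \<Rightarrow> real \<Rightarrow> ('a \<Rightarrow> 'a) \<Rightarrow> bool" where
  "surj_bounded_below V Y C S \<longleftrightarrow> (\<forall>y\<in>Y. \<exists>x\<in>Y. S x = y \<and> norm x \<le> C * norm y) \<and>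
     (\<forall>x\<in>V. \<forall>y\<in>Y. infdist x Y \<le> C * norm (S x - y))"

context invariant_op
begin

text \<open>Every range of a power contains the kernel, so closedness passes from each range to its
  image.\<close>

lemma Kato_imp_closed_rng:
  assumes K: "Kato V S"
  shows "closed (rng V (S ^^ n))"
proof (induction n)
  case (Suc n)
  have "closed (rng (rng V (S ^^ n)) S)"
    using K by (intro closed_image_if_kern_subset[OF _ Suc csub_rng rng_subset]) (auto simp: Kato_def)
  then show ?case by (simp only: rng_rng)
qed (simp add: rng_def closedV)

text \<open>The lower bound at \<open>y = 0\<close> puts the kernel into \<open>Y\<close>, and
  surjectivity on \<open>Y\<close> puts \<open>Y\<close> into every range. For closed range,
  \<open>x\<close> is replaced by \<open>x - y + z\<close> with \<open>y\<close> in \<open>Y\<close>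
  close to \<open>x\<close> and \<open>z\<close> in \<open>Y\<close> a short solution of
  \<open>S z = S y\<close>.\<close>

lemma
  assumes SB: "surj_bounded_below V Y C S" and Y: "closed Y" "csubspace Y" "Y \<subseteq> V"
    and SY: "\<And>y. y \<in> Y \<Longrightarrow> S y \<in> Y" and C: "C > 0"
  shows surj_bounded_below_kern: "kern V S \<subseteq> Y"
    and surj_bounded_below_rng: "Y \<subseteq> rng V (S ^^ n)"
    and surj_bounded_below_Kato: "Kato V S"
proof -
  have sur: "\<exists>x\<in>Y. S x = y \<and> norm x \<le> C * norm y" if "y \<in> Y" for y
    using SB that unfolding surj_bounded_below_def by blast
  have low: "infdist x Y \<le> C * norm (S x - y)" if "x \<in> V" "y \<in> Y" for x y
    using SB that unfolding surj_bounded_below_def by blast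
  have Y0: "0 \<in> Y" by (rule csubspace_0[OF Y(2)])
  show kern: "kern V S \<subseteq> Y"
  proof
    fix x assume "x \<in> kern V S"
    then have "infdist x Y = 0" using low[of x 0] Y0 infdist_nonneg[of x Y] by (auto simp: kern_def)
    then show "x \<in> Y" using in_closed_iff_infdist_zero[OF Y(1), of x] Y0 by blast
  qed
  have rngn: "Y \<subseteq> rng V (S ^^ n)" for n
  proof (induction n)
    case (Suc n)
    show ?case
    proof
      fix y assume "y \<in> Y"
      then obtain x where "x \<in> Y" "S x = y" using sur by blast
      then show "y \<in> rng V (S ^^ Suc n)" using Suc by (auto simp: rng_rng[symmetric] rng_def)
    qed
  qed (use Y(3) in \<open>simp add: rng_def\<close>)
  then show "Y \<subseteq> rng V (S ^^ n)" .
  obtain K where K: "K > 0" "\<And>x. norm (S x) \<le> norm x * K"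
    using bounded_linear.pos_bounded[OF blinS] by blast
  \<comment> \<open>The first summand bounds \<open>x - y\<close>: distance at most
    \<open>C * norm w\<close>, plus \<open>norm w\<close> since it need not be attained. The second
    bounds \<open>z\<close>, because \<open>norm (S y)\<close> is at most
    \<open>norm w + K * norm (x - y)\<close>.\<close>
  define C' where "C' = (C + 1) + C * (1 + (C + 1) * K)"
  have C': "C' \<ge> 0" unfolding C'_def using C K(1) by (intro add_nonneg_nonneg mult_nonneg_nonneg) auto
  have lift: "\<exists>x\<in>V. S x = w \<and> norm x \<le> C' * norm w" if w: "w \<in> S ` V" for w
  proof (cases "w = 0")
    case True
    then show ?thesis using csubspace_0[OF csubV] clinear_0[OF clinS] by (intro bexI[of _ 0]) auto
  next
    case False
    obtain x where x: "x \<in> V" "w = S x" using w by blast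
    obtain y where y: "y \<in> Y" "dist x y < infdist x Y + norm w"
      using infdist_approx[of Y "norm w" x] Y0 False by auto
    have xy: "norm (x - y) \<le> (C + 1) * norm w"
      using y(2) low[OF x(1) Y0] x(2) by (simp add: dist_norm algebra_simps)
    obtain z where z: "z \<in> Y" "S z = S y" "norm z \<le> C * norm (S y)" using sur[OF SY[OF y(1)]] by blast
    have "S (x - y) = w - S y" by (simp add: x(2) clinear_diff[OF clinS])
    moreover have "norm (S (x - y)) \<le> (C + 1) * norm w * K"
      using K(2)[of "x - y"] mult_right_mono[OF xy, of K] K(1) by linarith
    ultimately have "norm (S y) \<le> norm w + (C + 1) * norm w * K"
      using norm_triangle_ineq4[of w "S (x - y)"] by simp
    then have "norm z \<le> C * (norm w + (C + 1) * norm w * K)"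
      using C by (intro order_trans[OF z(3)] mult_left_mono) auto
    then have "norm (x - y + z) \<le> C' * norm w"
      using norm_triangle_ineq[of "x - y" z] xy by (simp add: C'_def algebra_simps)
    moreover have "S (x - y + z) = w"
      using z(2) x(2) by (simp add: clinear_add[OF clinS] clinear_diff[OF clinS])
    moreover have "x - y + z \<in> V"
      using x y z Y(3) by (auto intro!: csubspace_add[OF csubV] csubspace_diff[OF csubV])
    ultimately show ?thesis by blast
  qed
  show "Kato V S"
    unfolding Kato_def using lift_imp_closed_image[OF blinS closedV subV C' lift] kern rngn
    by (auto simp: rng_def)
qed

text \<open>A vector of the old kernel is sent to its multiple by \<open>a - b\<close>, which lies
  in \<open>Y\<close> and has a preimage \<open>g i\<close> in \<open>Y\<close> of norm at most
  \<open>C * cmod (b - a)\<close>. Subtracting these small corrections moves the family into the new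
  kernel and keeps it independent.\<close>

lemma qdim_kern_perturbation:
  assumes SB: "surj_bounded_below V Y C (shiftop S b)" and Y: "closed Y" "csubspace Y" "Y \<subseteq> V" and C: "C > 0"
    and kern: "kern V (shiftop S a) \<subseteq> Y"
    and small: "real n * 3 ^ n * (C * cmod (b - a)) < 1"
    and n: "enat n \<le> qdim (kern V (shiftop S a)) {0}"
  shows "enat n \<le> qdim (kern V (shiftop S b)) {0}"
proof -
  interpret a: invariant_op V "shiftop S a" by (rule invariant_op_shiftop)
  interpret b: invariant_op V "shiftop S b" by (rule invariant_op_shiftop)
  have ka: "csubspace (kern V (shiftop S a))" using a.csub_kern[of 1] by simp
  have kb: "csubspace (kern V (shiftop S b))" using b.csub_kern[of 1] by simp
  have ka0: "{0} \<subseteq> kern V (shiftop S a)" and kb0: "{0} \<subseteq> kern V (shiftop S b)"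
    using csubspace_0[OF ka] csubspace_0[OF kb] by auto
  obtain v where v: "\<And>i. i < n \<Longrightarrow> v i \<in> kern V (shiftop S a)" "\<And>i. i < n \<Longrightarrow> norm (v i) = 1"
    "\<And>c r i. r \<in> {0} \<Longrightarrow> i < n \<Longrightarrow> cmod (c i) \<le> 3 ^ n * norm ((\<Sum>j<n. scaleC (c j) (v j)) + r)"
    using quantitative_independence[OF ka closed_singleton csubspace_single_0 ka0 n] by blast
  have "\<exists>g\<in>Y. shiftop S b g = shiftop S b (v i) \<and> norm g \<le> C * cmod (b - a)" if i: "i < n" for i
  proof -
    have eq: "shiftop S b (v i) = scaleC (a - b) (v i)"
      using v(1)[OF i] by (simp add: kern_def shiftop_def cvs.scale_left_diff_distrib)
    have "v i \<in> Y" using v(1)[OF i] kern by blast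
    then have "shiftop S b (v i) \<in> Y" unfolding eq by (rule csubspace_scale[OF Y(2)])
    then obtain g where "g \<in> Y" "shiftop S b g = shiftop S b (v i)" "norm g \<le> C * norm (shiftop S b (v i))"
      using SB unfolding surj_bounded_below_def by blast
    moreover have "norm (shiftop S b (v i)) = cmod (b - a)"
      unfolding eq using v(2)[OF i] by (simp add: norm_scaleC norm_minus_commute)
    ultimately show ?thesis by auto
  qed
  then obtain g where g: "\<And>i. i < n \<Longrightarrow> g i \<in> Y" "\<And>i. i < n \<Longrightarrow> shiftop S b (g i) = shiftop S b (v i)"
    "\<And>i. i < n \<Longrightarrow> norm (g i) \<le> C * cmod (b - a)" by metis
  have "indep_mod {0} n (\<lambda>i. v i - g i)"
  proof (rule indep_modI_contraction[where R = "{0}" and v = v and k = "C * cmod (b - a)"])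
    fix c assume "(\<Sum>j<n. scaleC (c j) (v j - g j)) \<in> {0}"
    then have "(\<Sum>j<n. scaleC (c j) (v j)) = (\<Sum>j<n. scaleC (c j) (g j))"
      by (simp add: cvs.scale_right_diff_distrib sum_subtractf)
    then show "\<exists>r\<in>{0}. norm ((\<Sum>j<n. scaleC (c j) (v j)) + r) \<le> C * cmod (b - a) * (\<Sum>j<n. cmod (c j))"
      using norm_sum_scaleC_le[of n g "C * cmod (b - a)" c] g(3) by simp
  qed (use C small v(3) in auto)
  moreover have "v i - g i \<in> kern V (shiftop S b)" if i: "i < n" for i
    using v(1)[OF i] g(1,2)[OF i] Y(3)
    by (auto simp: kern_def clinear_diff[OF b.clinS] intro!: csubspace_diff[OF csubV])
  ultimately show ?thesis
    unfolding qdim_ge_iff[OF kb csubspace_single_0 kb0] by (intro exI[of _ "\<lambda>i. v i - g i"]) simp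
qed

text \<open>A family independent modulo the old range is independent modulo the new one, without
  change. A preimage \<open>x\<close> of a combination may be large, but it is close to
  \<open>Y\<close>, and \<open>Y\<close> lies in the old range.\<close>

lemma qdim_rng_perturbation:
  assumes SB: "surj_bounded_below V Y C (shiftop S b)" and Y: "closed Y" "csubspace Y" "Y \<subseteq> V" and C: "C > 0"
    and ra: "Y \<subseteq> rng V (shiftop S a)" "closed (rng V (shiftop S a))"
    and small: "real n * 3 ^ n * ((C + 1) * cmod (b - a)) < 1"
    and n: "enat n \<le> qdim V (rng V (shiftop S a))"
  shows "enat n \<le> qdim V (rng V (shiftop S b))"
proof -
  interpret a: invariant_op V "shiftop S a" by (rule invariant_op_shiftop)
  interpret b: invariant_op V "shiftop S b" by (rule invariant_op_shiftop)
  have Ra: "csubspace (rng V (shiftop S a))" "rng V (shiftop S a) \<subseteq> V"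
    using a.csub_rng[of 1] a.rng_subset[of 1] by simp_all
  have Rb: "csubspace (rng V (shiftop S b))" "rng V (shiftop S b) \<subseteq> V"
    using b.csub_rng[of 1] b.rng_subset[of 1] by simp_all
  obtain v where v: "\<And>i. i < n \<Longrightarrow> v i \<in> V" "\<And>i. i < n \<Longrightarrow> norm (v i) = 1"
    "\<And>c r i. r \<in> rng V (shiftop S a) \<Longrightarrow> i < n \<Longrightarrow> cmod (c i) \<le> 3 ^ n * norm ((\<Sum>j<n. scaleC (c j) (v j)) + r)"
    using quantitative_independence[OF csubV ra(2) Ra n] by blast
  have "indep_mod (rng V (shiftop S b)) n v"
  proof (rule indep_modI_contraction[where R = "rng V (shiftop S a)" and v = v and k = "(C + 1) * cmod (b - a)"])
    fix c assume c: "(\<Sum>j<n. scaleC (c j) (v j)) \<in> rng V (shiftop S b)"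
    define u where "u = (\<Sum>j<n. scaleC (c j) (v j))"
    define s where "s = (\<Sum>j<n. cmod (c j))"
    obtain x where x: "x \<in> V" "u = shiftop S b x" using c by (auto simp: rng_def u_def)
    have us: "norm u \<le> s" using norm_sum_scaleC_le[of n v 1 c] v(2) by (simp add: u_def s_def)
    show "\<exists>r\<in>rng V (shiftop S a). norm (u + r) \<le> (C + 1) * cmod (b - a) * s"
    proof (cases "s = 0")
      case True
      then show ?thesis using us csubspace_0[OF Ra(1)] by (intro bexI[of _ 0]) auto
    next
      case False
      then have s: "s > 0" using us norm_ge_zero[of u] by linarith
      have "infdist x Y \<le> C * norm (shiftop S b x - 0)"
        using SB x(1) csubspace_0[OF Y(2)] unfolding surj_bounded_below_def by blast
      also have "\<dots> \<le> C * s" using us C x(2) by simp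
      finally have "infdist x Y \<le> C * s" .
      then obtain y where y: "y \<in> Y" "norm (x - y) \<le> (C + 1) * s"
        using infdist_approx[of Y s x] s csubspace_0[OF Y(2)] by (force simp: dist_norm algebra_simps)
      \<comment> \<open>The term in \<open>y\<close> replaces \<open>x\<close> by
        \<open>x - y\<close> in the difference of the two shifts, so that
        \<open>u + r = scaleC (a - b) (x - y)\<close> is small.\<close>
      define r where "r = scaleC (b - a) y - shiftop S a x"
      have "r \<in> rng V (shiftop S a)"
        unfolding r_def using y(1) ra(1) x(1)
        by (intro csubspace_diff[OF Ra(1)] csubspace_scale[OF Ra(1)]) (auto simp: rng_def)
      moreover have "u + r = scaleC (a - b) (x - y)"
        by (simp add: r_def x(2) shiftop_def cvs.scale_left_diff_distrib cvs.scale_right_diff_distrib)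
      then have "norm (u + r) = cmod (b - a) * norm (x - y)" by (simp add: norm_scaleC norm_minus_commute)
      then have "norm (u + r) \<le> cmod (b - a) * ((C + 1) * s)"
        using y(2) by (simp add: mult_left_mono)
      ultimately show ?thesis by (intro bexI[of _ r]) (simp_all add: mult_ac)
    qed
  qed (use C small v(3) in auto)
  then show ?thesis unfolding qdim_ge_iff[OF csubV Rb] using v(1) by (intro exI[of _ v]) simp
qed

section \<open>Stability of Kato operators under small shifts\<close>

lemma surj_bounded_below_perturbation:
  assumes K: "Kato V S"
  shows "\<exists>Y C e. closed Y \<and> csubspace Y \<and> Y \<subseteq> V \<and> (\<forall>y\<in>Y. S y \<in> Y) \<and> C > 0 \<and> e > 0 \<and>
    (\<forall>l. cmod l < e \<longrightarrow> surj_bounded_below V Y C (shiftop S l))"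
proof -
  define Y where "Y = (\<Inter>n. rng V (S ^^ n))"
  have cY: "closed Y" unfolding Y_def using Kato_imp_closed_rng[OF K] by blast
  have sY: "csubspace Y"
    unfolding Y_def csubspace_iff using csub_rng by (auto simp: csubspace_iff cvs.subspace_Inter)
  have YV: "Y \<subseteq> V" unfolding Y_def using rng_subset[of 0] by blast
  have kY: "kern V S \<subseteq> Y" using K unfolding Kato_def Y_def by blast
  have SY: "S y \<in> Y" if y: "y \<in> Y" for y
  proof -
    have "S y \<in> rng V (S ^^ n)" for n
    proof (cases n)
      case 0
      then show ?thesis using y YV invS by (auto simp: rng_def)
    next
      case (Suc m)
      have "y \<in> rng V (S ^^ m)" using y by (auto simp: Y_def)
      then show ?thesis unfolding Suc rng_rng[symmetric] by (auto simp: rng_def)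
    qed
    then show ?thesis by (simp add: Y_def)
  qed
  have lift: "x \<in> Y" if x: "x \<in> V" "S x \<in> Y" for x
  proof -
    have "x \<in> rng V (S ^^ n)" for n
    proof -
      have "S x \<in> rng V (S ^^ Suc n)" using x(2) by (simp only: Y_def) blast
      then obtain z where z: "z \<in> rng V (S ^^ n)" "S x = S z" by (auto simp: rng_rng[symmetric] rng_def)
      have "z \<in> V" using z rng_subset by blast
      then have "x - z \<in> kern V S" using x z by (simp add: kern_def clinear_diff[OF clinS] csubspace_diff[OF csubV])
      then have "x - z \<in> rng V (S ^^ n)" using kY by (auto simp: Y_def)
      then show ?thesis using csubspace_add[OF csub_rng _ z(1), of "x - z"] by simp
    qed
    then show ?thesis by (simp add: Y_def)
  qed
  have SYeq: "S ` Y = Y"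
  proof
    show "Y \<subseteq> S ` Y"
    proof
      fix y assume y: "y \<in> Y"
      then have "y \<in> rng V (S ^^ 1)" by (simp only: Y_def) blast
      then obtain x where "x \<in> V" "y = S x" by (auto simp: rng_def)
      then show "y \<in> S ` Y" using lift y by blast
    qed
  qed (use SY in auto)
  obtain C1 where C1: "C1 > 0" "\<forall>y\<in>S ` Y. \<exists>x\<in>Y. S x = y \<and> norm x \<le> C1 * norm y"
    using open_mapping_closed_subspace[OF blinS cY csubspace_imp_subspace[OF sY]] SYeq cY by auto
  obtain C2 where C2: "C2 > 0" "\<forall>y\<in>rng V S. \<exists>x\<in>V. S x = y \<and> norm x \<le> C2 * norm y"
    using bounded_lift K by (auto simp: Kato_def)
  have low: "infdist x Y \<le> C2 * norm (S x - y)" if x: "x \<in> V" "y \<in> Y" for x y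
  proof -
    have "y \<in> S ` V" using x(2) SYeq YV by blast
    then have "S x - y \<in> rng V S" using x csubspace_diff[OF csub_rng[of 1], of "S x" y] by (auto simp: rng_def)
    then obtain z where z: "z \<in> V" "S z = S x - y" "norm z \<le> C2 * norm (S x - y)" using C2(2) by blast
    have "x - z \<in> Y" using lift[of "x - z"] x z by (simp add: clinear_diff[OF clinS] csubspace_diff[OF csubV])
    from infdist_le[OF this, of x] show ?thesis using z(3) by (simp add: dist_norm)
  qed
  \<comment> \<open>The doubling pays for the shift: if \<open>cmod l < 1 / C\<close>, then
    \<open>cmod l * C1\<close> and \<open>cmod l * C2\<close> are at most 1/2. The first halves
    residuals in \<open>Y\<close>, the second lets half of \<open>infdist x Y\<close> be
    absorbed.\<close>
  define C where "C = 2 * max C1 C2"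
  have C: "C > 0" "2 * C1 \<le> C" "2 * C2 \<le> C" using C1(1) C2(1) by (auto simp: C_def)
  have "surj_bounded_below V Y C (shiftop S l)" if l: "cmod l < 1 / C" for l
    unfolding surj_bounded_below_def
  proof (intro conjI ballI)
    interpret l: invariant_op V "shiftop S l" by (rule invariant_op_shiftop)
    have lC: "cmod l * C < 1" using l C(1) by (simp add: field_simps)
    have l1: "cmod l * C1 \<le> 1/2" "cmod l * C2 \<le> 1/2"
      using lC mult_left_mono[OF C(2), of "cmod l"] mult_left_mono[OF C(3), of "cmod l"] by auto
    fix y assume y: "y \<in> Y"
    have ap: "\<exists>x\<in>Y. norm x \<le> C1 * norm y \<and> y - shiftop S l x \<in> Y \<and> norm (y - shiftop S l x) \<le> norm y / 2"
      if y: "y \<in> Y" for y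
    proof -
      obtain x where x: "x \<in> Y" "S x = y" "norm x \<le> C1 * norm y" using C1(2) y SYeq by auto
      have eq: "y - shiftop S l x = scaleC l x" using x(2) by (simp add: shiftop_def)
      have "norm (scaleC l x) \<le> cmod l * (C1 * norm y)" using x(3) by (simp add: norm_scaleC mult_left_mono)
      also have "\<dots> \<le> norm y / 2" using mult_right_mono[OF l1(1), of "norm y"] by (simp add: mult_ac)
      finally show ?thesis using x eq csubspace_scale[OF sY] by auto
    qed
    obtain x where x: "x \<in> Y" "shiftop S l x = y" "norm x \<le> 2 * C1 * norm y"
      using approximate_lift_imp_lift[OF l.blinS cY csubspace_imp_subspace[OF sY] _ ap y] C1(1) by auto
    have "2 * C1 * norm y \<le> C * norm y" using C(2) by (rule mult_right_mono) simp
    then show "\<exists>x\<in>Y. shiftop S l x = y \<and> norm x \<le> C * norm y" using x by auto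
  next
    fix x y assume x: "x \<in> V" and y: "y \<in> Y"
    have lC: "cmod l * C < 1" using l C(1) by (simp add: field_simps)
    have l1: "cmod l * C2 \<le> 1/2"
      using lC mult_left_mono[OF C(3), of "cmod l"] by auto
    define t where "t = norm (shiftop S l x - y)"
    \<comment> \<open>The term \<open>d\<close> is there because the distance to \<open>Y\<close>
      need not be attained.\<close>
    have "infdist x Y \<le> 2 * (C2 * t) + d" if d: "d > 0" for d
    proof -
      obtain z where z: "z \<in> Y" "dist x z < infdist x Y + d"
        using infdist_approx[of Y d x] csubspace_0[OF sY] d by blast
      have "y + scaleC l z \<in> Y" using y z by (intro csubspace_add[OF sY] csubspace_scale[OF sY])
      then have "infdist x Y \<le> C2 * norm (S x - (y + scaleC l z))" by (rule low[OF x])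
      also have "S x - (y + scaleC l z) = (shiftop S l x - y) + scaleC l (x - z)"
        by (simp add: shiftop_def cvs.scale_right_diff_distrib)
      also have "C2 * norm \<dots> \<le> C2 * (t + cmod l * dist x z)"
        using norm_triangle_ineq[of "shiftop S l x - y" "scaleC l (x - z)"] C2(1)
        by (simp add: t_def norm_scaleC dist_norm)
      also have "\<dots> = C2 * t + (cmod l * C2) * dist x z" by (simp add: algebra_simps)
      also have "\<dots> \<le> C2 * t + (1/2) * (infdist x Y + d)"
        using l1 z(2) by (intro add_left_mono mult_mono) auto
      finally show ?thesis by (simp add: field_simps)
    qed
    then have "infdist x Y \<le> 2 * (C2 * t)" by (rule field_le_epsilon)
    also have "\<dots> \<le> C * t" unfolding mult.assoc[symmetric] using C(3) by (rule mult_right_mono) (simp add: t_def)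
    finally show "infdist x Y \<le> C * norm (shiftop S l x - y)" by (simp add: t_def)
  qed
  then show ?thesis using cY sY YV SY C(1) by (intro exI[of _ Y] exI[of _ C] exI[of _ "1 / C"]) simp
qed

text \<open>One \<open>Y\<close> and one \<open>C\<close> serve every point of the disc, so the two
  perturbation lemmas apply between any two sufficiently close points, in both directions, with a
  distance that depends on \<open>n\<close> only.\<close>

theorem Kato_perturbation:
  assumes K: "Kato V S"
  shows "\<exists>e>0. \<forall>l. cmod l < e \<longrightarrow> Kato V (shiftop S l) \<and>
    qdim (kern V (shiftop S l)) {0} = qdim (kern V S) {0} \<and>
    qdim V (rng V (shiftop S l)) = qdim V (rng V S)"
proof -
  obtain Y C e where *: "closed Y \<and> csubspace Y \<and> Y \<subseteq> V \<and> (\<forall>y\<in>Y. S y \<in> Y) \<and> C > 0 \<and> e > 0 \<and>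
    (\<forall>l. cmod l < e \<longrightarrow> surj_bounded_below V Y C (shiftop S l))"
    using surj_bounded_below_perturbation[OF K] by (elim exE)
  then have Y: "closed Y" "csubspace Y" "Y \<subseteq> V" and SY: "\<And>y. y \<in> Y \<Longrightarrow> S y \<in> Y"
    and C: "C > 0" and e: "e > 0" and SB: "\<And>l. cmod l < e \<Longrightarrow> surj_bounded_below V Y C (shiftop S l)"
    by auto
  have facts: "kern V (shiftop S l) \<subseteq> Y \<and> Y \<subseteq> rng V (shiftop S l) \<and> Kato V (shiftop S l)"
    if l: "cmod l < e" for l
  proof -
    interpret l: invariant_op V "shiftop S l" by (rule invariant_op_shiftop)
    have "shiftop S l y \<in> Y" if "y \<in> Y" for y
      unfolding shiftop_def using that SY by (intro csubspace_diff[OF Y(2)] csubspace_scale[OF Y(2)])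
    note l.surj_bounded_below_kern[OF SB[OF l] Y this C] l.surj_bounded_below_rng[OF SB[OF l] Y this C, of 1]
      l.surj_bounded_below_Kato[OF SB[OF l] Y this C]
    then show ?thesis by simp
  qed
  have rate: "\<exists>d>0. \<forall>x\<in>ball 0 e. \<forall>y\<in>ball 0 e. dist x y < d \<longrightarrow> real n * 3 ^ n * (B * cmod (y - x)) < 1"
    if B: "B > 0" for n :: nat and B :: real
  proof -
    define A where "A = real n * 3 ^ n * B + 1"
    have A: "A > 0" using B unfolding A_def by (intro add_nonneg_pos mult_nonneg_nonneg) auto
    have "real n * 3 ^ n * (B * cmod (y - x)) < 1" if xy: "dist x y < 1 / A" for x y :: complex
    proof -
      have "real n * 3 ^ n * (B * cmod (y - x)) \<le> A * dist x y"
        by (simp add: A_def dist_norm norm_minus_commute algebra_simps)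
      also have "\<dots> < 1" using xy A by (simp add: field_simps)
      finally show ?thesis .
    qed
    then show ?thesis using A by (intro exI[of _ "1 / A"]) auto
  qed
  have "qdim (kern V (shiftop S l)) {0} = qdim (kern V (shiftop S 0)) {0}"
    and "qdim V (rng V (shiftop S l)) = qdim V (rng V (shiftop S 0))" if l: "cmod l < e" for l
  proof -
    have l0: "l \<in> ball 0 e" "0 \<in> ball (0::complex) e" using l e by simp_all
    show "qdim (kern V (shiftop S l)) {0} = qdim (kern V (shiftop S 0)) {0}"
    proof (rule enat_constant_on_connected[where q = "\<lambda>l. qdim (kern V (shiftop S l)) {0}", OF connected_ball l0])
      fix n
      show "\<exists>d>0. \<forall>x\<in>ball 0 e. \<forall>y\<in>ball 0 e. dist x y < d \<longrightarrow>
        enat n \<le> qdim (kern V (shiftop S x)) {0} \<longrightarrow> enat n \<le> qdim (kern V (shiftop S y)) {0}"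
      proof -
        obtain d where d: "d > 0" "\<And>x y. x \<in> ball 0 e \<Longrightarrow> y \<in> ball 0 e \<Longrightarrow> dist x y < d \<Longrightarrow>
            real n * 3 ^ n * (C * cmod (y - x)) < 1"
          using rate[OF C, of n] by blast
        have "enat n \<le> qdim (kern V (shiftop S y)) {0}"
          if "x \<in> ball 0 e" "y \<in> ball 0 e" "dist x y < d" "enat n \<le> qdim (kern V (shiftop S x)) {0}" for x y
          by (rule qdim_kern_perturbation[OF SB Y C _ d(2)]) (use that facts[of x] in auto)
        then show ?thesis using d(1) by blast
      qed
    qed
    show "qdim V (rng V (shiftop S l)) = qdim V (rng V (shiftop S 0))"
    proof (rule enat_constant_on_connected[where q = "\<lambda>l. qdim V (rng V (shiftop S l))", OF connected_ball l0])
      fix n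
      have C1: "C + 1 > 0" using C by simp
      show "\<exists>d>0. \<forall>x\<in>ball 0 e. \<forall>y\<in>ball 0 e. dist x y < d \<longrightarrow>
        enat n \<le> qdim V (rng V (shiftop S x)) \<longrightarrow> enat n \<le> qdim V (rng V (shiftop S y))"
      proof -
        obtain d where d: "d > 0" "\<And>x y. x \<in> ball 0 e \<Longrightarrow> y \<in> ball 0 e \<Longrightarrow> dist x y < d \<Longrightarrow>
            real n * 3 ^ n * ((C + 1) * cmod (y - x)) < 1"
          using rate[OF C1, of n] by blast
        have "enat n \<le> qdim V (rng V (shiftop S y))"
          if "x \<in> ball 0 e" "y \<in> ball 0 e" "dist x y < d" "enat n \<le> qdim V (rng V (shiftop S x))" for x y
          by (rule qdim_rng_perturbation[OF SB Y C _ _ d(2)]) (use that facts[of x] in \<open>auto simp: Kato_def\<close>)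
        then show ?thesis using d(1) by blast
      qed
    qed
  qed
  then show ?thesis using facts e by (intro exI[of _ e]) simp
qed

end

section \<open>Semi-Fredholm and Riesz operators\<close>

lemma enat_sequence_attains_minimum:
  fixes q :: "nat \<Rightarrow> enat"
  shows "\<exists>p. \<forall>n. q p \<le> q n"
proof -
  obtain p where "q p = (LEAST x. x \<in> range q)"
    using LeastI[of "\<lambda>x. x \<in> range q" "q 0"] by auto
  then have "q p \<le> q n" for n by (simp add: Least_le)
  then show ?thesis by blast
qed

lemma enat_le_neq_infinity: "(a::enat) \<le> b \<Longrightarrow> b \<noteq> \<infinity> \<Longrightarrow> a \<noteq> \<infinity>"
  by (cases a; cases b) auto

text \<open>The isomorphism of \<open>f V / f U\<close> with \<open>V / (U + ker f)\<close>.\<close>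

lemma qdim_image:
  assumes f: "clinear f" and V: "csubspace V" and U: "csubspace U" "U \<subseteq> V"
  shows "qdim (f ` V) (f ` U) = qdim V {u + k | u k. u \<in> U \<and> k \<in> kern V f}"
proof (rule qdim_transfer[symmetric, OF V _ _ _ _ _ f])
  have k: "csubspace (kern V f)" by (rule csubspace_kern[OF f V])
  show "csubspace {u + k | u k. u \<in> U \<and> k \<in> kern V f}" by (rule csubspace_sums[OF U(1) k])
  show "{u + k | u k. u \<in> U \<and> k \<in> kern V f} \<subseteq> V" using U(2) by (auto simp: kern_def intro!: csubspace_add[OF V])
  show fU: "csubspace (f ` U)" "csubspace (f ` V)"
    using csubspace_rng[OF f U(1)] csubspace_rng[OF f V] by (simp_all add: rng_def)
  show "\<exists>x\<in>V. y - f x \<in> f ` U" if y: "y \<in> f ` V" for y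
  proof -
    obtain x where "x \<in> V" "y = f x" using y by blast
    then show ?thesis using csubspace_0[OF fU(1)] by (intro bexI[of _ x]) auto
  qed
  show "f x \<in> f ` U \<longleftrightarrow> x \<in> {u + k | u k. u \<in> U \<and> k \<in> kern V f}" if x: "x \<in> V" for x
  proof
    assume "f x \<in> f ` U"
    then obtain u where u: "u \<in> U" "f x = f u" by auto
    then have "x - u \<in> kern V f" using x U(2) by (auto simp: kern_def clinear_diff[OF f] intro!: csubspace_diff[OF V])
    then show "x \<in> {u + k | u k. u \<in> U \<and> k \<in> kern V f}"
      using u(1) by (intro CollectI exI[of _ u] exI[of _ "x - u"]) simp
  next
    assume "x \<in> {u + k | u k. u \<in> U \<and> k \<in> kern V f}"
    then obtain u k where "x = u + k" "u \<in> U" "k \<in> kern V f" by blast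
    then show "f x \<in> f ` U" by (simp add: clinear_add[OF f] kern_def)
  qed
qed (use U in auto)

lemma qdim_image_le:
  assumes f: "clinear f" and V: "csubspace V" and U: "csubspace U" "U \<subseteq> V"
  shows "qdim (f ` V) (f ` U) \<le> qdim V U"
proof -
  have k: "csubspace (kern V f)" by (rule csubspace_kern[OF f V])
  have "U \<subseteq> {u + k | u k. u \<in> U \<and> k \<in> kern V f}"
    using csubspace_0[OF k] by force
  moreover have "{u + k | u k. u \<in> U \<and> k \<in> kern V f} \<subseteq> V"
    using U(2) by (auto simp: kern_def intro!: csubspace_add[OF V])
  ultimately show ?thesis
    unfolding qdim_image[OF assms] using csubspace_sums[OF U(1) k] U V by (intro qdim_antimono_right)
qed

lemma qdim_rank_nullity:
  assumes f: "clinear f" and V: "csubspace V"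
  shows "qdim V {0} = qdim (f ` V) {0} + qdim (kern V f) {0}"
proof -
  have k: "csubspace (kern V f)" "kern V f \<subseteq> V"
    using csubspace_kern[OF f V] by simp (auto simp: kern_def)
  have 0: "{0} \<subseteq> kern V f" "{0} \<subseteq> V" using csubspace_0[OF k(1)] csubspace_0[OF V] by auto
  have "qdim (f ` V) (f ` {0}) = qdim V {u + k | u k. u \<in> {0} \<and> k \<in> kern V f}"
    by (rule qdim_image[OF f V csubspace_single_0 0(2)])
  then have "qdim (f ` V) {0} = qdim V (kern V f)" by (simp add: clinear_0[OF f])
  then show ?thesis using qdim_add[OF V csubspace_single_0 0(1) k] by simp
qed

text \<open>Bijectivity in the form in which it is the vanishing of the two dimensions that Kato
  perturbation preserves.\<close>

definition cbij :: "'a::complex_banach set \<Rightarrow> ('a \<Rightarrow> 'a) \<Rightarrow> bool" where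
  "cbij V S \<longleftrightarrow> kern V S = {0} \<and> rng V S = V"

section \<open>Semi-Fredholm operators and the ranges of their powers\<close>

context invariant_op
begin

text \<open>If \<open>x = (S ^^ n) y\<close> is in the kernel of \<open>S\<close>, then
  \<open>y\<close> is in that of \<open>S ^^ Suc n\<close>, hence in the range, which gains one
  power. The next lemma is the converse, so the Kato inclusion may be checked on either
  side.\<close>

lemma kern_funpow_subset_imp:
  assumes "\<And>n. kern V (S ^^ n) \<subseteq> rng V S"
  shows "kern V S \<subseteq> rng V (S ^^ n)"
proof (induction n)
  case (Suc n)
  show ?case
  proof
    fix x assume x: "x \<in> kern V S"
    then obtain y where y: "y \<in> V" "x = (S ^^ n) y" using Suc by (auto simp: rng_def)
    then have "y \<in> kern V (S ^^ Suc n)" using x by (simp add: kern_def)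
    then obtain z where "z \<in> V" "y = S z" using assms[of "Suc n"] by (auto simp: rng_def)
    then show "x \<in> rng V (S ^^ Suc n)" using y(2) by (auto simp: rng_def funpow_swap1)
  qed
qed (auto simp: rng_def kern_def)

lemma Kato_kern_funpow_subset:
  assumes K: "Kato V S"
  shows "kern V (S ^^ n) \<subseteq> rng V S"
proof (induction n)
  case 0
  show ?case using csubspace_0[OF csub_rng[of 1]] by (auto simp: kern_def)
next
  case (Suc n)
  interpret n: invariant_op V "S ^^ n" by (rule invariant_op_funpow)
  show ?case
  proof
    fix x assume x: "x \<in> kern V (S ^^ Suc n)"
    then have xV: "x \<in> V" by (simp add: kern_def)
    then have "(S ^^ n) x \<in> kern V S" using x n.invS by (simp add: kern_def)
    then have "(S ^^ n) x \<in> rng V (S ^^ Suc n)" using K unfolding Kato_def by blast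
    then obtain z where z: "z \<in> V" "(S ^^ n) x = (S ^^ n) (S z)" by (auto simp: rng_def funpow_swap1)
    then have "x - S z \<in> kern V (S ^^ n)"
      using xV invS by (auto simp: kern_def clinear_diff[OF n.clinS] intro!: csubspace_diff[OF csubV])
    then have "x - S z \<in> rng V S" using Suc by blast
    moreover have "S z \<in> rng V S" using z(1) by (auto simp: rng_def)
    ultimately show "x \<in> rng V S" using csubspace_add[OF csub_rng[of 1], of "x - S z" "S z"] by simp
  qed
qed

lemma rng_antimono: "m \<le> n \<Longrightarrow> rng V (S ^^ n) \<subseteq> rng V (S ^^ m)"
proof (induction n rule: dec_induct)
  case (step n)
  have "rng V (S ^^ Suc n) \<subseteq> rng V (S ^^ n)"
  proof
    fix y assume "y \<in> rng V (S ^^ Suc n)"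
    then obtain x where "x \<in> V" "y = (S ^^ n) (S x)" by (auto simp: rng_def funpow_swap1)
    then show "y \<in> rng V (S ^^ n)" using invS by (auto simp: rng_def)
  qed
  then show ?case using step by blast
qed simp

lemma kern_mono: "m \<le> n \<Longrightarrow> kern V (S ^^ m) \<subseteq> kern V (S ^^ n)"
  by (induction n rule: dec_induct) (auto simp: kern_def clinear_0[OF clinS])

text \<open>The finite-dimensional spaces \<open>kern V S \<inter> rng V (S ^^ n)\<close> decrease,
  hence are constant from some \<open>p\<close> on. From there the kernel on the range of
  \<open>S ^^ p\<close> lies in all further ranges.\<close>

lemma Kato_rng_if_Phi_plus:
  assumes P: "Phi_plus V S"
  shows "\<exists>p. closed (rng V (S ^^ p)) \<and> Kato (rng V (S ^^ p)) S"
proof -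
  have k: "csubspace (kern V S)" using csub_kern[of 1] by simp
  have fin: "cfinite_dim (kern V S)" and cl: "closed (rng V S)" using P by (auto simp: Phi_plus_def)
  \<comment> \<open>Adding the finite-dimensional kernel to \<open>L\<close> keeps it closed and
    does not change its image.\<close>
  have img: "closed (rng L S)" if L: "closed L" "csubspace L" "L \<subseteq> V" for L
  proof -
    let ?U = "{l + k | l k. l \<in> L \<and> k \<in> kern V S}"
    have "closed (rng ?U S)"
    proof (rule closed_image_if_kern_subset[OF cl])
      show "closed ?U" by (rule closed_csubspace_plus_finite_dim[OF L(1,2) fin])
      show "csubspace ?U" by (rule csubspace_sums[OF L(2) k])
      show "?U \<subseteq> V" using L(3) by (auto simp: kern_def intro!: csubspace_add[OF csubV])
      show "kern V S \<subseteq> ?U" using csubspace_0[OF L(2)] by force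
    qed
    moreover have "rng ?U S = rng L S"
    proof
      show "rng ?U S \<subseteq> rng L S" by (auto simp: rng_def kern_def clinear_add[OF clinS])
      have "L \<subseteq> ?U" using csubspace_0[OF k] by force
      then show "rng L S \<subseteq> rng ?U S" unfolding rng_def by (rule image_mono)
    qed
    ultimately show ?thesis by simp
  qed
  have clr: "closed (rng V (S ^^ n))" for n
  proof (induction n)
    case (Suc n)
    show ?case unfolding rng_rng[symmetric] by (rule img[OF Suc csub_rng rng_subset])
  qed (simp add: rng_def closedV)
  define U where "U = (\<lambda>n. kern V S \<inter> rng V (S ^^ n))"
  have U: "csubspace (U n)" "{0} \<subseteq> U n" for n
    unfolding U_def using csubspace_inter[OF k csub_rng] csubspace_0[OF k] csubspace_0[OF csub_rng] by auto
  obtain p where p: "\<forall>n. qdim (U p) {0} \<le> qdim (U n) {0}"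
    using enat_sequence_attains_minimum[of "\<lambda>n. qdim (U n) {0}"] by blast
  have "qdim (U p) {0} \<le> qdim (kern V S) {0}"
    by (rule qdim_mono_left[OF k U(1) csubspace_single_0 U(2)]) (simp add: U_def)
  then have fp: "qdim (U p) {0} \<noteq> \<infinity>"
    using fin unfolding cfinite_dim_iff_qdim[OF k] by (rule enat_le_neq_infinity)
  have Ueq: "U n = U p" if n: "p \<le> n" for n
  proof -
    have sub: "U n \<subseteq> U p" using rng_antimono[OF n] by (auto simp: U_def)
    have "qdim (U p) {0} = qdim (U p) (U n) + qdim (U n) {0}"
      by (rule qdim_add[OF U(1) csubspace_single_0 U(2) U(1) sub])
    then have "qdim (U p) (U n) = 0"
      using p[rule_format, of n] fp by (cases "qdim (U p) {0}"; cases "qdim (U p) (U n)"; cases "qdim (U n) {0}")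
        (auto simp: zero_enat_def)
    then show ?thesis using qdim_eq_0_iff[OF U(1) U(1) sub] by simp
  qed
  have "Kato (rng V (S ^^ p)) S"
    unfolding Kato_def
  proof (intro conjI allI)
    show "closed (rng (rng V (S ^^ p)) S)" unfolding rng_rng by (rule clr)
    fix n
    have "kern (rng V (S ^^ p)) S \<subseteq> U p" using rng_subset[of p] by (auto simp: kern_def U_def)
    also have "U p = U (n + p)" using Ueq[of "n + p"] by simp
    also have "\<dots> \<subseteq> rng V (S ^^ (n + p))" by (simp add: U_def)
    finally show "kern (rng V (S ^^ p)) S \<subseteq> rng (rng V (S ^^ p)) (S ^^ n)" unfolding rng_rng_funpow .
  qed
  then show ?thesis using clr by blast
qed

lemma fin_codim_rng_funpow:
  assumes P: "fin_codim V (rng V S)"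
  shows "fin_codim V (rng V (S ^^ n))"
proof (induction n)
  case 0
  show ?case using qdim_self[OF csubV] by (simp add: fin_codim_iff_qdim rng_def)
next
  case (Suc n)
  have "qdim V (rng V (S ^^ Suc n)) = qdim V (rng V S) + qdim (rng V S) (rng V (S ^^ Suc n))"
    using rng_antimono[of 1 "Suc n"] csub_rng[of 1] rng_subset[of 1] csub_rng[of "Suc n"]
    by (intro qdim_add[OF csubV]) auto
  moreover have "qdim (rng V S) (rng V (S ^^ Suc n)) \<le> qdim V (rng V (S ^^ n))"
    using qdim_image_le[OF clinS csubV csub_rng rng_subset, of n] rng_rng[of V n S] by (simp add: rng_def)
  moreover have "qdim (rng V S) (rng V (S ^^ Suc n)) \<noteq> \<infinity>"
    using calculation(2) Suc unfolding fin_codim_iff_qdim by (rule enat_le_neq_infinity)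
  ultimately show ?case using P unfolding fin_codim_iff_qdim by auto
qed

text \<open>Dual argument: the spaces \<open>rng V S + kern V (S ^^ n)\<close> increase and have
  finite codimension, so they stabilise at some \<open>p\<close>. This controls kernels of powers on
  \<open>rng V (S ^^ p)\<close>, and the dual form of the Kato inclusion finishes.\<close>

lemma Kato_rng_if_Phi_minus:
  assumes P: "Phi_minus V S"
  shows "\<exists>p. closed (rng V (S ^^ p)) \<and> Kato (rng V (S ^^ p)) S"
proof -
  have fin: "fin_codim V (rng V S)" using P by (simp add: Phi_minus_def)
  have clr: "closed (rng V (S ^^ n))" for n
    by (rule invariant_op.closed_rng_if_fin_codim[OF invariant_op_funpow fin_codim_rng_funpow[OF fin]])
  have r: "csubspace (rng V S)" "rng V S \<subseteq> V" using csub_rng[of 1] rng_subset[of 1] by simp_all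
  define U where "U = (\<lambda>n. {r + k | r k. r \<in> rng V S \<and> k \<in> kern V (S ^^ n)})"
  have U: "csubspace (U n)" "rng V S \<subseteq> U n" "U n \<subseteq> V" for n
  proof -
    show "csubspace (U n)" unfolding U_def by (rule csubspace_sums[OF r(1) csub_kern])
    show "rng V S \<subseteq> U n" unfolding U_def using csubspace_0[OF csub_kern] by force
    show "U n \<subseteq> V" unfolding U_def using r(2) by (auto simp: kern_def intro!: csubspace_add[OF csubV])
  qed
  obtain p where p: "\<forall>n. qdim V (U p) \<le> qdim V (U n)"
    using enat_sequence_attains_minimum[of "\<lambda>n. qdim V (U n)"] by blast
  have "qdim V (U p) \<le> qdim V (rng V S)" by (rule qdim_antimono_right[OF csubV U(1) r(1) U(2,3)])
  then have fp: "qdim V (U p) \<noteq> \<infinity>"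
    using fin unfolding fin_codim_iff_qdim by (rule enat_le_neq_infinity)
  have Ueq: "U n = U p" if n: "p \<le> n" for n
  proof -
    have sub: "U p \<subseteq> U n" using kern_mono[OF n] by (auto simp: U_def)
    have "qdim V (U p) = qdim V (U n) + qdim (U n) (U p)"
      by (rule qdim_add[OF csubV U(1) sub U(1,3)])
    then have "qdim (U n) (U p) = 0"
      using p[rule_format, of n] fp by (cases "qdim V (U p)"; cases "qdim (U n) (U p)"; cases "qdim V (U n)")
        (auto simp: zero_enat_def)
    then show ?thesis using qdim_eq_0_iff[OF U(1) U(1) sub] by simp
  qed
  interpret R: invariant_op "rng V (S ^^ p)" S by (rule invariant_op_rng[OF clr])
  have "kern (rng V (S ^^ p)) (S ^^ n) \<subseteq> rng (rng V (S ^^ p)) S" for n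
  proof
    interpret p: invariant_op V "S ^^ p" by (rule invariant_op_funpow)
    fix x assume x: "x \<in> kern (rng V (S ^^ p)) (S ^^ n)"
    then obtain y where y: "y \<in> V" "x = (S ^^ p) y" by (auto simp: kern_def rng_def)
    have "(S ^^ (n + p)) y = 0" using x y by (simp add: kern_def funpow_add)
    then have "y \<in> kern V (S ^^ (n + p))" using y(1) by (simp add: kern_def)
    then have "y \<in> U (n + p)" using csubspace_0[OF r(1)] unfolding U_def by force
    then have "y \<in> U p" using Ueq[of "n + p"] by simp
    then obtain z k where z: "z \<in> V" "k \<in> kern V (S ^^ p)" "y = S z + k" by (auto simp: U_def rng_def)
    then have "x = (S ^^ p) (S z)" using y(2) by (simp add: clinear_add[OF p.clinS] kern_def)
    then have "x = S ((S ^^ p) z)" by (simp add: funpow_swap1)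
    then show "x \<in> rng (rng V (S ^^ p)) S" using z(1) by (auto simp: rng_def)
  qed
  then have "kern (rng V (S ^^ p)) S \<subseteq> rng (rng V (S ^^ p)) (S ^^ n)" for n by (rule R.kern_funpow_subset_imp)
  moreover have "closed (rng (rng V (S ^^ p)) S)" unfolding rng_rng by (rule clr)
  ultimately show ?thesis using clr unfolding Kato_def by blast
qed

text \<open>\<open>S\<close> maps the kernel of \<open>S ^^ Suc n\<close> into that of
  \<open>S ^^ n\<close>, with kernel \<open>kern V S\<close>; rank and nullity do the rest.\<close>

lemma fin_dim_kern_funpow:
  assumes fin: "qdim (kern V S) {0} \<noteq> \<infinity>"
  shows "qdim (kern V (S ^^ n)) {0} \<noteq> \<infinity>"
proof (induction n)
  case 0
  have "kern V (S ^^ 0) = {0}" using csubspace_0[OF csubV] by (auto simp: kern_def)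
  then have "qdim (kern V (S ^^ 0)) {0} = 0" using qdim_self[OF csubspace_single_0] by (simp only:)
  then show ?case by (simp only:) simp
next
  case (Suc n)
  let ?K = "kern V (S ^^ Suc n)"
  have kk: "kern ?K S = kern V S" by (auto simp: kern_def funpow_swap1 clinear_0[OF clinear_funpow[OF clinS]])
  have eqK: "qdim ?K {0} = qdim (S ` ?K) {0} + qdim (kern V S) {0}"
    using qdim_rank_nullity[OF clinS csub_kern, of "Suc n"] by (simp only: kk)
  have "qdim (S ` ?K) {0} \<le> qdim (kern V (S ^^ n)) {0}"
  proof (rule qdim_mono_left[OF csub_kern _ csubspace_single_0])
    show c: "csubspace (S ` ?K)" using csubspace_rng[OF clinS csub_kern, of "Suc n"] by (simp only: rng_def)
    show "{0} \<subseteq> S ` ?K" using csubspace_0[OF c] by simp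
    show "S ` ?K \<subseteq> kern V (S ^^ n)" using invS by (auto simp: kern_def funpow_swap1)
  qed
  then have "qdim (S ` ?K) {0} \<noteq> \<infinity>" using Suc by (rule enat_le_neq_infinity)
  then show ?case using fin unfolding eqK by auto
qed

section \<open>Comparing \<open>V\<close> with the range of a power\<close>

text \<open>\<open>S\<close> is nilpotent on \<open>V / rng V (S ^^ p)\<close>, so
  \<open>S - l\<close> is injective there. Concretely,
  \<open>scaleC l x = S x - shiftop S l x\<close> raises the power of the range containing
  \<open>x\<close> one by one.\<close>

lemma mem_rng_if_shiftop_mem_rng:
  assumes l: "l \<noteq> 0" and x: "x \<in> V" and y: "shiftop S l x \<in> rng V (S ^^ p)"
  shows "x \<in> rng V (S ^^ p)"
proof -
  have "x \<in> rng V (S ^^ j)" if "j \<le> p" for j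
    using that
  proof (induction j)
    case (Suc j)
    have "shiftop S l x \<in> rng V (S ^^ Suc j)" using y rng_antimono[OF Suc.prems] by blast
    moreover have "S x \<in> rng V (S ^^ Suc j)" using Suc unfolding rng_rng[symmetric] by (simp add: rng_def)
    ultimately have "S x - shiftop S l x \<in> rng V (S ^^ Suc j)" by (intro csubspace_diff[OF csub_rng])
    moreover have "S x - shiftop S l x = scaleC l x" by (simp add: shiftop_def)
    ultimately show ?case using csubspace_scale_iff[OF csub_rng l] by metis
  qed (use x in \<open>simp add: rng_def\<close>)
  then show ?thesis by simp
qed

text \<open>The counterpart on kernels: \<open>S\<close> is nilpotent on
  \<open>kern V (S ^^ n)\<close>, so \<open>S - l\<close> is onto there.\<close>

lemma kern_funpow_subset_rng_shiftop:
  assumes l: "l \<noteq> 0"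
  shows "kern V (S ^^ n) \<subseteq> rng V (shiftop S l)"
proof -
  interpret l: invariant_op V "shiftop S l" by (rule invariant_op_shiftop)
  have R: "csubspace (rng V (shiftop S l))" using l.csub_rng[of 1] by simp
  have "k \<in> rng V (shiftop S l)" if "k \<in> V" "(S ^^ n) k = 0" for k
    using that
  proof (induction n arbitrary: k)
    case 0
    then show ?case using csubspace_0[OF R] by simp
  next
    case (Suc n)
    have "S k \<in> rng V (shiftop S l)" using Suc invS by (simp add: funpow_swap1)
    moreover have "shiftop S l k \<in> rng V (shiftop S l)" using Suc.prems by (simp add: rng_def)
    ultimately have "S k - shiftop S l k \<in> rng V (shiftop S l)" by (rule csubspace_diff[OF R])
    moreover have "S k - shiftop S l k = scaleC l k" by (simp add: shiftop_def)
    ultimately show ?case using csubspace_scale_iff[OF R l] by metis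
  qed
  then show ?thesis by (auto simp: kern_def)
qed

text \<open>Comparing \<open>qdim V (rng V (S ^^ p))\<close> computed through \<open>rng V S\<close> and through \<open>rng V (S ^^ p) + kern V S\<close>
  gives index zero without any index theory.\<close>

lemma Browder_if_stable:
  assumes P: "Phi_plus V S \<or> Phi_minus V S"
    and inj: "kern (rng V (S ^^ p)) S = {0}" and sur: "rng (rng V (S ^^ p)) S = rng V (S ^^ p)"
  shows "Browder V S \<and> qdim (kern V S) {0} = qdim V (rng V S)"
proof -
  let ?R = "rng V (S ^^ p)"
  have k: "csubspace (kern V S)" "kern V S \<subseteq> V" using csub_kern[of 1] by (auto simp: kern_def)
  have r: "csubspace (rng V S)" "rng V S \<subseteq> V" using csub_rng[of 1] rng_subset[of 1] by simp_all
  have stable: "rng V (S ^^ Suc p) = ?R" using sur by (simp only: rng_rng)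
  have Rr: "?R \<subseteq> rng V S" using rng_antimono[of 1 "Suc p"] stable by simp
  have "kern V S \<inter> ?R = kern ?R S" using rng_subset[of p] by (auto simp: kern_def)
  then have kR: "kern V S \<inter> ?R = {0}" by (simp only: inj)
  have down: "kern V (S ^^ Suc p) \<subseteq> kern V (S ^^ p)"
  proof
    fix x assume x: "x \<in> kern V (S ^^ Suc p)"
    then have "(S ^^ p) x \<in> kern ?R S" by (auto simp: kern_def rng_def)
    then have "(S ^^ p) x = 0" unfolding inj by simp
    then show "x \<in> kern V (S ^^ p)" using x by (simp add: kern_def)
  qed
  have asc: "finite_ascent V S"
    unfolding finite_ascent_def by (intro exI[of _ p] equalityI down kern_mono) simp
  have desc: "finite_descent V S" unfolding finite_descent_def using stable by (intro exI[of _ p]) simp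
  have iter: "rng ?R (S ^^ n) = ?R" for n
  proof (induction n)
    case (Suc n)
    have "rng ?R (S ^^ Suc n) = rng (rng ?R (S ^^ n)) S" by (simp only: rng_rng)
    then show ?case by (simp only: Suc.IH sur)
  qed (simp add: rng_def)
  interpret p: invariant_op V "S ^^ p" by (rule invariant_op_funpow)
  \<comment> \<open>The spanning half of the Fitting decomposition. If the kernel of
    \<open>S\<close> is finite-dimensional, it bounds the codimension of \<open>?R\<close> by the
    dimension of \<open>kern V (S ^^ p)\<close>.\<close>
  have dec: "V = {k + r | k r. k \<in> kern V (S ^^ p) \<and> r \<in> ?R}"
  proof
    show "V \<subseteq> {k + r | k r. k \<in> kern V (S ^^ p) \<and> r \<in> ?R}"
    proof
      fix x assume x: "x \<in> V"
      then have "(S ^^ p) x \<in> rng ?R (S ^^ p)" unfolding iter by (simp add: rng_def)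
      then obtain y where y: "y \<in> ?R" "(S ^^ p) x = (S ^^ p) y" by (auto simp: rng_def)
      then have "x - y \<in> kern V (S ^^ p)"
        using x rng_subset[of p] by (auto simp: kern_def clinear_diff[OF p.clinS] intro!: csubspace_diff[OF csubV])
      then show "x \<in> {k + r | k r. k \<in> kern V (S ^^ p) \<and> r \<in> ?R}"
        using y(1) by (intro CollectI exI[of _ "x - y"] exI[of _ y]) simp
    qed
    show "{k + r | k r. k \<in> kern V (S ^^ p) \<and> r \<in> ?R} \<subseteq> V"
      using rng_subset[of p] by (auto simp: kern_def intro!: csubspace_add[OF csubV])
  qed
  have finR: "qdim V ?R \<noteq> \<infinity>"
    using P
  proof
    assume "Phi_plus V S"
    then have "qdim (kern V (S ^^ p)) {0} \<noteq> \<infinity>"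
      using fin_dim_kern_funpow cfinite_dim_iff_qdim[OF k(1)] by (simp add: Phi_plus_def)
    moreover have "qdim V ?R = qdim (kern V (S ^^ p)) (kern V (S ^^ p) \<inter> ?R)"
      by (subst (1) dec) (rule qdim_sum[OF csub_kern csub_rng])
    moreover have "qdim (kern V (S ^^ p)) (kern V (S ^^ p) \<inter> ?R) \<le> qdim (kern V (S ^^ p)) {0}"
      using csubspace_0[OF csub_kern] csubspace_0[OF csub_rng]
      by (intro qdim_antimono_right[OF csub_kern csubspace_inter[OF csub_kern csub_rng] csubspace_single_0]) auto
    ultimately show ?thesis by (metis enat_le_neq_infinity)
  next
    assume "Phi_minus V S"
    then show ?thesis using fin_codim_rng_funpow by (simp add: Phi_minus_def fin_codim_iff_qdim)
  qed
  have "qdim V (rng V S) \<le> qdim V ?R" by (rule qdim_antimono_right[OF csubV r(1) csub_rng Rr r(2)])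
  then have fc: "fin_codim V (rng V S)"
    using finR unfolding fin_codim_iff_qdim by (rule enat_le_neq_infinity)
  let ?Q = "{r + k | r k. r \<in> ?R \<and> k \<in> kern V S}"
  have Qeq: "?Q = {k + r | k r. k \<in> kern V S \<and> r \<in> ?R}"
  proof (intro set_eqI iffI)
    fix x assume "x \<in> ?Q"
    then obtain r k where "r \<in> ?R" "k \<in> kern V S" "x = r + k" by blast
    then show "x \<in> {k + r | k r. k \<in> kern V S \<and> r \<in> ?R}"
      by (intro CollectI exI[of _ k] exI[of _ r]) (simp add: add.commute)
  next
    fix x assume "x \<in> {k + r | k r. k \<in> kern V S \<and> r \<in> ?R}"
    then obtain r k where "r \<in> ?R" "k \<in> kern V S" "x = k + r" by blast
    then show "x \<in> ?Q"
      by (intro CollectI exI[of _ r] exI[of _ k]) (simp add: add.commute)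
  qed
  have Q: "csubspace ?Q" "?R \<subseteq> ?Q" "?Q \<subseteq> V"
    using csubspace_sums[OF csub_rng k(1)] csubspace_0[OF k(1)] k(2) rng_subset[of p]
    by (force, force, auto intro!: csubspace_add[OF csubV])
  have QR: "qdim ?Q ?R = qdim (kern V S) {0}"
    unfolding Qeq using qdim_sum[OF k(1) csub_rng, of p] by (simp add: kR)
  have "qdim V ?R = qdim V ?Q + qdim ?Q ?R" by (rule qdim_add[OF csubV csub_rng Q(2,1,3)])
  moreover have "qdim V ?R = qdim V (rng V S) + qdim (rng V S) ?R"
    by (rule qdim_add[OF csubV csub_rng Rr r])
  \<comment> \<open>As \<open>S\<close> maps \<open>?R\<close> onto itself,
    \<open>rng V S / ?R\<close> is isomorphic to \<open>V / (?R + kern V S)\<close>. This finite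
    term occurs in both sums and cancels.\<close>
  moreover have "qdim (rng V S) ?R = qdim V ?Q"
    using qdim_image[OF clinS csubV csub_rng rng_subset, of p] sur by (simp add: rng_def)
  ultimately have eq: "qdim (kern V S) {0} = qdim V (rng V S)" and fk: "qdim (kern V S) {0} \<noteq> \<infinity>"
    using finR QR by (cases "qdim V ?Q"; cases "qdim (kern V S) {0}"; cases "qdim V (rng V S)"; auto)+
  have "Phi V S"
    unfolding Phi_def Phi_plus_def Phi_minus_def
    using fk fc closed_rng_if_fin_codim[OF fc] by (simp add: cfinite_dim_iff_qdim[OF k(1)])
  then show ?thesis using asc desc eq by (simp add: Browder_def)
qed

text \<open>On \<open>?R\<close>, the range of a power on which \<open>S\<close> is Kato,
  bijectivity of \<open>S - l\<close> means that two numbers independent of \<open>l\<close> vanish.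
  For \<open>l \<noteq> 0\<close> the nilpotency lemmas carry bijectivity between \<open>?R\<close>
  and \<open>V\<close>. The radius is fixed before the bijective point, as the later connectedness
  argument needs.\<close>

lemma punctured_neighbourhood:
  assumes P: "Phi_plus V S \<or> Phi_minus V S"
  shows "\<exists>e>0. (\<exists>l. cmod l < e \<and> cbij V (shiftop S l)) \<longrightarrow>
    Browder V S \<and> qdim (kern V S) {0} = qdim V (rng V S) \<and>
    (\<forall>l. l \<noteq> 0 \<longrightarrow> cmod l < e \<longrightarrow> cbij V (shiftop S l))"
proof -
  obtain p where p: "closed (rng V (S ^^ p))" "Kato (rng V (S ^^ p)) S"
    using P Kato_rng_if_Phi_plus Kato_rng_if_Phi_minus by blast
  let ?R = "rng V (S ^^ p)"
  interpret R: invariant_op ?R S by (rule invariant_op_rng[OF p(1)])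
  obtain e where e: "e > 0" "\<And>l. cmod l < e \<Longrightarrow>
      qdim (kern ?R (shiftop S l)) {0} = qdim (kern ?R S) {0} \<and>
      qdim ?R (rng ?R (shiftop S l)) = qdim ?R (rng ?R S)"
    using R.Kato_perturbation[OF p(2)] by blast
  have zero: "cbij ?R (shiftop S l) \<longleftrightarrow> qdim (kern ?R S) {0} = 0 \<and> qdim ?R (rng ?R S) = 0"
    if l: "cmod l < e" for l
  proof -
    interpret l: invariant_op ?R "shiftop S l" by (rule R.invariant_op_shiftop)
    have kl: "csubspace (kern ?R (shiftop S l))" using l.csub_kern[of 1] by simp
    have "qdim (kern ?R (shiftop S l)) {0} = 0 \<longleftrightarrow> kern ?R (shiftop S l) = {0}"
      using csubspace_0[OF kl] by (intro qdim_eq_0_iff[OF kl]) auto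
    moreover have "qdim ?R (rng ?R (shiftop S l)) = 0 \<longleftrightarrow> ?R = rng ?R (shiftop S l)"
      using l.csub_rng[of 1] l.rng_subset[of 1] by (intro qdim_eq_0_iff[OF csub_rng]) auto
    ultimately show ?thesis using e(2)[OF l] by (auto simp: cbij_def)
  qed
  have main: "Browder V S \<and> qdim (kern V S) {0} = qdim V (rng V S) \<and>
    (\<forall>l. l \<noteq> 0 \<longrightarrow> cmod l < e \<longrightarrow> cbij V (shiftop S l))"
    if l: "cmod l < e" and b: "cbij V (shiftop S l)" for l
  proof -
    have "cbij ?R (shiftop S l)"
    proof (cases "l = 0")
      case True
      then have "rng V S = V" using b by (simp add: cbij_def)
      then have "rng V (S ^^ n) = V" for n
        by (induction n) (simp_all add: rng_rng[symmetric] del: funpow.simps, simp add: rng_def)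
      then show ?thesis using b by simp
    next
      case False
      have "kern ?R (shiftop S l) = {0}"
        using b rng_subset[of p] csubspace_0[OF csub_rng, of p] by (auto simp: cbij_def kern_def)
      moreover have "?R \<subseteq> rng ?R (shiftop S l)"
      proof
        fix y assume y: "y \<in> ?R"
        then have "y \<in> rng V (shiftop S l)" using rng_subset b by (auto simp: cbij_def)
        then obtain x where x: "x \<in> V" "y = shiftop S l x" by (auto simp: rng_def)
        then have "x \<in> ?R" using mem_rng_if_shiftop_mem_rng[OF False x(1)] y by simp
        then show "y \<in> rng ?R (shiftop S l)" using x(2) by (simp add: rng_def)
      qed
      moreover have "rng ?R (shiftop S l) \<subseteq> ?R"
        using invariant_op.rng_subset[OF R.invariant_op_shiftop, where n = 1] by simp
      ultimately show ?thesis by (simp add: cbij_def)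
    qed
    then have Rb: "cbij ?R (shiftop S l')" if "cmod l' < e" for l' using zero that l by blast
    have R0: "kern ?R S = {0}" "rng ?R S = ?R" using Rb[of 0] e(1) by (simp_all add: cbij_def)
    have "cbij V (shiftop S l')" if l': "l' \<noteq> 0" "cmod l' < e" for l'
    proof -
      interpret l': invariant_op V "shiftop S l'" by (rule invariant_op_shiftop)
      have rl: "csubspace (rng V (shiftop S l'))" "rng V (shiftop S l') \<subseteq> V"
        using l'.csub_rng[of 1] l'.rng_subset[of 1] by simp_all
      have "kern V (shiftop S l') \<subseteq> {0}"
      proof
        fix x assume x: "x \<in> kern V (shiftop S l')"
        then have "x \<in> ?R"
          using mem_rng_if_shiftop_mem_rng[OF l'(1), of x p] csubspace_0[OF csub_rng] by (simp add: kern_def)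
        then have "x \<in> kern ?R (shiftop S l')" using x by (simp add: kern_def)
        then show "x \<in> {0}" using Rb[OF l'(2)] by (simp add: cbij_def)
      qed
      moreover have "V \<subseteq> rng V (shiftop S l')"
      proof
        interpret p: invariant_op V "S ^^ p" by (rule invariant_op_funpow)
        fix x assume x: "x \<in> V"
        have "rng ?R (S ^^ n) = ?R" for n
        proof (induction n)
          case (Suc n)
          have "rng ?R (S ^^ Suc n) = rng (rng ?R (S ^^ n)) S" by (simp only: rng_rng)
          then show ?case by (simp only: Suc.IH R0)
        qed (simp add: rng_def)
        then have "(S ^^ p) x \<in> rng ?R (S ^^ p)" using x by (simp add: rng_def)
        then obtain y where y: "y \<in> ?R" "(S ^^ p) x = (S ^^ p) y" by (auto simp: rng_def)
        then have "x - y \<in> kern V (S ^^ p)"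
          using x rng_subset[of p] by (auto simp: kern_def clinear_diff[OF p.clinS] intro!: csubspace_diff[OF csubV])
        then have "x - y \<in> rng V (shiftop S l')" using kern_funpow_subset_rng_shiftop[OF l'(1)] by blast
        moreover have "y \<in> rng ?R (shiftop S l')" using Rb[OF l'(2)] y(1) by (simp add: cbij_def)
        then have "y \<in> rng V (shiftop S l')" using rng_subset[of p] by (auto simp: rng_def)
        ultimately show "x \<in> rng V (shiftop S l')" using csubspace_add[OF rl(1), of "x - y" y] by simp
      qed
      ultimately show ?thesis
        using rl(2) csubspace_0[OF csubspace_kern[OF l'.clinS csubV]] by (auto simp: cbij_def)
    qed
    then show ?thesis using Browder_if_stable[OF P R0] by blast
  qed
  then show ?thesis using e(1) by (intro exI[of _ e]) blast
qed

text \<open>Starting point for the connectedness argument. The multiple by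
  \<open>- inverse l\<close> is an approximate right inverse: its residual \<open>- S x\<close> has
  relative size at most \<open>K / cmod l\<close>, below 1/2, and successive approximation does the
  work of the Neumann series.\<close>

lemma cbij_if_large: "\<exists>K>0. \<forall>l. K < cmod l \<longrightarrow> cbij V (shiftop S l)"
proof -
  obtain K where K: "K > 0" "\<And>x. norm (S x) \<le> norm x * K"
    using bounded_linear.pos_bounded[OF blinS] by blast
  have "cbij V (shiftop S l)" if l: "2 * K < cmod l" for l
  proof -
    interpret l: invariant_op V "shiftop S l" by (rule invariant_op_shiftop)
    have l0: "l \<noteq> 0" "cmod l > 0" using l K(1) by auto
    have "x = 0" if "x \<in> kern V (shiftop S l)" for x
    proof (rule ccontr)
      assume "x \<noteq> 0"
      have "S x = scaleC l x" using that by (simp add: kern_def shiftop_def)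
      then have "cmod l * norm x \<le> K * norm x" using K(2)[of x] by (simp add: norm_scaleC mult.commute)
      then show False using \<open>x \<noteq> 0\<close> l K(1) by simp
    qed
    then have "kern V (shiftop S l) = {0}"
      using csubspace_0[OF csubspace_kern[OF l.clinS csubV]] by blast
    moreover have "\<exists>x\<in>V. norm x \<le> (1 / cmod l) * norm y \<and> y - shiftop S l x \<in> V \<and> norm (y - shiftop S l x) \<le> norm y / 2"
      if y: "y \<in> V" for y
    proof -
      define x where "x = scaleC (- inverse l) y"
      have x: "x \<in> V" unfolding x_def by (rule csubspace_scale[OF csubV y])
      have nx: "norm x = norm y / cmod l" by (simp add: x_def norm_scaleC norm_inverse divide_inverse mult.commute)
      have eq: "y - shiftop S l x = - S x" using l0 by (simp add: x_def shiftop_def)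
      have "norm (S x) \<le> norm y / cmod l * K" using K(2)[of x] nx by simp
      also have "\<dots> \<le> norm y / 2" using l l0 mult_left_mono[of "2 * K" "cmod l" "norm y"] by (simp add: field_simps)
      finally have "norm (y - shiftop S l x) \<le> norm y / 2" by (simp add: eq)
      moreover have "y - shiftop S l x \<in> V" unfolding eq by (rule csubspace_neg[OF csubV invS[OF x]])
      ultimately show ?thesis using x nx by (intro bexI[of _ x]) simp_all
    qed
    then have "V \<subseteq> rng V (shiftop S l)"
      using approximate_lift_imp_lift[OF l.blinS closedV subV, of "1 / cmod l" V] by (force simp: rng_def)
    moreover have "rng V (shiftop S l) \<subseteq> V" using l.rng_subset[of 1] by simp
    ultimately show ?thesis by (simp add: cbij_def)
  qed
  then show ?thesis using K(1) by (intro exI[of _ "2 * K"]) simp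
qed

text \<open>Points of bijectivity are dense near every nonzero point because the punctured plane is connected; hence they
  also accumulate at \<open>0\<close>, which makes the case \<open>l = 0\<close> work.\<close>

theorem Riesz_imp_Browder:
  assumes R: "Riesz V S" and P: "Phi_plus V (shiftop S l) \<or> Phi_minus V (shiftop S l)"
  shows "Browder V (shiftop S l) \<and> qdim (kern V (shiftop S l)) {0} = qdim V (rng V (shiftop S l))"
proof -
  \<comment> \<open>\<open>near m\<close> only places \<open>m\<close> in the closure of the set of
    bijectivity. The closure can be followed through isolated points at which bijectivity
    fails.\<close>
  define near where "near = (\<lambda>m. \<forall>r>0. \<exists>v. cmod (v - m) < r \<and> cbij V (shiftop S v))"
  have local: "\<exists>e>0. (\<exists>v. cmod (v - m) < e \<and> cbij V (shiftop S v)) \<longrightarrow>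
      (Browder V (shiftop S m) \<and> qdim (kern V (shiftop S m)) {0} = qdim V (rng V (shiftop S m))) \<and>
      (\<forall>v. v \<noteq> m \<longrightarrow> cmod (v - m) < e \<longrightarrow> cbij V (shiftop S v))"
    if m: "Phi_plus V (shiftop S m) \<or> Phi_minus V (shiftop S m)" for m
  proof -
    interpret m: invariant_op V "shiftop S m" by (rule invariant_op_shiftop)
    obtain e where e: "e > 0" "(\<exists>l. cmod l < e \<and> cbij V (shiftop (shiftop S m) l)) \<longrightarrow>
      Browder V (shiftop S m) \<and> qdim (kern V (shiftop S m)) {0} = qdim V (rng V (shiftop S m)) \<and>
      (\<forall>l. l \<noteq> 0 \<longrightarrow> cmod l < e \<longrightarrow> cbij V (shiftop (shiftop S m) l))"
      using m.punctured_neighbourhood[OF m] by blast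
    show ?thesis
    proof (intro exI[of _ e] conjI impI e(1))
      assume "\<exists>v. cmod (v - m) < e \<and> cbij V (shiftop S v)"
      then obtain v where v: "cmod (v - m) < e" "cbij V (shiftop S v)" by blast
      then have "cbij V (shiftop (shiftop S m) (v - m))" by (simp add: shiftop_shiftop)
      then have *: "Browder V (shiftop S m) \<and> qdim (kern V (shiftop S m)) {0} = qdim V (rng V (shiftop S m)) \<and>
        (\<forall>l. l \<noteq> 0 \<longrightarrow> cmod l < e \<longrightarrow> cbij V (shiftop (shiftop S m) l))"
        using e(2) v(1) by blast
      then show "Browder V (shiftop S m)" "qdim (kern V (shiftop S m)) {0} = qdim V (rng V (shiftop S m))"
        by blast+
      show "\<forall>v. v \<noteq> m \<longrightarrow> cmod (v - m) < e \<longrightarrow> cbij V (shiftop S v)"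
      proof (intro allI impI)
        fix w assume "w \<noteq> m" "cmod (w - m) < e"
        then have "cbij V (shiftop (shiftop S m) (w - m))" using * by simp
        then show "cbij V (shiftop S w)" by (simp add: shiftop_shiftop)
      qed
    qed
  qed
  have Phi: "Phi_plus V (shiftop S m) \<or> Phi_minus V (shiftop S m)" if "m \<noteq> 0" for m
    using R that unfolding Riesz_def Phi_def shiftop_def by blast
  obtain K where K: "K > 0" "\<And>l. K < cmod l \<Longrightarrow> cbij V (shiftop S l)" using cbij_if_large by blast
  have near_nz: "near m" if m: "m \<noteq> 0" for m
  proof (rule connected_induction_simple[where P = near and S = "- {0::complex}" and a = "complex_of_real (K + 1)"])
    show "connected (- {0::complex})" by (rule connected_punctured_universe) simp
    show "complex_of_real (K + 1) \<in> - {0}" using K(1) by (simp del: of_real_add)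
    show "m \<in> - {0}" using m by simp
    have "cbij V (shiftop S (complex_of_real (K + 1)))"
      using K by (intro K(2)) (simp del: of_real_add)
    then show "near (complex_of_real (K + 1))" unfolding near_def by force
    fix a :: complex assume "a \<in> - {0}"
    then have "a \<noteq> 0" by simp
    from local[OF Phi[OF this]] obtain e where e: "e > 0" "(\<exists>v. cmod (v - a) < e \<and> cbij V (shiftop S v)) \<longrightarrow>
       (\<forall>v. v \<noteq> a \<longrightarrow> cmod (v - a) < e \<longrightarrow> cbij V (shiftop S v))" by blast
    \<comment> \<open>A point of closure in the disc supplies a bijective point in it, and then the
      whole disc, except possibly its centre \<open>a\<close>, is bijective; the centre is still a
      limit of such points.\<close>
    have step: "near y" if x: "x \<in> ball a e" "near x" and y: "y \<in> ball a e" for x y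
    proof -
      have "e - dist a x > 0" using x by simp
      then obtain v where v: "cmod (v - x) < e - dist a x" "cbij V (shiftop S v)"
        using x(2) unfolding near_def by blast
      have "cmod (v - a) < e" using v(1) norm_triangle_ineq[of "v - x" "x - a"] by (simp add: dist_norm norm_minus_commute)
      then have all: "cbij V (shiftop S w)" if "w \<noteq> a" "cmod (w - a) < e" for w using e(2) v(2) that by blast
      show ?thesis
        unfolding near_def
      proof (intro allI impI)
        fix r :: real assume r: "r > 0"
        show "\<exists>v. cmod (v - y) < r \<and> cbij V (shiftop S v)"
        proof (cases "y = a")
          case True
          define w where "w = a + complex_of_real (min r e / 2)"
          have "cmod (w - a) = min r e / 2" using r e(1) by (simp add: w_def del: of_real_divide)
          then have "cmod (w - a) < r" "cmod (w - a) < e" "w \<noteq> a" using r e(1) by auto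
          then show ?thesis using all True by blast
        next
          case False
          then have "cbij V (shiftop S y)" using all y by (simp add: dist_norm norm_minus_commute)
          then show ?thesis using r by (intro exI[of _ y]) simp
        qed
      qed
    qed
    have "openin (top_of_set (- {0})) (- {0} \<inter> ball a e)" by (simp add: openin_open_Int)
    moreover have "a \<in> - {0} \<inter> ball a e" using \<open>a \<noteq> 0\<close> e(1) by simp
    ultimately show "\<exists>T. openin (top_of_set (- {0})) T \<and> a \<in> T \<and> (\<forall>x\<in>T. \<forall>y\<in>T. near x \<longrightarrow> near y)"
      using step by blast
  qed
  have near: "near m" for m
  proof (cases "m = 0")
    case True
    show ?thesis
      unfolding near_def
    proof (intro allI impI)
      fix r :: real assume r: "r > 0"
      define w where "w = complex_of_real (r / 2)"
      have w: "cmod w = r / 2" "w \<noteq> 0" using r by (simp_all add: w_def del: of_real_divide)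
      obtain v where v: "cmod (v - w) < r / 2" "cbij V (shiftop S v)"
        using near_nz[OF w(2)] r unfolding near_def by (meson half_gt_zero)
      have "cmod (v - m) < r" using v(1) w(1) norm_triangle_ineq[of "v - w" w] True by simp
      then show "\<exists>v. cmod (v - m) < r \<and> cbij V (shiftop S v)" using v(2) by blast
    qed
  qed (rule near_nz)
  obtain e where "e > 0" "(\<exists>v. cmod (v - l) < e \<and> cbij V (shiftop S v)) \<longrightarrow>
      (Browder V (shiftop S l) \<and> qdim (kern V (shiftop S l)) {0} = qdim V (rng V (shiftop S l)))"
    using local[OF P] by blast
  moreover have "\<exists>v. cmod (v - l) < e \<and> cbij V (shiftop S v)"
    using near[of l] \<open>e > 0\<close> unfolding near_def by blast
  ultimately show ?thesis by blast
qed

end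

section \<open>Reducing pairs and the spectral inclusions\<close>

abbreviation ssum :: "'a::complex_banach set \<Rightarrow> 'a set \<Rightarrow> 'a set" where
  "ssum U U' \<equiv> {u + w | u w. u \<in> U \<and> w \<in> U'}"

context invariant_op
begin

section \<open>Ascent, descent and index in terms of relative dimension\<close>

text \<open>A kernel vector is \<open>(S ^^ p) y\<close> for some \<open>y\<close> in the kernel of
  \<open>S ^^ Suc p\<close>, which equals that of \<open>S ^^ p\<close>; so the vector is
  zero.\<close>

lemma Kato_finite_ascent_imp_inj:
  assumes K: "Kato V S" and asc: "finite_ascent V S"
  shows "kern V S = {0}"
proof -
  obtain p where p: "kern V (S ^^ p) = kern V (S ^^ Suc p)" using asc unfolding finite_ascent_def by blast
  have "x = 0" if x: "x \<in> kern V S" for x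
  proof -
    have "x \<in> rng V (S ^^ p)" using K x unfolding Kato_def by blast
    then obtain y where y: "y \<in> V" "x = (S ^^ p) y" unfolding rng_def by blast
    then have "y \<in> kern V (S ^^ Suc p)" using x by (simp add: kern_def)
    then have "y \<in> kern V (S ^^ p)" using p by simp
    then show "x = 0" using y(2) by (simp add: kern_def)
  qed
  then show ?thesis using csubspace_0[OF csubspace_kern[OF clinS csubV]] by blast
qed

text \<open>Stable ranges give \<open>x - S z\<close> in the kernel of \<open>S ^^ q\<close>, and
  for a Kato operator this kernel lies in the range of \<open>S\<close>.\<close>

lemma Kato_finite_descent_imp_surj:
  assumes K: "Kato V S" and desc: "finite_descent V S"
  shows "rng V S = V"
proof
  show "rng V S \<subseteq> V" using rng_subset[of 1] by simp
  obtain q where q: "rng V (S ^^ q) = rng V (S ^^ Suc q)" using desc unfolding finite_descent_def by blast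
  interpret q: invariant_op V "S ^^ q" by (rule invariant_op_funpow)
  show "V \<subseteq> rng V S"
  proof
    fix x assume x: "x \<in> V"
    then have "(S ^^ q) x \<in> rng V (S ^^ q)" by (simp add: rng_def)
    then have "(S ^^ q) x \<in> rng V (S ^^ Suc q)" by (simp only: q)
    then obtain z where z: "z \<in> V" "(S ^^ q) x = (S ^^ q) (S z)" by (auto simp: rng_def funpow_swap1)
    then have "x - S z \<in> kern V (S ^^ q)"
      using x invS by (auto simp: kern_def clinear_diff[OF q.clinS] intro!: csubspace_diff[OF csubV])
    then have "x - S z \<in> rng V S" using Kato_kern_funpow_subset[OF K] by blast
    moreover have "S z \<in> rng V S" using z(1) by (simp add: rng_def)
    ultimately show "x \<in> rng V S" using csubspace_add[OF csub_rng[of 1], of "x - S z" "S z"] by simp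
  qed
qed

lemma qdim_kern_eq_0_iff: "qdim (kern V S) {0} = 0 \<longleftrightarrow> kern V S = {0}"
  using csubspace_kern[OF clinS csubV] csubspace_0[OF csubspace_kern[OF clinS csubV]]
  by (intro qdim_eq_0_iff) auto

lemma qdim_rng_eq_0_iff: "qdim V (rng V S) = 0 \<longleftrightarrow> rng V S = V"
  using qdim_eq_0_iff[OF csubV csub_rng[of 1] rng_subset[of 1]] by auto

lemma Phi_plus_iff: "Phi_plus V S \<longleftrightarrow> qdim (kern V S) {0} \<noteq> \<infinity> \<and> closed (rng V S)"
  unfolding Phi_plus_def cfinite_dim_iff_qdim[OF csubspace_kern[OF clinS csubV]] ..

lemma Phi_minus_iff: "Phi_minus V S \<longleftrightarrow> qdim V (rng V S) \<noteq> \<infinity>"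
  unfolding Phi_minus_def fin_codim_iff_qdim ..

text \<open>The case distinction on an infinite codimension is absorbed by the order of
  \<open>enat\<close>; likewise for an infinite kernel in \<open>W_minus_iff\<close>.\<close>

lemma W_plus_iff: "W_plus V S \<longleftrightarrow> Phi_plus V S \<and> qdim (kern V S) {0} \<le> qdim V (rng V S)"
  unfolding W_plus_def Phi_plus_def cfinite_dim_iff[OF csubspace_kern[OF clinS csubV]]
    cdim_eq_codim[OF csubspace_kern[OF clinS csubV]] by (auto simp: qdim_def)

lemma W_minus_iff: "W_minus V S \<longleftrightarrow> Phi_minus V S \<and> qdim V (rng V S) \<le> qdim (kern V S) {0}"
  unfolding W_minus_def Phi_minus_def cfinite_dim_iff[OF csubspace_kern[OF clinS csubV]]
    cdim_eq_codim[OF csubspace_kern[OF clinS csubV]] by (auto simp: qdim_def)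

lemma W_iff: "W V S \<longleftrightarrow> Phi V S \<and> qdim (kern V S) {0} = qdim V (rng V S)"
  unfolding W_def Phi_def Phi_plus_def Phi_minus_def cfinite_dim_iff[OF csubspace_kern[OF clinS csubV]]
    cdim_eq_codim[OF csubspace_kern[OF clinS csubV]] by (auto simp: qdim_def)

end

section \<open>Splitting along two complementary invariant subspaces\<close>

locale reducing_pair =
  fixes M N :: "'a::complex_banach set" and S :: "'a \<Rightarrow> 'a"
  assumes closedM: "closed M" and closedN: "closed N"
    and csubM: "csubspace M" and csubN: "csubspace N"
    and bclS: "bounded_clinear S"
    and invM: "x \<in> M \<Longrightarrow> S x \<in> M" and invN: "x \<in> N \<Longrightarrow> S x \<in> N"
    and disj: "M \<inter> N = {0}" and span: "\<exists>m\<in>M. \<exists>n\<in>N. x = m + n"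
begin

sublocale X: invariant_op UNIV S
  by unfold_locales (auto simp: bclS)

sublocale M: invariant_op M S
  by unfold_locales (auto simp: bclS closedM csubM invM)

sublocale N: invariant_op N S
  by unfold_locales (auto simp: bclS closedN csubN invN)

lemma reducing_pair_shiftop: "reducing_pair M N (shiftop S l)"
  using M.invariant_op_shiftop[of l] N.invariant_op_shiftop[of l] disj span
  by unfold_locales (auto simp: invariant_op_def)

lemma reducing_pair_funpow: "reducing_pair M N (S ^^ n)"
  using M.invariant_op_funpow[of n] N.invariant_op_funpow[of n] disj span
  by unfold_locales (auto simp: invariant_op_def)

lemma sum_unique:
  assumes "m \<in> M" "n \<in> N" "m' \<in> M" "n' \<in> N" "m + n = m' + n'"
  shows "m = m' \<and> n = n'"
proof -
  have eq: "m - m' = n' - n" using assms(5) by (metis add_diff_eq diff_add_eq add_diff_cancel_left' add_diff_cancel_right')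
  have "m - m' \<in> M" using assms csubspace_diff[OF csubM] by blast
  moreover have "m - m' \<in> N" unfolding eq using assms csubspace_diff[OF csubN] by blast
  ultimately have "m - m' \<in> M \<inter> N" by (rule IntI)
  then have "m = m'" unfolding disj by simp
  then show ?thesis using eq by simp
qed

lemma UNIV_eq: "UNIV = ssum M N"
  using span by blast

lemma kern_eq: "kern UNIV S = ssum (kern M S) (kern N S)"
proof
  show "kern UNIV S \<subseteq> ssum (kern M S) (kern N S)"
  proof
    fix x assume x: "x \<in> kern UNIV S"
    obtain m n where mn: "m \<in> M" "n \<in> N" "x = m + n" using span[of x] by blast
    have "S m + S n = 0 + 0" using x mn(3) by (simp add: kern_def clinear_add[OF X.clinS])
    then have "S m = 0 \<and> S n = 0"
      using sum_unique[of "S m" "S n" 0 0] invM[OF mn(1)] invN[OF mn(2)] csubspace_0[OF csubM] csubspace_0[OF csubN]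
      by blast
    then show "x \<in> ssum (kern M S) (kern N S)" using mn by (auto simp: kern_def)
  qed
qed (auto simp: kern_def clinear_add[OF X.clinS])

lemma rng_eq: "rng UNIV S = ssum (rng M S) (rng N S)"
proof
  show "rng UNIV S \<subseteq> ssum (rng M S) (rng N S)"
  proof
    fix y assume "y \<in> rng UNIV S"
    then obtain x where "y = S x" by (auto simp: rng_def)
    moreover obtain m n where "m \<in> M" "n \<in> N" "x = m + n" using span[of x] by blast
    ultimately show "y \<in> ssum (rng M S) (rng N S)" by (auto simp: rng_def clinear_add[OF X.clinS])
  qed
  show "ssum (rng M S) (rng N S) \<subseteq> rng UNIV S"
    by (auto simp: rng_def clinear_add[OF X.clinS, symmetric])
qed

lemma kern_M_eq: "kern M S = kern UNIV S \<inter> M"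
  by (auto simp: kern_def)

lemma rng_M_eq: "rng M S = rng UNIV S \<inter> M"
  and rng_N_eq: "rng N S = rng UNIV S \<inter> N"
proof -
  have RM: "rng M S \<subseteq> M" "0 \<in> rng M S" and RN: "rng N S \<subseteq> N" "0 \<in> rng N S"
    using M.rng_subset[of 1] N.rng_subset[of 1] csubspace_0[OF M.csub_rng[of 1]] csubspace_0[OF N.csub_rng[of 1]]
    by simp_all
  have sub: "rng M S \<subseteq> rng UNIV S" "rng N S \<subseteq> rng UNIV S" by (auto simp: rng_def)
  have *: "(x \<in> M \<longrightarrow> x \<in> rng M S) \<and> (x \<in> N \<longrightarrow> x \<in> rng N S)" if "x \<in> rng UNIV S" for x
  proof -
    obtain m n where mn: "m \<in> rng M S" "n \<in> rng N S" "x = m + n" using \<open>x \<in> rng UNIV S\<close> unfolding rng_eq by blast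
    have 1: "m \<in> M" "n \<in> N" using mn RM RN by auto
    have "x = m" if "x \<in> M"
      using sum_unique[of x 0 m n] that mn(3) 1 csubspace_0[OF csubN] by simp
    moreover have "x = n" if "x \<in> N"
      using sum_unique[of 0 x m n] that mn(3) 1 csubspace_0[OF csubM] by simp
    ultimately show ?thesis using mn by blast
  qed
  show "rng M S = rng UNIV S \<inter> M" "rng N S = rng UNIV S \<inter> N" using * RM RN sub by blast+
qed

text \<open>Additivity along \<open>U' + Z' \<subseteq> U' + Z \<subseteq> U + Z\<close>: directness
  of the sum makes each of the two quotients that of a single summand.\<close>

lemma qdim_ssum:
  assumes U: "csubspace U" "U \<subseteq> M" "csubspace U'" "U' \<subseteq> U"
    and Z: "csubspace Z" "Z \<subseteq> N" "csubspace Z'" "Z' \<subseteq> Z"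
  shows "qdim (ssum U Z) (ssum U' Z') = qdim U U' + qdim Z Z'"
proof -
  have z: "0 \<in> U" "0 \<in> U'" "0 \<in> Z" "0 \<in> Z'" using U Z csubspace_0 by blast+
  have s: "csubspace (ssum U Z)" "csubspace (ssum U' Z)" "csubspace (ssum U' Z')"
    by (intro csubspace_sums U Z)+
  have i: "ssum U' Z' \<subseteq> ssum U' Z" "ssum U' Z \<subseteq> ssum U Z" using U(4) Z(4) by blast+
  have "qdim U U' = qdim (ssum U Z) (ssum U' Z)"
  proof (rule qdim_transfer[where f = "\<lambda>x. x", OF U(1,3,4) s(1,2) i(2) clinear_id])
    show "x \<in> ssum U Z" if "x \<in> U" for x using that z(3) by force
    show "\<exists>x\<in>U. y - x \<in> ssum U' Z" if y: "y \<in> ssum U Z" for y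
    proof -
      obtain u w where "u \<in> U" "w \<in> Z" "y = u + w" using y by blast
      then show ?thesis using z(2) by (intro bexI[of _ u]) force+
    qed
    show "x \<in> ssum U' Z \<longleftrightarrow> x \<in> U'" if x: "x \<in> U" for x
    proof
      assume "x \<in> ssum U' Z"
      then obtain u w where uw: "u \<in> U'" "w \<in> Z" "x = u + w" by blast
      have "x = u \<and> 0 = w" by (rule sum_unique) (use uw x U Z z in auto)
      then show "x \<in> U'" using uw by simp
    next
      assume "x \<in> U'" then show "x \<in> ssum U' Z" using z(3) by force
    qed
  qed
  moreover have "qdim Z Z' = qdim (ssum U' Z) (ssum U' Z')"
  proof (rule qdim_transfer[where f = "\<lambda>x. x", OF Z(1,3,4) s(2,3) i(1) clinear_id])
    show "x \<in> ssum U' Z" if "x \<in> Z" for x using that z(2) by force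
    show "\<exists>x\<in>Z. y - x \<in> ssum U' Z'" if y: "y \<in> ssum U' Z" for y
    proof -
      obtain u w where "u \<in> U'" "w \<in> Z" "y = u + w" using y by blast
      then show ?thesis using z(4) by (intro bexI[of _ w]) force+
    qed
    show "x \<in> ssum U' Z' \<longleftrightarrow> x \<in> Z'" if x: "x \<in> Z" for x
    proof
      assume "x \<in> ssum U' Z'"
      then obtain u w where uw: "u \<in> U'" "w \<in> Z'" "x = u + w" by blast
      have "0 = u \<and> x = w" by (rule sum_unique) (use uw x U Z z in auto)
      then show "x \<in> Z'" using uw by simp
    next
      assume "x \<in> Z'" then show "x \<in> ssum U' Z'" using z(2) by force
    qed
  qed
  ultimately show ?thesis using qdim_add[OF s(1,3) i(1) s(2) i(2)] by simp
qed

lemma qdim_kern_add: "qdim (kern UNIV S) {0} = qdim (kern M S) {0} + qdim (kern N S) {0}"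
proof -
  have "qdim (ssum (kern M S) (kern N S)) (ssum {0} {0}) = qdim (kern M S) {0} + qdim (kern N S) {0}"
    using csubspace_kern[OF M.clinS csubM] csubspace_kern[OF N.clinS csubN] csubspace_0
    by (intro qdim_ssum) (auto simp: kern_def clinear_0[OF M.clinS])
  moreover have "ssum {0} {0::'a} = {0}" by auto
  ultimately show ?thesis unfolding kern_eq by simp
qed

lemma qdim_rng_add: "qdim UNIV (rng UNIV S) = qdim M (rng M S) + qdim N (rng N S)"
  unfolding rng_eq using UNIV_eq M.csub_rng[of 1] N.csub_rng[of 1] M.rng_subset[of 1] N.rng_subset[of 1] csubM csubN
  by (subst UNIV_eq, intro qdim_ssum) auto

text \<open>The ranges on the summands are intersections of the full range with \<open>M\<close> and
  \<open>N\<close>. Conversely, the projections are bounded by \<open>C\<close>, so addition on the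
  product of the two ranges has a lift with constant \<open>2 * C\<close> and therefore a closed
  image.\<close>

lemma closed_rng_iff: "closed (rng UNIV S) \<longleftrightarrow> closed (rng M S) \<and> closed (rng N S)"
proof
  assume "closed (rng UNIV S)"
  then show "closed (rng M S) \<and> closed (rng N S)"
    unfolding rng_M_eq rng_N_eq using closedM closedN by auto
next
  assume cl: "closed (rng M S) \<and> closed (rng N S)"
  have RM: "rng M S \<subseteq> M" "subspace (rng M S)" and RN: "rng N S \<subseteq> N" "subspace (rng N S)"
    using M.rng_subset[of 1] N.rng_subset[of 1] M.csub_rng[of 1] N.csub_rng[of 1]
    by (auto intro: csubspace_imp_subspace)
  obtain C where C: "C > 0" "\<forall>m\<in>M. \<forall>n\<in>N. norm m \<le> C * norm (m + n) \<and> norm n \<le> C * norm (m + n)"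
    using direct_sum_bound[OF closedM M.subV closedN N.subV disj] UNIV_eq by (metis closed_UNIV)
  let ?f = "\<lambda>p::'a \<times> 'a. fst p + snd p"
  have "closed (?f ` (rng M S \<times> rng N S))"
  proof (rule lift_imp_closed_image)
    show "bounded_linear ?f" by (intro bounded_linear_add bounded_linear_fst bounded_linear_snd)
    show "closed (rng M S \<times> rng N S)" using cl by (simp add: closed_Times)
    show "subspace (rng M S \<times> rng N S)" by (intro subspace_Times RM RN)
    show "0 \<le> 2 * C" using C(1) by simp
    fix y assume "y \<in> ?f ` (rng M S \<times> rng N S)"
    then obtain m n where mn: "m \<in> rng M S" "n \<in> rng N S" "y = m + n" by auto
    have "norm (m, n) \<le> norm m + norm n" by (simp add: norm_Pair sqrt_sum_squares_le_sum)
    moreover have "norm m \<le> C * norm y \<and> norm n \<le> C * norm y" using C(2) mn RM RN by blast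
    ultimately have "norm (m, n) \<le> 2 * C * norm y" by linarith
    then show "\<exists>x\<in>rng M S \<times> rng N S. ?f x = y \<and> norm x \<le> 2 * C * norm y"
      using mn by (intro bexI[of _ "(m, n)"]) auto
  qed
  moreover have "?f ` (rng M S \<times> rng N S) = ssum (rng M S) (rng N S)" by force
  ultimately show "closed (rng UNIV S)" unfolding rng_eq by simp
qed

lemma Phi_plus_reducing_iff: "Phi_plus UNIV S \<longleftrightarrow> Phi_plus M S \<and> Phi_plus N S"
  unfolding X.Phi_plus_iff M.Phi_plus_iff N.Phi_plus_iff qdim_kern_add closed_rng_iff plus_eq_infty_iff_enat by argo

lemma Phi_minus_reducing_iff: "Phi_minus UNIV S \<longleftrightarrow> Phi_minus M S \<and> Phi_minus N S"
  unfolding X.Phi_minus_iff M.Phi_minus_iff N.Phi_minus_iff qdim_rng_add plus_eq_infty_iff_enat by argo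

lemma finite_ascent_M: "finite_ascent UNIV S \<Longrightarrow> finite_ascent M S"
  unfolding finite_ascent_def by (auto simp: reducing_pair.kern_M_eq[OF reducing_pair_funpow] simp del: funpow.simps)

lemma finite_descent_M: "finite_descent UNIV S \<Longrightarrow> finite_descent M S"
  unfolding finite_descent_def by (auto simp: reducing_pair.rng_M_eq[OF reducing_pair_funpow] simp del: funpow.simps)

lemma finite_ascent_if_inj_M:
  assumes M: "kern M S = {0}" and N: "finite_ascent N S"
  shows "finite_ascent UNIV S"
proof -
  have M0: "kern M (S ^^ n) = {0}" for n
  proof (induction n)
    case 0
    show ?case using csubspace_0[OF csubM] by (auto simp: kern_def)
  next
    case (Suc n)
    have "x = 0" if "x \<in> kern M (S ^^ Suc n)" for x
    proof -
      have "S x \<in> kern M (S ^^ n)" using that invM by (simp add: kern_def funpow_swap1)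
      then have "S x = 0" using Suc by simp
      then have "x \<in> kern M S" using that by (simp add: kern_def)
      then show "x = 0" using M by simp
    qed
    then show ?case using csubspace_0[OF M.csub_kern] by blast
  qed
  obtain p where p: "kern N (S ^^ p) = kern N (S ^^ Suc p)" using N unfolding finite_ascent_def by blast
  have "kern UNIV (S ^^ p) = kern UNIV (S ^^ Suc p)"
    unfolding reducing_pair.kern_eq[OF reducing_pair_funpow] M0 p ..
  then show ?thesis unfolding finite_ascent_def by blast
qed

lemma finite_descent_if_surj_M:
  assumes M: "rng M S = M" and N: "finite_descent N S"
  shows "finite_descent UNIV S"
proof -
  have M0: "rng M (S ^^ n) = M" for n
  proof (induction n)
    case (Suc n)
    have "rng M (S ^^ Suc n) = rng (rng M (S ^^ n)) S" by (simp only: rng_rng)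
    then show ?case by (simp only: Suc.IH M)
  qed (simp add: rng_def)
  obtain p where p: "rng N (S ^^ p) = rng N (S ^^ Suc p)" using N unfolding finite_descent_def by blast
  have "rng UNIV (S ^^ p) = rng UNIV (S ^^ Suc p)"
    unfolding reducing_pair.rng_eq[OF reducing_pair_funpow] M0 p ..
  then show ?thesis unfolding finite_descent_def by blast
qed

end

section \<open>The disc around a point outside the generalized Kato-Riesz spectrum\<close>

text \<open>\<open>a = 0\<close> must be allowed, since a frontier point may itself lie outside
  \<open>A\<close>; \<open>b\<close> is nonzero because it comes from accumulation.\<close>

lemma frontier_acc_nearby:
  assumes "z \<in> frontier A" "z \<in> acc B" "e > 0"
  obtains a b where "cmod a < e" "z + a \<notin> A" "b \<noteq> 0" "cmod b < e" "z + b \<in> B"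
proof -
  have "\<not> ball z e \<subseteq> A"
  proof
    assume "ball z e \<subseteq> A"
    then have "z \<in> interior A" using assms(3) by (auto simp: interior_def)
    then show False using assms(1) by (simp add: frontier_def)
  qed
  then obtain u where "u \<in> ball z e" and uA: "u \<notin> A" by blast
  then have u: "dist z u < e" by simp
  obtain v where v: "v \<in> B" "v \<noteq> z" "dist v z < e"
    using assms(2,3) unfolding acc_def islimpt_approachable by blast
  show thesis
    by (rule that[of "u - z" "v - z"]) (use u uA v in \<open>auto simp: dist_norm norm_minus_commute\<close>)
qed

locale Kato_Riesz = reducing_pair +
  fixes e :: real
  assumes Riesz_N: "Riesz N S" and e_pos: "e > 0"
    and pert: "cmod l < e \<Longrightarrow> Kato M (shiftop S l) \<and>
      qdim (kern M (shiftop S l)) {0} = qdim (kern M S) {0} \<and>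
      qdim M (rng M (shiftop S l)) = qdim M (rng M S)"
begin

text \<open>For \<open>l \<noteq> 0\<close> the Riesz condition makes the part on \<open>N\<close>
  Fredholm; at \<open>l = 0\<close> its semi-Fredholm property is inherited from the whole
  operator.\<close>

lemma Browder_N:
  assumes "l \<noteq> 0 \<or> Phi_plus UNIV (shiftop S l) \<or> Phi_minus UNIV (shiftop S l)"
  shows "Browder N (shiftop S l) \<and> qdim (kern N (shiftop S l)) {0} = qdim N (rng N (shiftop S l))"
proof (rule N.Riesz_imp_Browder[OF Riesz_N])
  interpret l: reducing_pair M N "shiftop S l" by (rule reducing_pair_shiftop)
  have "l \<noteq> 0 \<Longrightarrow> Phi N (shiftop S l)" using Riesz_N by (simp add: Riesz_def shiftop_def)
  then show "Phi_plus N (shiftop S l) \<or> Phi_minus N (shiftop S l)"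
    using assms unfolding Phi_def l.Phi_plus_reducing_iff l.Phi_minus_reducing_iff by blast
qed

context
  fixes l assumes l: "cmod l < e"
begin

interpretation l: reducing_pair M N "shiftop S l"
  by (rule reducing_pair_shiftop)

text \<open>This and the next five lemmas read the two numbers on \<open>M\<close> off any point of
  the disc, the centre included. The lemmas from \<open>Phi_plusI\<close> to
  \<open>finite_descentI\<close> return from the numbers to the operator, for
  \<open>l \<noteq> 0\<close>, where the part on \<open>N\<close> is Browder.\<close>

lemma finite_kern: "Phi_plus UNIV (shiftop S l) \<Longrightarrow> qdim (kern M S) {0} \<noteq> \<infinity>"
  using pert[OF l] by (simp add: l.Phi_plus_reducing_iff l.M.Phi_plus_iff)

lemma finite_corng: "Phi_minus UNIV (shiftop S l) \<Longrightarrow> qdim M (rng M S) \<noteq> \<infinity>"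
  using pert[OF l] by (simp add: l.Phi_minus_reducing_iff l.M.Phi_minus_iff)

lemma kern_zero: "finite_ascent UNIV (shiftop S l) \<Longrightarrow> qdim (kern M S) {0} = 0"
  using pert[OF l] l.M.Kato_finite_ascent_imp_inj l.finite_ascent_M l.M.qdim_kern_eq_0_iff by metis

lemma corng_zero: "finite_descent UNIV (shiftop S l) \<Longrightarrow> qdim M (rng M S) = 0"
  using pert[OF l] l.M.Kato_finite_descent_imp_surj l.finite_descent_M l.M.qdim_rng_eq_0_iff by metis

lemma kern_zero_if_inj: "kern UNIV (shiftop S l) = {0} \<Longrightarrow> qdim (kern M S) {0} = 0"
  using pert[OF l] l.M.qdim_kern_eq_0_iff l.kern_M_eq csubspace_0[OF csubM] by auto

lemma corng_zero_if_surj: "rng UNIV (shiftop S l) = UNIV \<Longrightarrow> qdim M (rng M S) = 0"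
  using pert[OF l] l.M.qdim_rng_eq_0_iff l.rng_M_eq by auto

lemma Phi_plusI: "l \<noteq> 0 \<Longrightarrow> qdim (kern M S) {0} \<noteq> \<infinity> \<Longrightarrow> Phi_plus UNIV (shiftop S l)"
  using pert[OF l] Browder_N[of l]
  by (auto simp: l.Phi_plus_reducing_iff l.M.Phi_plus_iff Kato_def Browder_def Phi_def)

lemma Phi_minusI: "l \<noteq> 0 \<Longrightarrow> qdim M (rng M S) \<noteq> \<infinity> \<Longrightarrow> Phi_minus UNIV (shiftop S l)"
  using pert[OF l] Browder_N[of l]
  by (auto simp: l.Phi_minus_reducing_iff l.M.Phi_minus_iff Browder_def Phi_def)

lemma finite_ascentI: "l \<noteq> 0 \<Longrightarrow> qdim (kern M S) {0} = 0 \<Longrightarrow> finite_ascent UNIV (shiftop S l)"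
  using pert[OF l] Browder_N[of l] l.M.qdim_kern_eq_0_iff
  by (intro l.finite_ascent_if_inj_M) (auto simp: Browder_def)

lemma finite_descentI: "l \<noteq> 0 \<Longrightarrow> qdim M (rng M S) = 0 \<Longrightarrow> finite_descent UNIV (shiftop S l)"
  using pert[OF l] Browder_N[of l] l.M.qdim_rng_eq_0_iff
  by (intro l.finite_descent_if_surj_M) (auto simp: Browder_def)

text \<open>On \<open>N\<close> kernel dimension and codimension equal the same finite
  \<open>k\<close>, and a finite summand may be cancelled in \<open>enat\<close> even if the terms
  from \<open>M\<close> are infinite.\<close>

lemma index_le_iff:
  assumes "l \<noteq> 0 \<or> Phi_plus UNIV (shiftop S l) \<or> Phi_minus UNIV (shiftop S l)"
  shows "qdim (kern UNIV (shiftop S l)) {0} \<le> qdim UNIV (rng UNIV (shiftop S l)) \<longleftrightarrow>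
      qdim (kern M S) {0} \<le> qdim M (rng M S)"
    and "qdim UNIV (rng UNIV (shiftop S l)) \<le> qdim (kern UNIV (shiftop S l)) {0} \<longleftrightarrow>
      qdim M (rng M S) \<le> qdim (kern M S) {0}"
proof -
  have b: "qdim (kern N (shiftop S l)) {0} = qdim N (rng N (shiftop S l))" "qdim N (rng N (shiftop S l)) \<noteq> \<infinity>"
    using Browder_N[OF assms] by (auto simp: Browder_def Phi_def l.N.Phi_minus_iff)
  then obtain k where k: "qdim (kern N (shiftop S l)) {0} = enat k" "qdim N (rng N (shiftop S l)) = enat k" by auto
  have cancel: "a + enat k \<le> b + enat k \<longleftrightarrow> a \<le> b" for a b by (cases a; cases b) auto
  have M: "qdim (kern M (shiftop S l)) {0} = qdim (kern M S) {0}" "qdim M (rng M (shiftop S l)) = qdim M (rng M S)"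
    using pert[OF l] by simp_all
  show "qdim (kern UNIV (shiftop S l)) {0} \<le> qdim UNIV (rng UNIV (shiftop S l)) \<longleftrightarrow>
      qdim (kern M S) {0} \<le> qdim M (rng M S)"
    "qdim UNIV (rng UNIV (shiftop S l)) \<le> qdim (kern UNIV (shiftop S l)) {0} \<longleftrightarrow>
      qdim M (rng M S) \<le> qdim (kern M S) {0}"
    unfolding l.qdim_kern_add l.qdim_rng_add k M cancel by (rule refl)+
qed

end

text \<open>Each class is a conjunction of semi-Fredholm, ascent, descent and index conditions; each
  condition passes from \<open>a\<close> to \<open>b\<close> through the numbers on
  \<open>M\<close>.\<close>

lemma propagate:
  assumes R: "R \<in> {B_plus, B_minus, Browder, Phi_plus, Phi_minus, Phi, W_plus, W_minus, W}"
    and a: "cmod a < e" "R UNIV (shiftop S a)" and b: "b \<noteq> 0" "cmod b < e"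
  shows "R UNIV (shiftop S b)"
proof -
  interpret a: reducing_pair M N "shiftop S a" by (rule reducing_pair_shiftop)
  interpret b: reducing_pair M N "shiftop S b" by (rule reducing_pair_shiftop)
  have plus: "Phi_plus UNIV (shiftop S b)" if "Phi_plus UNIV (shiftop S a)"
    using Phi_plusI[OF b(2,1) finite_kern[OF a(1) that]] .
  have minus: "Phi_minus UNIV (shiftop S b)" if "Phi_minus UNIV (shiftop S a)"
    using Phi_minusI[OF b(2,1) finite_corng[OF a(1) that]] .
  have asc: "finite_ascent UNIV (shiftop S b)" if "finite_ascent UNIV (shiftop S a)"
    using finite_ascentI[OF b(2,1) kern_zero[OF a(1) that]] .
  have desc: "finite_descent UNIV (shiftop S b)" if "finite_descent UNIV (shiftop S a)"
    using finite_descentI[OF b(2,1) corng_zero[OF a(1) that]] .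
  have b': "b \<noteq> 0 \<or> Phi_plus UNIV (shiftop S b) \<or> Phi_minus UNIV (shiftop S b)" using b by blast
  consider "R = B_plus" | "R = B_minus" | "R = Browder" | "R = Phi_plus" | "R = Phi_minus" | "R = Phi"
    | "R = W_plus" | "R = W_minus" | "R = W" using R by blast
  then show ?thesis
  proof cases
    case 1 then show ?thesis using a(2) plus asc by (simp add: B_plus_def)
  next
    case 2 then show ?thesis using a(2) minus desc by (simp add: B_minus_def)
  next
    case 3 then show ?thesis using a(2) plus minus asc desc by (simp add: Browder_def Phi_def)
  next
    case 4 then show ?thesis using a(2) plus by simp
  next
    case 5 then show ?thesis using a(2) minus by simp
  next
    case 6 then show ?thesis using a(2) plus minus by (simp add: Phi_def)
  next
    case 7
    have "Phi_plus UNIV (shiftop S a)"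
      "qdim (kern UNIV (shiftop S a)) {0} \<le> qdim UNIV (rng UNIV (shiftop S a))"
      using a(2) unfolding 7 a.X.W_plus_iff by blast+
    then show ?thesis
      unfolding 7 b.X.W_plus_iff
      using plus index_le_iff(1)[OF a(1)] index_le_iff(1)[OF b(2) b'] by blast
  next
    case 8
    have "Phi_minus UNIV (shiftop S a)"
      "qdim UNIV (rng UNIV (shiftop S a)) \<le> qdim (kern UNIV (shiftop S a)) {0}"
      using a(2) unfolding 8 a.X.W_minus_iff by blast+
    then show ?thesis
      unfolding 8 b.X.W_minus_iff
      using minus index_le_iff(2)[OF a(1)] index_le_iff(2)[OF b(2) b'] by blast
  next
    case 9
    have "Phi_plus UNIV (shiftop S a)" "Phi_minus UNIV (shiftop S a)"
      "qdim (kern UNIV (shiftop S a)) {0} \<le> qdim UNIV (rng UNIV (shiftop S a))"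
      "qdim UNIV (rng UNIV (shiftop S a)) \<le> qdim (kern UNIV (shiftop S a)) {0}"
      using a(2) unfolding 9 a.X.W_iff Phi_def by simp_all
    then show ?thesis
      unfolding 9 b.X.W_iff Phi_def order_eq_iff[of "qdim _ _"]
      using plus minus index_le_iff[OF a(1)] index_le_iff[OF b(2) b'] by blast
  qed
qed

text \<open>Injectivity at \<open>a\<close> makes the kernel dimension on \<open>M\<close> zero,
  which gives finite ascent at \<open>b\<close>. Closed range at \<open>b\<close> comes from the
  Kato part and the Browder part, not from \<open>a\<close>.\<close>

lemma B_plus_if_inj:
  assumes "cmod a < e" "kern UNIV (shiftop S a) = {0}" "b \<noteq> 0" "cmod b < e"
  shows "B_plus UNIV (shiftop S b)"
  using kern_zero_if_inj[OF assms(1,2)] Phi_plusI[OF assms(4,3)] finite_ascentI[OF assms(4,3)]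
  by (simp add: B_plus_def)

lemma B_minus_if_surj:
  assumes "cmod a < e" "rng UNIV (shiftop S a) = UNIV" "b \<noteq> 0" "cmod b < e"
  shows "B_minus UNIV (shiftop S b)"
  using corng_zero_if_surj[OF assms(1,2)] Phi_minusI[OF assms(4,3)] finite_descentI[OF assms(4,3)]
  by (simp add: B_minus_def)

end

lemma Kato_Riesz_if_notin_sigma_gKR:
  assumes T: "bounded_clinear T" and z: "z \<notin> sigma_gKR T"
  shows "\<exists>M N e. Kato_Riesz M N (shiftop T z) e"
proof -
  obtain M N where MN: "closed M" "closed N" "csubspace M" "csubspace N"
       "shiftop T z ` M \<subseteq> M" "shiftop T z ` N \<subseteq> N"
       "M \<inter> N = {0}" "\<forall>x. \<exists>m\<in>M. \<exists>n\<in>N. x = m + n"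
       "Kato M (shiftop T z)" "Riesz N (shiftop T z)"
    using z unfolding sigma_gKR_def by blast
  interpret reducing_pair M N "shiftop T z"
    by unfold_locales (use MN bounded_clinear_shiftop[OF T] in auto)
  obtain e where "e > 0" "\<forall>l. cmod l < e \<longrightarrow> Kato M (shiftop (shiftop T z) l) \<and>
    qdim (kern M (shiftop (shiftop T z) l)) {0} = qdim (kern M (shiftop T z)) {0} \<and>
    qdim M (rng M (shiftop (shiftop T z) l)) = qdim M (rng M (shiftop T z))"
    using M.Kato_perturbation[OF MN(9)] by blast
  then have "Kato_Riesz M N (shiftop T z) e"
    using MN(10) by unfold_locales auto
  then show ?thesis by blast
qed

theorem theorem3p15:
  fixes T :: "'a::complex_banach \<Rightarrow> 'a"
  assumes "\<not> cfinite_dim (UNIV :: 'a set)"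
    and "bounded_clinear T"
  shows "(\<forall>R \<in> {B_plus, B_minus, Browder, Phi_plus, Phi_minus, Phi, W_plus, W_minus, W}.
            frontier (sigma_R R T) \<inter> acc (sigma_R R T) \<subseteq> sigma_gKR T)
       \<and> frontier (sigma_ap T) \<inter> acc (sigma_R B_plus T) \<subseteq> sigma_gKR T
       \<and> frontier (sigma_su T) \<inter> acc (sigma_R B_minus T) \<subseteq> sigma_gKR T
       \<and> frontier (spectrum T) \<inter> acc (sigma_R Browder T) \<subseteq> sigma_gKR T"
proof -
  \<comment> \<open>\<open>A\<close> carries the frontier and \<open>R\<close> the accumulation: in
    the first nine inclusions \<open>A\<close> is \<open>sigma_R R T\<close>, in the last three it
    is a different spectrum.\<close>
  have main: "frontier A \<inter> acc (sigma_R R T) \<subseteq> sigma_gKR T"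
    if step: "\<And>z M N e a b. Kato_Riesz M N (shiftop T z) e \<Longrightarrow> cmod a < e \<Longrightarrow> z + a \<notin> A \<Longrightarrow>
      b \<noteq> 0 \<Longrightarrow> cmod b < e \<Longrightarrow> R UNIV (shiftop (shiftop T z) b)"
    for A and R :: "'a set \<Rightarrow> ('a \<Rightarrow> 'a) \<Rightarrow> bool"
  proof
    fix z assume z: "z \<in> frontier A \<inter> acc (sigma_R R T)"
    show "z \<in> sigma_gKR T"
    proof (rule ccontr)
      assume "z \<notin> sigma_gKR T"
      then obtain M N e where KR: "Kato_Riesz M N (shiftop T z) e"
        using Kato_Riesz_if_notin_sigma_gKR[OF assms(2)] by blast
      then have "e > 0" by (rule Kato_Riesz.e_pos)
      with z obtain a b where "cmod a < e" "z + a \<notin> A" "b \<noteq> 0" "cmod b < e" "z + b \<in> sigma_R R T"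
        using frontier_acc_nearby[of z A "sigma_R R T" e] by auto
      then show False using step[OF KR, of a b] by (simp add: sigma_R_def shiftop_shiftop)
    qed
  qed
  have inj: "kern UNIV f = {0}" if "f 0 = (0::'a)" "\<And>x. f x = 0 \<Longrightarrow> x = 0" for f
    using that by (auto simp: kern_def)
  have sh0: "shiftop T l 0 = 0" for l
    using bounded_clinear_shiftop[OF assms(2), of l] by (intro clinear_0 bounded_clinear_imp_clinear)
  show ?thesis
  proof (intro conjI ballI)
    fix R :: "'a set \<Rightarrow> ('a \<Rightarrow> 'a) \<Rightarrow> bool" assume R: "R \<in> {B_plus, B_minus, Browder, Phi_plus, Phi_minus, Phi, W_plus, W_minus, W}"
    show "frontier (sigma_R R T) \<inter> acc (sigma_R R T) \<subseteq> sigma_gKR T"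
      by (rule main, rule Kato_Riesz.propagate[OF _ R]) (auto simp: sigma_R_def shiftop_shiftop)
  next
    show "frontier (sigma_ap T) \<inter> acc (sigma_R B_plus T) \<subseteq> sigma_gKR T"
    proof (rule main, rule Kato_Riesz.B_plus_if_inj)
      fix z a assume "z + a \<notin> sigma_ap T"
      then obtain c where c: "c > 0" "\<And>x. c * norm x \<le> norm (shiftop T (z + a) x)"
        unfolding sigma_ap_def by blast
      have "x = 0" if "shiftop T (z + a) x = 0" for x
        using c(2)[of x] that c(1) by (simp add: mult_le_0_iff)
      then show "kern UNIV (shiftop (shiftop T z) a) = {0}"
        unfolding shiftop_shiftop by (intro inj sh0)
    qed
  next
    show "frontier (sigma_su T) \<inter> acc (sigma_R B_minus T) \<subseteq> sigma_gKR T"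
      by (rule main, rule Kato_Riesz.B_minus_if_surj) (auto simp: sigma_su_def shiftop_shiftop rng_def)
  next
    show "frontier (spectrum T) \<inter> acc (sigma_R Browder T) \<subseteq> sigma_gKR T"
    proof (rule main)
      fix z M N e a b
      assume KR: "Kato_Riesz M N (shiftop T z) e" and a: "cmod a < e" "z + a \<notin> spectrum T"
        and b: "b \<noteq> 0" "cmod b < e"
      obtain G where G: "G \<circ> shiftop T (z + a) = id" "shiftop T (z + a) \<circ> G = id"
        using a(2) unfolding spectrum_def by blast
      have G': "G (shiftop T (z + a) x) = x" "shiftop T (z + a) (G x) = x" for x
        using G by (simp_all add: fun_eq_iff)
      have "x = 0" if "shiftop T (z + a) x = 0" for x
        using that G'(1)[of x] G'(1)[of 0] sh0 by simp
      then have "kern UNIV (shiftop (shiftop T z) a) = {0}"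
        unfolding shiftop_shiftop by (intro inj sh0)
      moreover have "surj (shiftop T (z + a))" using G'(2) by (metis surjI)
      then have "rng UNIV (shiftop (shiftop T z) a) = UNIV" unfolding shiftop_shiftop rng_def .
      \<comment> \<open>An invertible point is both injective and surjective, and
        \<open>B_plus\<close> together with \<open>B_minus\<close> is exactly
        \<open>Browder\<close>.\<close>
      ultimately show "Browder UNIV (shiftop (shiftop T z) b)"
        using Kato_Riesz.B_plus_if_inj[OF KR a(1) _ b] Kato_Riesz.B_minus_if_surj[OF KR a(1) _ b]
        by (simp add: B_plus_def B_minus_def Browder_def Phi_def)
    qed
  qed
qed

end
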